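(* Let $U$ be a $\mathbf{B}_1$-module and $V$ a $\mathbf{B}_r$-module with $V(\emptyset)=\{0\}$. Then $\mathrm{ch}(U\circ V)=\mathrm{ch}(U)\circ\mathrm{ch}(V)$, where $\circ$ on the right is the plethysm $\mathbb{A}(1)\times\mathbb{A}(r)_+\to\mathbb{A}(r)$. Consequently, if $A$ is a species and $B$ an $r$-species with $B(\emptyset)=\emptyset$, then $Z_{A\circ B}=Z_A\circ Z_B$.
   Context: $\mu_r$, $W(r,n)=\mu_r\wr S_n$, $\mathbf{B}_r$ = category of finite sets with free $\mu_r$-action and equivariant bijections ($\mathbf{B}_1$ = finite sets and bijections), $[n]_r=\mu_r\times\{1,\dots,n\}$. A $\mathbf{B}_r$-module is a functor $\mathbf{B}_r\to$ finite-dimensional complex vector spaces; its characteristic is $\mathrm{ch}(U)=\sum_n\frac{1}{r^nn!}\sum_{w\in W(r,n)}\mathrm{tr}(w,U([n]_r))p_w\in\mathbb{A}(r)=\mathbb{C}[[p_i(\zeta)]]$, with $p_w=\prod p_i(\zeta)^{a_i(\zeta)}$ ($a_i(\zeta)$ = number of cycles of length $i$ and type $\zeta$). An $r$-species is a functor $A:\mathbf{B}_r\to\mathbf{B}_1$, with cycle index $Z_A=\mathrm{ch}(\mathbb{C}^{A(-)})$. For a $\mathbf{B}_1$-module $U$ and $\mathbf{B}_r$-module $V$, $(U\circ V)(I)=\bigoplus_{\pi}\bigl(U(\pi)\otimes\bigotimes_{J\in\pi}V(J)\bigr)$, summed over partitions $\pi$ of $I$ into nonempty blocks each of which is $\mu_r$-stable;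 similarly $(A\circ B)(I)=\coprod_\pi A(\pi)\times\prod_{J\in\pi}B(J)$. Here the plethysm $\circ:\mathbb{A}(1)\times\mathbb{A}(r)_+\to\mathbb{A}(r)$ is the unique operation such that $f\mapsto f\circ g$ is a continuous algebra homomorphism, $g\mapsto p_i\circ g$ is a continuous algebra homomorphism, and $p_i\circ p_j(\zeta)=p_{ij}(\zeta)$. *)

theory Defs
  imports Complex_Main "HOL-Library.Multiset" "HOL-Library.Disjoint_Sets" "HOL-Library.FuncSet"
begin

text \<open>A functor to finite-dimensional complex vector spaces is encoded by a finite basis
  for each object and, for each morphism f : I -> f`I, the matrix of the induced linear map
  (entry (b', b) with b in the basis of I and b' in the basis of f`I).\<close>

record ('a, 'b) bmod =
  basis :: "'a set \<Rightarrow> 'b set"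
  mat :: "('a \<Rightarrow> 'a) \<Rightarrow> 'a set \<Rightarrow> 'b \<Rightarrow> 'b \<Rightarrow> complex"

record ('a, 'c) spec =
  sset :: "'a set \<Rightarrow> 'c set"
  smap :: "('a \<Rightarrow> 'a) \<Rightarrow> 'a set \<Rightarrow> 'c \<Rightarrow> 'c"

definition is_module :: "('a set \<Rightarrow> bool) \<Rightarrow> ('a set \<Rightarrow> ('a \<Rightarrow> 'a) \<Rightarrow> bool) \<Rightarrow> ('a, 'b) bmod \<Rightarrow> bool" where
  "is_module obj hom M \<longleftrightarrow>
     (\<forall>I. obj I \<longrightarrow> finite (basis M I)) \<and>
     (\<forall>I f g. hom I f \<longrightarrow> (\<forall>x\<in>I. f x = g x) \<longrightarrow>
        (\<forall>b\<in>basis M I. \<forall>b'\<in>basis M (f ` I). mat M f I b' b = mat M g I b' b)) \<and>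
     (\<forall>I. obj I \<longrightarrow> (\<forall>b\<in>basis M I. \<forall>b'\<in>basis M I. mat M id I b' b = (if b' = b then 1 else 0))) \<and>
     (\<forall>I f g. hom I f \<longrightarrow> hom (f ` I) g \<longrightarrow>
        (\<forall>b\<in>basis M I. \<forall>b''\<in>basis M (g ` f ` I).
           mat M (g \<circ> f) I b'' b = (\<Sum>b'\<in>basis M (f ` I). mat M g (f ` I) b'' b' * mat M f I b' b)))"

definition is_species :: "('a set \<Rightarrow> bool) \<Rightarrow> ('a set \<Rightarrow> ('a \<Rightarrow> 'a) \<Rightarrow> bool) \<Rightarrow> ('a, 'c) spec \<Rightarrow> bool" where
  "is_species obj hom A \<longleftrightarrow>
     (\<forall>I. obj I \<longrightarrow> finite (sset A I)) \<and>
     (\<forall>I f. hom I f \<longrightarrow> bij_betw (smap A f I) (sset A I) (sset A (f ` I))) \<and>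
     (\<forall>I f g. hom I f \<longrightarrow> (\<forall>x\<in>I. f x = g x) \<longrightarrow> (\<forall>a\<in>sset A I. smap A f I a = smap A g I a)) \<and>
     (\<forall>I. obj I \<longrightarrow> (\<forall>a\<in>sset A I. smap A id I a = a)) \<and>
     (\<forall>I f g. hom I f \<longrightarrow> hom (f ` I) g \<longrightarrow>
        (\<forall>a\<in>sset A I. smap A (g \<circ> f) I a = smap A g (f ` I) (smap A f I a)))"

definition lin :: "('a, 'c) spec \<Rightarrow> ('a, 'c) bmod" where
  "lin A = \<lparr> basis = sset A, mat = (\<lambda>f I c' c. if smap A f I c = c' then 1 else 0) \<rparr>"

definition obj1 :: "'x set \<Rightarrow> bool" where "obj1 I \<longleftrightarrow> finite I"
definition hom1 :: "'x set \<Rightarrow> ('x \<Rightarrow> 'x) \<Rightarrow> bool" where "hom1 I f \<longleftrightarrow> finite I \<and> inj_on f I"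

definition roots :: "nat \<Rightarrow> complex set" where "roots r = {z. z ^ r = 1}"

text \<open>Ambient free mu_r-set: complex numbers (nonzero) times nat, mu_r acting on the first factor.\<close>
definition act :: "complex \<Rightarrow> complex \<times> nat \<Rightarrow> complex \<times> nat" where
  "act z x = (z * fst x, snd x)"

definition objr :: "nat \<Rightarrow> (complex \<times> nat) set \<Rightarrow> bool" where
  "objr r I \<longleftrightarrow> finite I \<and> (\<forall>x\<in>I. fst x \<noteq> 0) \<and> (\<forall>x\<in>I. \<forall>z\<in>roots r. act z x \<in> I)"

definition homr :: "nat \<Rightarrow> (complex \<times> nat) set \<Rightarrow> ((complex \<times> nat) \<Rightarrow> (complex \<times> nat)) \<Rightarrow> bool" where
  "homr r I f \<longleftrightarrow> objr r I \<and> objr r (f ` I) \<and> inj_on f I \<and>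
     (\<forall>x\<in>I. \<forall>z\<in>roots r. f (act z x) = act z (f x))"

definition comp_mod :: "nat \<Rightarrow> ((complex \<times> nat) set, 'u) bmod \<Rightarrow> (complex \<times> nat, 'v) bmod \<Rightarrow>
    (complex \<times> nat, (complex \<times> nat) set set \<times> 'u \<times> ((complex \<times> nat) set \<Rightarrow> 'v)) bmod" where
  "comp_mod r U V = \<lparr>
     basis = (\<lambda>I. {(\<pi>, u, \<sigma>). partition_on I \<pi> \<and> (\<forall>K\<in>\<pi>. objr r K) \<and> u \<in> basis U \<pi> \<and>
                       \<sigma> \<in> (\<Pi>\<^sub>E K\<in>\<pi>. basis V K)}),
     mat = (\<lambda>f I (\<pi>', u', \<sigma>') (\<pi>, u, \<sigma>).
              if \<pi>' = (\<lambda>K. f ` K) ` \<pi>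
              then mat U (\<lambda>K. f ` K) \<pi> u' u * (\<Prod>K\<in>\<pi>. mat V f K (\<sigma>' (f ` K)) (\<sigma> K))
              else 0) \<rparr>"

definition comp_sp :: "nat \<Rightarrow> ((complex \<times> nat) set, 'c) spec \<Rightarrow> (complex \<times> nat, 'd) spec \<Rightarrow>
    (complex \<times> nat, (complex \<times> nat) set set \<times> 'c \<times> ((complex \<times> nat) set \<Rightarrow> 'd)) spec" where
  "comp_sp r A B = \<lparr>
     sset = (\<lambda>I. {(\<pi>, a, \<sigma>). partition_on I \<pi> \<and> (\<forall>K\<in>\<pi>. objr r K) \<and> a \<in> sset A \<pi> \<and>
                       \<sigma> \<in> (\<Pi>\<^sub>E K\<in>\<pi>. sset B K)}),
     smap = (\<lambda>f I (\<pi>, a, \<sigma>).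
              ((\<lambda>K. f ` K) ` \<pi>, smap A (\<lambda>K. f ` K) \<pi> a,
               \<lambda>K'. if K' \<in> (\<lambda>K. f ` K) ` \<pi>
                     then smap B f (the_inv_into \<pi> (\<lambda>K. f ` K) K') (\<sigma> (the_inv_into \<pi> (\<lambda>K. f ` K) K'))
                     else undefined)) \<rparr>"

definition trace :: "('a, 'b) bmod \<Rightarrow> ('a \<Rightarrow> 'a) \<Rightarrow> 'a set \<Rightarrow> complex" where
  "trace M w I = (\<Sum>b\<in>basis M I. mat M w I b b)"

definition orb :: "('a \<Rightarrow> 'a) \<Rightarrow> 'a \<Rightarrow> 'a set" where
  "orb w x = {(w ^^ t) x | t. True}"

definition perms_on :: "'a set \<Rightarrow> ('a \<Rightarrow> 'a) set" where
  "perms_on I = {w. bij_betw w I I \<and> (\<forall>x. x \<notin> I \<longrightarrow> w x = x)}"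

text \<open>Cycle type of a permutation of I, as the multiset of cycle lengths (monomial p_w in A(1)).\<close>
definition cyc_type :: "('a \<Rightarrow> 'a) \<Rightarrow> 'a set \<Rightarrow> nat multiset" where
  "cyc_type w I = image_mset card (mset_set (orb w ` I))"

text \<open>Characteristic of a B_1-module, evaluated on an arbitrary n-element set
  (the trace is invariant under relabelling, so this equals evaluation on [n]).\<close>
definition ch1 :: "('x, 'b) bmod \<Rightarrow> nat multiset \<Rightarrow> complex" where
  "ch1 U \<mu> = (let n = sum_mset \<mu>; I = (SOME I :: 'x set. finite I \<and> card I = n)
             in (1 / fact n) * (\<Sum>w\<in>{w \<in> perms_on I. cyc_type w I = \<mu>}. trace U w I))"

definition stdset :: "nat \<Rightarrow> nat \<Rightarrow> (complex \<times> nat) set" where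
  "stdset r n = {(z, k). z \<in> roots r \<and> k \<in> {1..n}}"

definition wreath :: "nat \<Rightarrow> nat \<Rightarrow> ((complex \<times> nat) \<Rightarrow> (complex \<times> nat)) set" where
  "wreath r n = {w. homr r (stdset r n) w \<and> w ` stdset r n = stdset r n \<and>
                    (\<forall>x. x \<notin> stdset r n \<longrightarrow> w x = x)}"

text \<open>Signed cycle type of w in W(r,n): multiset of pairs (i, zeta) = cycles of length i and type zeta,
  i.e. the monomial p_w in A(r) (variable p_i(zeta) is the pair (i, zeta)).\<close>
definition wtype :: "nat \<Rightarrow> nat \<Rightarrow> ((complex \<times> nat) \<Rightarrow> (complex \<times> nat)) \<Rightarrow> (nat \<times> complex) multiset" where
  "wtype r n w = (let \<sigma> = (\<lambda>k. snd (w (1, k)))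
     in image_mset (\<lambda>C. (card C, fst ((w ^^ card C) (1, Min C)))) (mset_set (orb \<sigma> ` {1..n})))"

definition chr :: "nat \<Rightarrow> (complex \<times> nat, 'b) bmod \<Rightarrow> (nat \<times> complex) multiset \<Rightarrow> complex" where
  "chr r V m = (let n = sum_mset (image_mset fst m)
     in (1 / (of_nat r ^ n * fact n)) * (\<Sum>w\<in>{w \<in> wreath r n. wtype r n w = m}. trace V w (stdset r n)))"

text \<open>A power series is its coefficient function on monomials (multisets of variables).\<close>

definition ps_mult :: "('v multiset \<Rightarrow> complex) \<Rightarrow> ('v multiset \<Rightarrow> complex) \<Rightarrow> 'v multiset \<Rightarrow> complex" where
  "ps_mult f g m = (\<Sum>A\<in>{A. A \<subseteq># m}. f A * g (m - A))"

definition ps_one :: "'v multiset \<Rightarrow> complex" where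
  "ps_one m = (if m = {#} then 1 else 0)"

text \<open>p_i o g: the continuous algebra endomorphism p_j(zeta) |-> p_{ij}(zeta) applied to g.\<close>
definition adams :: "nat \<Rightarrow> ((nat \<times> complex) multiset \<Rightarrow> complex) \<Rightarrow> (nat \<times> complex) multiset \<Rightarrow> complex" where
  "adams i g m = (if \<exists>m'. image_mset (\<lambda>(j, z). (i * j, z)) m' = m
                  then g (THE m'. image_mset (\<lambda>(j, z). (i * j, z)) m' = m) else 0)"

text \<open>f o g = sum over monomials p_mu of f of f_mu * prod_k (p_{mu_k} o g); only monomials of weight
  at most the weight of the target monomial can contribute (g has no constant term).\<close>
definition pleth :: "(nat multiset \<Rightarrow> complex) \<Rightarrow> ((nat \<times> complex) multiset \<Rightarrow> complex) \<Rightarrow>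
    (nat \<times> complex) multiset \<Rightarrow> complex" where
  "pleth f g m = (\<Sum>\<mu>\<in>{\<mu>. 0 \<notin># \<mu> \<and> sum_mset \<mu> \<le> sum_mset (image_mset fst m)}.
       f \<mu> * foldr ps_mult (map (\<lambda>i. adams i g) (sorted_list_of_multiset \<mu>)) ps_one m)"

end

theory Submission
  imports Defs
begin

text \<open>Call a pair (X, w), with w an automorphism of the free mu_r-set X, an object of type m if m
  is the multiset of lengths and types of its cycles. Objects of equal type are isomorphic, and an
  object of type m has z(m) automorphisms, where z(m) is the product of (r l)^k k! over the
  variables p_l(zeta) of m, k being the multiplicity. Hence the coefficient of p_m in ch(V) is
  tr(w, V(X)) / z(m) for any object of type m.

  Replacing each w-stable partition of X into k blocks by its k! labellings by a k-element set P
  turns tr(w, (U o V)(X)) into the sum over k and over permutations s of P of tr(s, U(P)) / k!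
  times the sum, over the mu_r-invariant maps phi : X -> P with phi w = s phi, of the product over
  the cycles c of s of tr(w^|c|, V(phi^{-1}(p_c))), where p_c is any point of c; maps that are not
  surjective contribute nothing because V is zero on the empty set. Peeling off one cycle c of s at
  a time, X splits into phi^{-1}(c) and its complement, and there are z(m) / (z(A) z(m - A)) ways to
  choose a union of cycles of w of type A; this is the product of power series. For a single cycle of
  length i there are i^(number of cycles of w) maps phi if i divides all cycle lengths and none
  otherwise, and the cycles of w^i on the fibre are those of w with lengths divided by i; this is
  the plethysm with p_i.\<close>

section \<open>Orbits of an automorphism of a free set\<close>

text \<open>The characteristic is an average over standard sets, but blocks of a partition, fibres
  of a labelling and stable subsets are in general not standard. Everything is therefore proved for
  arbitrary pairs (X, w), and the average is turned into a single trace in \<open>chr_const\<close>,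
  which asks for the trace to be constant on all objects of a type. For V this is conjugation
  invariance; for the composite it comes out of the computation itself, whose result depends on m
  only. Non-surjective maps are kept among the labellings because surjectivity would couple the
  cycles of s and destroy the factorisation. Labels are arbitrary elements of the type on which U
  lives, since \<open>ch1\<close> evaluates U on a chosen set of that type. The product in
  \<open>pleth\<close> runs through a sorted list, so the cycles of s are listed by increasing
  length. Monomials with a length 0 or a type outside mu_r belong to no pair (X, w); there both
  sides are shown to vanish separately.\<close>

lemma funpow_add_apply: "(w ^^ (s + t)) x = (w ^^ s) ((w ^^ t) x)"
  by (simp add: funpow_add)

text \<open>Two iterates of \<open>x\<close> coincide by finiteness; cancelling the injective
  \<open>w ^^ s\<close> moves the coincidence back to time 0, so orbits have no preperiod.\<close>

lemma inj_return:
  assumes "finite X" "inj_on w X" "w ` X \<subseteq> X" "x \<in> X"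
  shows "\<exists>T>0. (w ^^ T) x = x"
proof -
  have inX: "(w ^^ t) x \<in> X" for t
    using assms(3,4) by (induction t) auto
  have "\<not> inj (\<lambda>t. (w ^^ t) x)"
  proof
    assume "inj (\<lambda>t. (w ^^ t) x)"
    then have "infinite (range (\<lambda>t. (w ^^ t) x))"
      using finite_imageD infinite_UNIV_nat by blast
    moreover have "range (\<lambda>t. (w ^^ t) x) \<subseteq> X" using inX by blast
    ultimately show False using assms(1) finite_subset by blast
  qed
  then obtain s t where st: "s < t" "(w ^^ s) x = (w ^^ t) x"
    unfolding inj_def by (metis nat_neq_iff)
  have cancel: "a = b" if "(w ^^ s) a = (w ^^ s) b" "a \<in> X" "b \<in> X" for a b s
    using that
  proof (induction s)
    case (Suc s)
    have "(w ^^ s) a \<in> X" "(w ^^ s) b \<in> X" using Suc.prems(2,3) assms(3) by (induction s) auto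
    then have "(w ^^ s) a = (w ^^ s) b" using Suc.prems(1) assms(2) by (auto dest: inj_onD)
    then show ?case using Suc by blast
  qed simp
  have "(w ^^ s) ((w ^^ (t - s)) x) = (w ^^ s) x"
    using st funpow_add_apply[of s "t - s" w x] by simp
  then have "(w ^^ (t - s)) x = x" using cancel inX assms(4) by blast
  then show ?thesis using st(1) by (intro exI[of _ "t - s"]) simp
qed

section \<open>Roots of unity and automorphisms of free mu_r-sets\<close>

locale root_sets =
  fixes r :: nat
  assumes r_pos: "1 \<le> r"
begin

abbreviation mu :: "complex set" where "mu \<equiv> roots r"

lemma card_mu: "card mu = r"
  using r_pos by (simp add: roots_def card_roots_unity_eq)

lemma finite_mu [simp]: "finite mu"
  using card_mu r_pos card.infinite by fastforce

lemma one_mu [simp]: "1 \<in> mu"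
  by (simp add: roots_def)

lemma mult_mu [simp]: "z \<in> mu \<Longrightarrow> z' \<in> mu \<Longrightarrow> z * z' \<in> mu"
  by (simp add: roots_def power_mult_distrib)

lemma power_mu [simp]: "z \<in> mu \<Longrightarrow> z ^ n \<in> mu"
  by (induction n) auto

lemma inverse_mu [simp]: "z \<in> mu \<Longrightarrow> inverse z \<in> mu"
  by (simp add: roots_def power_inverse)

lemma nonzero_mu: "z \<in> mu \<Longrightarrow> z \<noteq> 0"
  using r_pos by (auto simp: roots_def power_0_left)

lemma act_one [simp]: "act 1 x = x"
  by (simp add: act_def)

lemma act_act [simp]: "act z (act z' x) = act (z * z') x"
  by (simp add: act_def mult.assoc)

lemma act_inverse [simp]: "z \<in> mu \<Longrightarrow> act (inverse z) (act z x) = x"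
  using nonzero_mu by simp

lemma act_cancel: "z \<in> mu \<Longrightarrow> act z x = act z y \<longleftrightarrow> x = y"
  using nonzero_mu by (auto simp: act_def prod_eq_iff)

lemma act_eq_iff: "fst x \<noteq> 0 \<Longrightarrow> act z x = act z' x \<longleftrightarrow> z = z'"
  by (simp add: act_def)

text \<open>Nothing is asked of \<open>w\<close> outside \<open>X\<close>, so one function
  \<open>w\<close> serves as automorphism of all stable subsets of \<open>X\<close> at once.\<close>

definition aut :: "(complex \<times> nat) set \<Rightarrow> (complex \<times> nat \<Rightarrow> complex \<times> nat) \<Rightarrow> bool" where
  "aut X w \<longleftrightarrow> objr r X \<and> bij_betw w X X \<and> (\<forall>x\<in>X. \<forall>z\<in>mu. w (act z x) = act z (w x))"

lemma aut_homr: "aut X w \<longleftrightarrow> homr r X w \<and> w ` X = X"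
  by (auto simp: aut_def homr_def bij_betw_def)

lemma aut_finite: "aut X w \<Longrightarrow> finite X"
  by (simp add: aut_def objr_def)

lemma aut_objr: "aut X w \<Longrightarrow> objr r X"
  by (simp add: aut_def)

lemma aut_act_in: "aut X w \<Longrightarrow> x \<in> X \<Longrightarrow> z \<in> mu \<Longrightarrow> act z x \<in> X"
  by (simp add: aut_def objr_def)

lemma aut_nonzero: "aut X w \<Longrightarrow> x \<in> X \<Longrightarrow> fst x \<noteq> 0"
  by (simp add: aut_def objr_def)

lemma aut_in: "aut X w \<Longrightarrow> x \<in> X \<Longrightarrow> w x \<in> X"
  by (auto simp: aut_def bij_betw_def)

lemma aut_act: "aut X w \<Longrightarrow> x \<in> X \<Longrightarrow> z \<in> mu \<Longrightarrow> w (act z x) = act z (w x)"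
  by (simp add: aut_def)

lemma aut_inj: "aut X w \<Longrightarrow> x \<in> X \<Longrightarrow> y \<in> X \<Longrightarrow> w x = w y \<Longrightarrow> x = y"
  by (auto simp: aut_def bij_betw_def inj_on_def)

lemma aut_id: "objr r X \<Longrightarrow> aut X id"
  by (simp add: aut_def)

lemma aut_pow: "aut X w \<Longrightarrow> aut X (w ^^ t)"
proof (induction t)
  case 0
  then show ?case using bij_betw_id[of X] by (simp add: aut_def id_def)
next
  case (Suc t)
  then have IH: "aut X (w ^^ t)" and w: "aut X w" by auto
  have "bij_betw (w \<circ> (w ^^ t)) X X"
    using IH w by (auto simp: aut_def intro: bij_betw_trans)
  then show ?case
    using IH w aut_in[OF IH] by (simp add: aut_def comp_def)
qed

text \<open>Only stability has to be checked: an injective self-map of a finite set is onto.\<close>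

lemma aut_subset:
  assumes "aut X w" "Y \<subseteq> X" "\<And>x. x \<in> Y \<Longrightarrow> w x \<in> Y"
    "\<And>x z. x \<in> Y \<Longrightarrow> z \<in> mu \<Longrightarrow> act z x \<in> Y"
  shows "aut Y w"
proof -
  have fin: "finite Y" using assms aut_finite finite_subset by blast
  have "inj_on w Y"
    using assms(1,2) unfolding aut_def bij_betw_def by (meson inj_on_subset)
  then have "bij_betw w Y Y"
    using assms(3) fin by (simp add: bij_betw_def endo_inj_surj image_subsetI)
  then show ?thesis
    using assms fin by (auto simp: aut_def objr_def)
qed

lemma aut_return:
  assumes "aut X w" "x \<in> X"
  obtains T where "T > 0" "(w ^^ T) x = x"
  using inj_return[of X w x] assms aut_finite that unfolding aut_def bij_betw_def by blast

text \<open>Orbits under w and mu_r together: they are the preimages in X of the cycles of w on X / mu_r,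
  and \<open>per\<close> and \<open>lab\<close> are the length and the type of the cycle.\<close>
definition worb :: "(complex \<times> nat \<Rightarrow> complex \<times> nat) \<Rightarrow> complex \<times> nat \<Rightarrow> (complex \<times> nat) set" where
  "worb w x = {act z ((w ^^ t) x) | z t. z \<in> mu}"

definition per :: "(complex \<times> nat \<Rightarrow> complex \<times> nat) \<Rightarrow> complex \<times> nat \<Rightarrow> nat" where
  "per w x = (LEAST L. 0 < L \<and> (\<exists>\<zeta>\<in>mu. (w ^^ L) x = act \<zeta> x))"

definition lab :: "(complex \<times> nat \<Rightarrow> complex \<times> nat) \<Rightarrow> complex \<times> nat \<Rightarrow> complex" where
  "lab w x = (THE \<zeta>. \<zeta> \<in> mu \<and> (w ^^ per w x) x = act \<zeta> x)"

text \<open>A plain return time, with scalar 1, shows that \<open>per\<close> minimises over a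
  nonempty set; freeness of the action makes the scalar in \<open>lab\<close> unique.\<close>

lemma per_lab:
  assumes "aut X w" "x \<in> X"
  shows per_pos: "0 < per w x"
    and lab_mu: "lab w x \<in> mu"
    and pow_per: "(w ^^ per w x) x = act (lab w x) x"
    and per_minimal: "0 < t \<Longrightarrow> \<zeta> \<in> mu \<Longrightarrow> (w ^^ t) x = act \<zeta> x \<Longrightarrow> per w x \<le> t"
proof -
  let ?P = "\<lambda>L. 0 < L \<and> (\<exists>\<zeta>\<in>mu. (w ^^ L) x = act \<zeta> x)"
  obtain T where "T > 0" "(w ^^ T) x = x" using aut_return assms by blast
  then have "?P T" using one_mu act_one by metis
  then have P: "?P (per w x)" unfolding per_def by (rule LeastI)
  then show "0 < per w x" by simp
  have "\<exists>!\<zeta>. \<zeta> \<in> mu \<and> (w ^^ per w x) x = act \<zeta> x"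
    using P act_eq_iff[OF aut_nonzero[OF assms]] by auto
  from theI'[OF this] show "lab w x \<in> mu" "(w ^^ per w x) x = act (lab w x) x"
    unfolding lab_def by auto
  show "0 < t \<Longrightarrow> \<zeta> \<in> mu \<Longrightarrow> (w ^^ t) x = act \<zeta> x \<Longrightarrow> per w x \<le> t"
    unfolding per_def by (rule Least_le) auto
qed

lemma per_lab_eqI:
  assumes "0 < L" "\<zeta> \<in> mu" "(w ^^ L) x = act \<zeta> x" "fst x \<noteq> 0"
    "\<And>t \<zeta>'. 0 < t \<Longrightarrow> \<zeta>' \<in> mu \<Longrightarrow> (w ^^ t) x = act \<zeta>' x \<Longrightarrow> L \<le> t"
  shows "per w x = L" "lab w x = \<zeta>"
proof -
  show "per w x = L"
    unfolding per_def by (rule Least_equality) (use assms in auto)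
  then show "lab w x = \<zeta>"
    unfolding lab_def using assms(2,3) act_eq_iff[OF assms(4)] by (intro the_equality) auto
qed

text \<open>Both invariants depend only on which pairs of time and scalar solve the return equation,
  so any correspondence that preserves the solutions preserves length and type.\<close>

lemma per_lab_cong:
  assumes "\<And>t \<zeta>. \<zeta> \<in> mu \<Longrightarrow> (w ^^ t) x = act \<zeta> x \<longleftrightarrow> (w' ^^ t) x' = act \<zeta> x'"
  shows "per w x = per w' x'" "lab w x = lab w' x'"
proof -
  show *: "per w x = per w' x'"
    unfolding per_def by (intro arg_cong[where f = Least] ext) (use assms in auto)
  show "lab w x = lab w' x'"
    unfolding lab_def * by (intro arg_cong[where f = The] ext) (use assms in auto)
qed

lemma pow_act:
  "aut X w \<Longrightarrow> x \<in> X \<Longrightarrow> z \<in> mu \<Longrightarrow> (w ^^ t) (act z x) = act z ((w ^^ t) x)"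
  using aut_act[OF aut_pow] by blast

lemma pow_in: "aut X w \<Longrightarrow> x \<in> X \<Longrightarrow> (w ^^ t) x \<in> X"
  using aut_in[OF aut_pow] by blast

lemma pow_per_mult:
  assumes "aut X w" "x \<in> X"
  shows "(w ^^ (per w x * q)) x = act (lab w x ^ q) x"
proof (induction q)
  case 0
  then show ?case by simp
next
  case (Suc q)
  have "(w ^^ (per w x * Suc q)) x = (w ^^ per w x) ((w ^^ (per w x * q)) x)"
    by (simp add: funpow_add)
  also have "\<dots> = act (lab w x ^ q) (act (lab w x) x)"
    using Suc assms by (simp add: pow_act[OF assms] lab_mu[OF assms] pow_per[OF assms])
  finally show ?case by (simp add: mult.commute)
qed

lemma pow_mod_per:
  assumes "aut X w" "x \<in> X"
  shows "(w ^^ t) x = act (lab w x ^ (t div per w x)) ((w ^^ (t mod per w x)) x)"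
proof -
  have "(w ^^ t) x = (w ^^ (t mod per w x)) ((w ^^ (per w x * (t div per w x))) x)"
    by (metis comp_apply funpow_add mod_mult_div_eq)
  then show ?thesis
    by (simp add: pow_per_mult[OF assms] pow_act[OF assms] lab_mu[OF assms])
qed

text \<open>Normal form of a point of the orbit. Reducing \<open>t\<close> modulo the length moves
  powers of the type into \<open>z\<close>; two normal forms of one point would bring
  \<open>x\<close> back, up to a scalar, before time \<open>per w x\<close>.\<close>

lemma worb_bij:
  assumes "aut X w" "x \<in> X"
  shows "bij_betw (\<lambda>(z, t). act z ((w ^^ t) x)) (mu \<times> {..<per w x}) (worb w x)"
proof -
  let ?f = "\<lambda>(z, t). act z ((w ^^ t) x)"
  have key: "z = z' \<and> t = t'"
    if "z \<in> mu" "z' \<in> mu" "t < per w x" "t \<le> t'" "t' < per w x"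
      and eq: "act z ((w ^^ t) x) = act z' ((w ^^ t') x)" for z z' t t'
  proof -
    have "(w ^^ t') x = (w ^^ t) ((w ^^ (t' - t)) x)"
      using \<open>t \<le> t'\<close> funpow_add[of t "t' - t" w] by simp
    then have "(w ^^ t) (act z x) = (w ^^ t) (act z' ((w ^^ (t' - t)) x))"
      using eq that(1,2) pow_act[OF assms] pow_act[OF assms(1) pow_in[OF assms]] by simp
    then have "act z x = act z' ((w ^^ (t' - t)) x)"
      by (rule aut_inj[OF aut_pow[OF assms(1)], rotated 2])
        (use aut_act_in[OF assms(1)] pow_in[OF assms] that(1,2) assms(2) in auto)
    then have "act (inverse z') (act z x) = (w ^^ (t' - t)) x"
      using that(2) nonzero_mu by simp
    then have "(w ^^ (t' - t)) x = act (inverse z' * z) x"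
      by simp
    then have "per w x \<le> t' - t" if "0 < t' - t"
      using per_minimal[OF assms that, of "inverse z' * z"] \<open>z \<in> mu\<close> \<open>z' \<in> mu\<close> by simp
    then have "\<not> 0 < t' - t" using that(5) by linarith
    then have "t' = t" using that(4) by linarith
    then show ?thesis
      using eq act_eq_iff[OF aut_nonzero[OF assms(1) pow_in[OF assms]]] by blast
  qed
  have "inj_on ?f (mu \<times> {..<per w x})"
  proof (rule inj_onI)
    fix p p'
    assume *: "p \<in> mu \<times> {..<per w x}" "p' \<in> mu \<times> {..<per w x}" "?f p = ?f p'"
    show "p = p'"
    proof (cases "snd p \<le> snd p'")
      case True
      then show ?thesis
        using key[of "fst p" "fst p'" "snd p" "snd p'"] * by (auto simp: case_prod_beta)
    next
      case False
      then show ?thesis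
        using key[of "fst p'" "fst p" "snd p'" "snd p"] * by (auto simp: case_prod_beta)
    qed
  qed
  moreover have "?f ` (mu \<times> {..<per w x}) = worb w x"
  proof
    show "?f ` (mu \<times> {..<per w x}) \<subseteq> worb w x" by (auto simp: worb_def)
    show "worb w x \<subseteq> ?f ` (mu \<times> {..<per w x})"
    proof
      fix y assume "y \<in> worb w x"
      then obtain z t where y: "y = act z ((w ^^ t) x)" "z \<in> mu" by (auto simp: worb_def)
      then have "y = act (z * lab w x ^ (t div per w x)) ((w ^^ (t mod per w x)) x)"
        using pow_mod_per[OF assms, of t] by simp
      then show "y \<in> ?f ` (mu \<times> {..<per w x})"
        using y(2) lab_mu[OF assms] per_pos[OF assms]
        by (intro image_eqI[where x = "(z * lab w x ^ (t div per w x), t mod per w x)"]) auto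
    qed
  qed
  ultimately show ?thesis by (simp add: bij_betw_def)
qed

lemma card_worb: "aut X w \<Longrightarrow> x \<in> X \<Longrightarrow> card (worb w x) = r * per w x"
  using bij_betw_same_card[OF worb_bij] by (metis card_cartesian_product card_lessThan card_mu)

lemma worb_self [simp]: "x \<in> worb w x"
proof -
  have "x = act 1 ((w ^^ 0) x)" by simp
  then show ?thesis unfolding worb_def using one_mu by blast
qed

lemma worb_subset: "aut X w \<Longrightarrow> x \<in> X \<Longrightarrow> worb w x \<subseteq> X"
  unfolding worb_def using aut_act_in pow_in by blast

lemma worb_trans:
  assumes "aut X w" "x \<in> X" "y \<in> worb w x"
  shows "worb w y \<subseteq> worb w x"
proof
  fix u assume "u \<in> worb w y"
  then obtain z t where u: "u = act z ((w ^^ t) y)" "z \<in> mu" by (auto simp: worb_def)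
  obtain z' t' where y: "y = act z' ((w ^^ t') x)" "z' \<in> mu" using assms(3) by (auto simp: worb_def)
  have "u = act (z * z') ((w ^^ (t + t')) x)"
    using u y by (simp add: pow_act[OF assms(1) pow_in[OF assms(1,2)]] funpow_add)
  moreover have "z * z' \<in> mu" using u y by simp
  ultimately show "u \<in> worb w x"
    unfolding worb_def by blast
qed

text \<open>Orbits use nonnegative powers of \<open>w\<close> only. With a return time
  \<open>T\<close> of \<open>x\<close>, another \<open>T * t - t\<close> steps after the first
  \<open>t\<close> complete \<open>t\<close> rounds and replace the inverse power.\<close>

lemma worb_sym:
  assumes "aut X w" "x \<in> X" "y \<in> worb w x"
  shows "x \<in> worb w y"
proof -
  obtain z t where y: "y = act z ((w ^^ t) x)" "z \<in> mu" using assms(3) by (auto simp: worb_def)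
  obtain T where T: "T > 0" "(w ^^ T) x = x" using aut_return assms(1,2) by blast
  have "(w ^^ (T * t)) x = x"
    using T(2) by (induction t) (simp_all add: funpow_add)
  then have "(w ^^ (T * t - t)) ((w ^^ t) x) = x"
    using T(1) funpow_add_apply[of "T * t - t" t w x] by simp
  then have "x = act (inverse z) ((w ^^ (T * t - t)) y)"
    using y by (simp add: pow_act[OF assms(1) pow_in[OF assms(1,2)]] nonzero_mu)
  then show ?thesis
    using y(2) inverse_mu unfolding worb_def by blast
qed

lemma worb_eq:
  assumes "aut X w" "x \<in> X" "y \<in> worb w x"
  shows "worb w y = worb w x"
  using worb_trans worb_sym worb_subset assms by (meson subset_antisym subsetD)

text \<open>\<open>y\<close> arises from \<open>x\<close> by a power of \<open>w\<close> and a
  scalar; both commute with \<open>w\<close> and with the action and are injective on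
  \<open>X\<close>, so \<open>x\<close> and \<open>y\<close> solve the same return
  equations.\<close>

lemma per_lab_worb:
  assumes "aut X w" "x \<in> X" "y \<in> worb w x"
  shows "per w y = per w x" "lab w y = lab w x"
proof -
  obtain z t where y: "y = act z ((w ^^ t) x)" "z \<in> mu" using assms(3) by (auto simp: worb_def)
  have "(w ^^ s) y = act \<zeta> y \<longleftrightarrow> (w ^^ s) x = act \<zeta> x" if "\<zeta> \<in> mu" for s \<zeta>
  proof -
    have X: "act z x \<in> X" "(w ^^ s) x \<in> X" "act \<zeta> x \<in> X"
      using assms y that by (auto simp: pow_in aut_act_in)
    have y': "y = (w ^^ t) (act z x)" using y pow_act assms by simp
    have "(w ^^ s) y = (w ^^ t) (act z ((w ^^ s) x))"
      unfolding y' using pow_act[OF assms(1,2) y(2), of s] funpow_add_apply[of s t w "act z x"] funpow_add_apply[of t s w "act z x"]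
      by (simp only: add.commute)
    moreover have "act \<zeta> y = (w ^^ t) (act z (act \<zeta> x))"
      unfolding y' using pow_act[OF assms(1) X(1) that, of t] by (simp add: mult.commute)
    ultimately have "(w ^^ s) y = act \<zeta> y \<longleftrightarrow> act z ((w ^^ s) x) = act z (act \<zeta> x)"
      using aut_inj[OF aut_pow[OF assms(1)] aut_act_in[OF assms(1) X(2) y(2)] aut_act_in[OF assms(1) X(3) y(2)]]
      by auto
    also have "\<dots> \<longleftrightarrow> (w ^^ s) x = act \<zeta> x"
      using act_cancel[OF y(2)] by blast
    finally show ?thesis .
  qed
  then show "per w y = per w x" "lab w y = lab w x"
    using per_lab_cong[of w y w x] by blast+
qed

lemma aut_worb:
  assumes "aut X w" "x \<in> X"
  shows "aut (worb w x) w"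
proof (rule aut_subset[OF assms(1) worb_subset[OF assms]])
  fix y assume y: "y \<in> worb w x"
  then have yX: "y \<in> X" using worb_subset assms by blast
  have "w y = act 1 ((w ^^ 1) y)" by simp
  then have "w y \<in> worb w y" unfolding worb_def using one_mu by blast
  then show "w y \<in> worb w x" using worb_eq[OF assms y] by simp
  fix z assume z: "z \<in> mu"
  have "act z y = act z ((w ^^ 0) y)" by simp
  then have "act z y \<in> worb w y" unfolding worb_def using z by blast
  then show "act z y \<in> worb w x" using worb_eq[OF assms y] by simp
qed

definition worbs :: "(complex \<times> nat \<Rightarrow> complex \<times> nat) \<Rightarrow> (complex \<times> nat) set \<Rightarrow> (complex \<times> nat) set set" where
  "worbs w X = worb w ` X"

text \<open>On an orbit the choice of representative is harmless, by
  \<open>per_lab_worb\<close>.\<close>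

definition otype :: "(complex \<times> nat \<Rightarrow> complex \<times> nat) \<Rightarrow> (complex \<times> nat) set \<Rightarrow> nat \<times> complex" where
  "otype w S = (per w (SOME x. x \<in> S), lab w (SOME x. x \<in> S))"

definition gtype :: "(complex \<times> nat \<Rightarrow> complex \<times> nat) \<Rightarrow> (complex \<times> nat) set \<Rightarrow> (nat \<times> complex) multiset" where
  "gtype w X = image_mset (otype w) (mset_set (worbs w X))"

lemma otype_worb:
  assumes "aut X w" "x \<in> X"
  shows "otype w (worb w x) = (per w x, lab w x)"
proof -
  have "(SOME y. y \<in> worb w x) \<in> worb w x" using worb_self someI by metis
  from per_lab_worb[OF assms this] show ?thesis by (simp add: otype_def)
qed

lemma finite_worbs: "aut X w \<Longrightarrow> finite (worbs w X)"
  by (simp add: worbs_def aut_finite)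

lemma Union_worbs: "aut X w \<Longrightarrow> \<Union>(worbs w X) = X"
  unfolding worbs_def using worb_subset worb_self by fastforce

lemma worbs_disjoint:
  assumes "aut X w" "S \<in> worbs w X" "S' \<in> worbs w X" "S \<inter> S' \<noteq> {}"
  shows "S = S'"
proof -
  obtain x x' y where "S = worb w x" "S' = worb w x'" "x \<in> X" "x' \<in> X" "y \<in> S" "y \<in> S'"
    using assms(2-4) unfolding worbs_def by blast
  then show ?thesis using worb_eq[OF assms(1)] by metis
qed

lemma otype_props:
  assumes "aut X w" "S \<in> worbs w X"
  shows "0 < fst (otype w S)" "snd (otype w S) \<in> mu" "card S = r * fst (otype w S)"
  using assms per_pos lab_mu card_worb by (auto simp: worbs_def otype_worb)

section \<open>Equivariant maps and the order of the centralizer\<close>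

lemma worbs_Union:
  assumes "aut X w" "S \<subseteq> worbs w X"
  shows aut_Union_worbs: "aut (\<Union>S) w" and worbs_Union_worbs: "worbs w (\<Union>S) = S"
proof -
  show "aut (\<Union>S) w"
  proof (rule aut_subset[OF assms(1)])
    show "\<Union>S \<subseteq> X" using assms Union_worbs by blast
    fix x assume "x \<in> \<Union>S"
    then obtain a where a: "a \<in> X" "worb w a \<in> S" "x \<in> worb w a"
      using assms(2) by (auto simp: worbs_def)
    show "w x \<in> \<Union>S" using aut_in[OF aut_worb[OF assms(1) a(1)] a(3)] a(2) by blast
    fix z assume "z \<in> mu"
    then show "act z x \<in> \<Union>S" using aut_act_in[OF aut_worb[OF assms(1) a(1)] a(3)] a(2) by blast
  qed
  show "worbs w (\<Union>S) = S"
  proof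
    show "worbs w (\<Union>S) \<subseteq> S"
    proof
      fix C assume "C \<in> worbs w (\<Union>S)"
      then obtain x D where x: "C = worb w x" "x \<in> D" "D \<in> S" by (auto simp: worbs_def)
      then obtain a where a: "a \<in> X" "D = worb w a" using assms(2) by (auto simp: worbs_def)
      have "worb w x = worb w a" by (rule worb_eq[OF assms(1) a(1)]) (use x(2) a(2) in simp)
      then show "C \<in> S" using x(1,3) a(2) by simp
    qed
    show "S \<subseteq> worbs w (\<Union>S)"
    proof
      fix C assume "C \<in> S"
      moreover obtain a where "C = worb w a" using \<open>C \<in> S\<close> assms(2) by (auto simp: worbs_def)
      ultimately show "C \<in> worbs w (\<Union>S)" using worb_self unfolding worbs_def by blast
    qed
  qed
qed

text \<open>Converts sums over stable subsets into sums over sets of orbits, which can then be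
  grouped by type.\<close>

lemma bij_betw_Union_worbs:
  assumes "aut X w"
  shows "bij_betw Union (Pow (worbs w X)) {Y. Y \<subseteq> X \<and> aut Y w}"
proof (rule bij_betw_byWitness[where f' = "worbs w"])
  show "\<forall>S\<in>Pow (worbs w X). worbs w (\<Union>S) = S"
    using worbs_Union_worbs[OF assms] by blast
  show "\<forall>Y\<in>{Y. Y \<subseteq> X \<and> aut Y w}. \<Union>(worbs w Y) = Y"
    using Union_worbs by blast
  show "Union ` Pow (worbs w X) \<subseteq> {Y. Y \<subseteq> X \<and> aut Y w}"
    using aut_Union_worbs[OF assms] Union_worbs[OF assms] by blast
  show "worbs w ` {Y. Y \<subseteq> X \<and> aut Y w} \<subseteq> Pow (worbs w X)"
    by (auto simp: worbs_def)
qed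

lemma Diff_stable:
  assumes "aut X w" "Y \<subseteq> X" "aut Y w"
  shows aut_Diff: "aut (X - Y) w" and worbs_Diff: "worbs w (X - Y) = worbs w X - worbs w Y"
proof -
  have sub: "worbs w Y \<subseteq> worbs w X" using assms(2) by (auto simp: worbs_def)
  have "X - Y = \<Union>(worbs w X) - \<Union>(worbs w Y)"
    using Union_worbs assms by simp
  also have "\<dots> = \<Union>(worbs w X - worbs w Y)"
    using worbs_disjoint[OF assms(1)] sub by blast
  finally have eq: "X - Y = \<Union>(worbs w X - worbs w Y)" .
  show "aut (X - Y) w" "worbs w (X - Y) = worbs w X - worbs w Y"
    unfolding eq using worbs_Union[OF assms(1), of "worbs w X - worbs w Y"] by auto
qed

lemma gtype_split:
  assumes "aut X w" "Y \<subseteq> X" "aut Y w"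
  shows "gtype w X = gtype w Y + gtype w (X - Y)"
proof -
  have "worbs w Y \<subseteq> worbs w X" using assms(2) by (auto simp: worbs_def)
  then have "mset_set (worbs w X) = mset_set (worbs w Y) + mset_set (worbs w X - worbs w Y)"
    using finite_worbs[OF assms(1)]
    by (metis Diff_disjoint Un_Diff_cancel Un_absorb1 finite_Diff finite_subset mset_set_Union)
  then show ?thesis using worbs_Diff[OF assms] by (simp add: gtype_def)
qed

lemma gtype_worb:
  assumes "aut X w" "x \<in> X"
  shows "gtype w (worb w x) = {#(per w x, lab w x)#}"
proof -
  have "worbs w (worb w x) = {worb w x}"
  proof -
    have "worb w ` worb w x = (\<lambda>_. worb w x) ` worb w x"
      by (rule image_cong[OF refl]) (rule worb_eq[OF assms])
    also have "\<dots> = {worb w x}" using worb_self[of x w] by blast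
    finally show ?thesis by (simp add: worbs_def)
  qed
  then show ?thesis using otype_worb[OF assms] by (simp add: gtype_def)
qed

lemma gtype_remove:
  assumes "aut X w" "x \<in> X"
  shows "gtype w X = add_mset (per w x, lab w x) (gtype w (X - worb w x))"
  using gtype_split[OF assms(1) worb_subset[OF assms] aut_worb[OF assms]] gtype_worb[OF assms] by simp

lemma gtype_empty_iff: "aut X w \<Longrightarrow> gtype w X = {#} \<longleftrightarrow> X = {}"
  using finite_worbs[of X w] by (simp add: gtype_def mset_set_empty_iff worbs_def)

lemma aut_Diff_worb: "aut X w \<Longrightarrow> x \<in> X \<Longrightarrow> aut (X - worb w x) w"
  by (rule aut_Diff[OF _ worb_subset aut_worb])

text \<open>A whole orbit is the smallest piece whose removal leaves a stable set, so it is the unit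
  of induction.\<close>

lemma aut_induct [consumes 1, case_names empty remove]:
  assumes "aut X w" "P {}" "\<And>X x. aut X w \<Longrightarrow> x \<in> X \<Longrightarrow> P (X - worb w x) \<Longrightarrow> P X"
  shows "P X"
  using assms(1)
proof (induction "card X" arbitrary: X rule: less_induct)
  case less
  show ?case
  proof (cases "X = {}")
    case False
    then obtain x where x: "x \<in> X" by blast
    have "X - worb w x \<subset> X" using x worb_self by blast
    then have "card (X - worb w x) < card X"
      using aut_finite[OF less.prems] psubset_card_mono by blast
    then show ?thesis using less aut_Diff_worb x assms(3) by blast
  qed (use assms(2) in simp)
qed

lemma card_weight:
  assumes "aut X w"
  shows "card X = r * sum_mset (image_mset fst (gtype w X))"
  using assms
proof (induction rule: aut_induct)
  case empty
  show ?case by (simp add: gtype_def worbs_def)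
next
  case (remove X x)
  have "card X = card (worb w x) + card (X - worb w x)"
    using worb_subset[OF remove(1,2)] aut_finite[OF remove(1)]
    by (simp add: card_Diff_subset card_mono finite_subset)
  then show ?case
    using remove(3) card_worb[OF remove(1,2)] gtype_remove[OF remove(1,2)] by (simp add: algebra_simps)
qed

lemma gtype_elem:
  assumes "aut X w" "v \<in># gtype w X"
  shows "0 < fst v" "snd v \<in> mu"
  using assms otype_props[OF assms(1)] finite_worbs[OF assms(1)] by (auto simp: gtype_def)

text \<open>These points are the possible images of an orbit generator of length and type
  \<open>v\<close> in another object; each orbit of type \<open>v\<close> supplies all of its
  \<open>r * fst v\<close> points.\<close>

lemma card_type:
  assumes "aut X w"
  shows "card {y \<in> X. (per w y, lab w y) = v} = r * fst v * count (gtype w X) v"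
  using assms
proof (induction rule: aut_induct)
  case empty
  show ?case by (simp add: gtype_def worbs_def)
next
  case (remove X x)
  let ?t = "\<lambda>y. (per w y, lab w y)"
  let ?A = "{y \<in> X. ?t y = v}" and ?B = "{y \<in> X - worb w x. ?t y = v}"
  have O: "?t y = v \<longleftrightarrow> ?t x = v" if "y \<in> worb w x" for y
    using per_lab_worb[OF remove(1,2) that] by simp
  have fin: "finite X" "finite (worb w x)"
    using aut_finite[OF remove(1)] worb_subset[OF remove(1,2)] finite_subset by auto
  show ?case
  proof (cases "?t x = v")
    case True
    have "p \<in> ?A \<longleftrightarrow> p \<in> worb w x \<union> ?B" for p
      using O[of p] True worb_subset[OF remove(1,2)] by (cases "p \<in> worb w x") blast+
    then have "?A = worb w x \<union> ?B" by blast
    moreover have "card (worb w x \<union> ?B) = card (worb w x) + card ?B"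
      using fin by (intro card_Un_disjoint) auto
    ultimately show ?thesis
      using True remove(3) card_worb[OF remove(1,2)] gtype_remove[OF remove(1,2)]
      by (auto simp: algebra_simps)
  next
    case False
    have "p \<in> ?A \<longleftrightarrow> p \<in> ?B" for p
      using O[of p] False by (cases "p \<in> worb w x") blast+
    then have "?A = ?B" by blast
    then show ?thesis using False remove(3) gtype_remove[OF remove(1,2)] by simp
  qed
qed

text \<open>The target carries an arbitrary action \<alpha>: with \<open>act\<close> these maps are
  the candidates for isomorphisms, with the trivial action they are the invariant labellings.
  Extensionality keeps them finite in number and lets equality be tested on
  \<open>X\<close>.\<close>

definition equiv_maps ::
  "(complex \<times> nat) set \<Rightarrow> (complex \<times> nat \<Rightarrow> complex \<times> nat) \<Rightarrow> 'y set \<Rightarrow> (complex \<Rightarrow> 'y \<Rightarrow> 'y) \<Rightarrow> ('y \<Rightarrow> 'y)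
    \<Rightarrow> (complex \<times> nat \<Rightarrow> 'y) set" where
  "equiv_maps X w T \<alpha> s = {f \<in> X \<rightarrow>\<^sub>E T. (\<forall>x\<in>X. f (w x) = s (f x)) \<and> (\<forall>x\<in>X. \<forall>z\<in>mu. f (act z x) = \<alpha> z (f x))}"

definition acts_on :: "'y set \<Rightarrow> (complex \<Rightarrow> 'y \<Rightarrow> 'y) \<Rightarrow> ('y \<Rightarrow> 'y) \<Rightarrow> bool" where
  "acts_on T \<alpha> s \<longleftrightarrow> (\<forall>y\<in>T. s y \<in> T \<and> \<alpha> 1 y = y \<and>
     (\<forall>z\<in>mu. \<alpha> z y \<in> T \<and> s (\<alpha> z y) = \<alpha> z (s y) \<and> (\<forall>z'\<in>mu. \<alpha> z (\<alpha> z' y) = \<alpha> (z * z') y)))"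

lemma acts_on_aut: "aut X w \<Longrightarrow> acts_on X act w"
  by (auto simp: acts_on_def aut_in aut_act_in aut_act)

lemma acts_on_pow:
  assumes "acts_on T \<alpha> s" "y \<in> T"
  shows "(s ^^ t) y \<in> T" "z \<in> mu \<Longrightarrow> (s ^^ t) (\<alpha> z y) = \<alpha> z ((s ^^ t) y)"
proof -
  show *: "(s ^^ t) y \<in> T" for t using assms by (induction t) (auto simp: acts_on_def)
  show "z \<in> mu \<Longrightarrow> (s ^^ t) (\<alpha> z y) = \<alpha> z ((s ^^ t) y)"
    using assms * by (induction t) (auto simp: acts_on_def)
qed

lemma equiv_maps_pow:
  assumes "aut X w" "f \<in> equiv_maps X w T \<alpha> s" "x \<in> X"
  shows "f ((w ^^ t) x) = (s ^^ t) (f x)"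
  using assms pow_in[OF assms(1,3)] by (induction t) (auto simp: equiv_maps_def)

lemma equiv_maps_worb:
  assumes "aut X w" "f \<in> equiv_maps X w T \<alpha> s" "x \<in> X" "z \<in> mu"
  shows "f (act z ((w ^^ t) x)) = \<alpha> z ((s ^^ t) (f x))"
  using assms(2,4) equiv_maps_pow[OF assms(1-3)] pow_in[OF assms(1,3)] by (auto simp: equiv_maps_def)

text \<open>The orbit of \<open>x\<close> is presented by the generator \<open>x\<close> and the
  single relation that \<open>w ^^ per w x\<close> acts on it as the scalar \<open>lab w x\<close>.
  An equivariant map may thus send \<open>x\<close> to any solution of that relation in
  \<open>T\<close>.\<close>

lemma equiv_maps_bij:
  assumes X: "aut X w" "x \<in> X" and T: "acts_on T \<alpha> s"
  shows "bij_betw (\<lambda>f. f x) (equiv_maps (worb w x) w T \<alpha> s) {y \<in> T. (s ^^ per w x) y = \<alpha> (lab w x) y}"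
    (is "bij_betw _ ?E ?Y")
proof -
  let ?O = "worb w x" and ?L = "per w x" and ?l = "lab w x"
  have O: "aut ?O w" "x \<in> ?O" using aut_worb[OF X] by auto
  have "inj_on (\<lambda>f. f x) ?E"
  proof (rule inj_onI)
    fix f g assume fg: "f \<in> ?E" "g \<in> ?E" "f x = g x"
    show "f = g"
    proof (rule PiE_ext[of f ?O "\<lambda>_. T" g])
      show "f \<in> ?O \<rightarrow>\<^sub>E T" "g \<in> ?O \<rightarrow>\<^sub>E T" using fg by (auto simp: equiv_maps_def)
      fix p assume "p \<in> ?O"
      then obtain z t where "p = act z ((w ^^ t) x)" "z \<in> mu" by (auto simp: worb_def)
      then show "f p = g p" using equiv_maps_worb[OF O(1) _ O(2)] fg by metis
    qed
  qed
  moreover have "(\<lambda>f. f x) ` ?E = ?Y"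
  proof
    show "(\<lambda>f. f x) ` ?E \<subseteq> ?Y"
    proof clarify
      fix f assume f: "f \<in> ?E"
      then have "f x \<in> T" using O by (auto simp: equiv_maps_def)
      moreover have "(s ^^ ?L) (f x) = \<alpha> ?l (f x)"
        using equiv_maps_pow[OF O(1) f O(2), of ?L] pow_per[OF X] f O(2) lab_mu[OF X]
        by (simp add: equiv_maps_def)
      ultimately show "f x \<in> T \<and> (s ^^ ?L) (f x) = \<alpha> ?l (f x)" by simp
    qed
    show "?Y \<subseteq> (\<lambda>f. f x) ` ?E"
    proof
      fix y assume "y \<in> ?Y"
      then have y: "y \<in> T" "(s ^^ ?L) y = \<alpha> ?l y" by auto
      have \<alpha>: "\<alpha> 1 u = u" "z \<in> mu \<Longrightarrow> \<alpha> z u \<in> T" "z \<in> mu \<Longrightarrow> z' \<in> mu \<Longrightarrow> \<alpha> z (\<alpha> z' u) = \<alpha> (z * z') u"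
          "s u \<in> T" "z \<in> mu \<Longrightarrow> s (\<alpha> z u) = \<alpha> z (s u)"
        if "u \<in> T" for u z z' using T that by (auto simp: acts_on_def)
      have sq: "(s ^^ (?L * q)) y = \<alpha> (?l ^ q) y" for q
      proof (induction q)
        case 0
        show ?case using \<alpha> y by simp
      next
        case (Suc q)
        have "(s ^^ (?L * Suc q)) y = (s ^^ ?L) ((s ^^ (?L * q)) y)"
          by (simp add: funpow_add)
        also have "\<dots> = \<alpha> (?l ^ q) (\<alpha> ?l y)"
          using Suc y acts_on_pow[OF T y(1)] lab_mu[OF X] by simp
        finally show ?case using \<alpha> y lab_mu[OF X] by (simp add: mult.commute)
      qed
      have smod: "(s ^^ t) y = \<alpha> (?l ^ (t div ?L)) ((s ^^ (t mod ?L)) y)" for t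
      proof -
        have "(s ^^ t) y = (s ^^ (t mod ?L)) ((s ^^ (?L * (t div ?L))) y)"
          using funpow_add_apply[of "t mod ?L" "?L * (t div ?L)" s y] by simp
        then show ?thesis using sq acts_on_pow[OF T y(1)] lab_mu[OF X] by simp
      qed
      let ?F = "\<lambda>(z, t). act z ((w ^^ t) x)"
      let ?D = "mu \<times> {..<?L}"
      \<comment> \<open>\<open>f\<close> is prescribed through the unique coordinates of
        \<open>worb_bij\<close>, so it is well defined. Its formula extends to times beyond the
        length because \<open>x\<close> and \<open>y\<close> are reduced by the same
        relation.\<close>
      define f where "f = (\<lambda>p\<in>?O. case inv_into ?D ?F p of (z, t) \<Rightarrow> \<alpha> z ((s ^^ t) y))"
      have inj: "inj_on ?F ?D" using worb_bij[OF X] by (simp add: bij_betw_def)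
      have inO: "act z ((w ^^ t) x) \<in> ?O" if "z \<in> mu" for z t
        using that by (auto simp: worb_def)
      have f0: "f (act z ((w ^^ t) x)) = \<alpha> z ((s ^^ t) y)" if "z \<in> mu" "t < ?L" for z t
      proof -
        have "inv_into ?D ?F (?F (z, t)) = (z, t)"
          using inj that by (intro inv_into_f_f) auto
        then show ?thesis using inO[OF that(1)] by (simp add: f_def)
      qed
      have f: "f (act z ((w ^^ t) x)) = \<alpha> z ((s ^^ t) y)" if "z \<in> mu" for z t
      proof -
        have "act z ((w ^^ t) x) = act (z * ?l ^ (t div ?L)) ((w ^^ (t mod ?L)) x)"
          using pow_mod_per[OF X, of t] by simp
        moreover have "\<alpha> z ((s ^^ t) y) = \<alpha> (z * ?l ^ (t div ?L)) ((s ^^ (t mod ?L)) y)"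
          using smod[of t] \<alpha>(3)[OF acts_on_pow(1)[OF T y(1)] that] lab_mu[OF X] by simp
        ultimately show ?thesis
          using f0[of "z * ?l ^ (t div ?L)" "t mod ?L"] that lab_mu[OF X] per_pos[OF X] by simp
      qed
      have "f \<in> ?E"
        unfolding equiv_maps_def
      proof (intro CollectI conjI ballI)
        have "f p \<in> T" if "p \<in> ?O" for p
        proof -
          from that obtain z t where "p = act z ((w ^^ t) x)" "z \<in> mu" by (auto simp: worb_def)
          then show ?thesis using f \<alpha>(2) acts_on_pow(1)[OF T y(1)] by simp
        qed
        then show "f \<in> ?O \<rightarrow>\<^sub>E T" by (auto simp: f_def)
        fix p assume "p \<in> ?O"
        then obtain z t where p: "p = act z ((w ^^ t) x)" "z \<in> mu" by (auto simp: worb_def)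
        have "w p = act z ((w ^^ Suc t) x)" using p aut_act[OF X(1) pow_in[OF X]] by simp
        then have "f (w p) = \<alpha> z ((s ^^ Suc t) y)" using f p by metis
        then show "f (w p) = s (f p)" using f p \<alpha>(5)[OF acts_on_pow(1)[OF T y(1)]] by simp
        fix z' assume z': "z' \<in> mu"
        then have "f (act z' p) = \<alpha> (z' * z) ((s ^^ t) y)" using p f by simp
        then show "f (act z' p) = \<alpha> z' (f p)"
          using \<alpha>(3)[OF acts_on_pow(1)[OF T y(1)]] z' p f by simp
      qed
      moreover have "f x = y" using f[OF one_mu, of 0] \<alpha>(1)[OF y(1)] by simp
      ultimately show "y \<in> (\<lambda>f. f x) ` ?E" by blast
    qed
  qed
  ultimately show ?thesis by (simp add: bij_betw_def)
qed

lemma equiv_maps_restrict: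
  "f \<in> equiv_maps X w T \<alpha> s \<Longrightarrow> Y \<subseteq> X \<Longrightarrow> aut Y w \<Longrightarrow> restrict f Y \<in> equiv_maps Y w T \<alpha> s"
  by (auto simp: equiv_maps_def aut_in aut_act_in)

lemma equiv_maps_glue:
  assumes "aut X w" "Y \<subseteq> X" "aut Y w" "f \<in> equiv_maps Y w T \<alpha> s" "g \<in> equiv_maps (X - Y) w T \<alpha> s"
  shows "(\<lambda>x. if x \<in> Y then f x else g x) \<in> equiv_maps X w T \<alpha> s"
proof -
  have "aut (X - Y) w" by (rule aut_Diff[OF assms(1-3)])
  then have "x \<in> X \<Longrightarrow> x \<notin> Y \<Longrightarrow> w x \<in> X - Y" "x \<in> X \<Longrightarrow> x \<notin> Y \<Longrightarrow> z \<in> mu \<Longrightarrow> act z x \<in> X - Y" for x z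
    using aut_in aut_act_in by blast+
  then show ?thesis
    using assms(2,4,5) aut_in[OF assms(3)] aut_act_in[OF assms(3)]
    by (auto simp: equiv_maps_def PiE_iff extensional_def)
qed

section \<open>Isomorphisms of pairs and the order of the centralizer\<close>

definition equiv_isos :: "(complex \<times> nat) set \<Rightarrow> (complex \<times> nat \<Rightarrow> complex \<times> nat) \<Rightarrow>
    (complex \<times> nat) set \<Rightarrow> (complex \<times> nat \<Rightarrow> complex \<times> nat) \<Rightarrow> (complex \<times> nat \<Rightarrow> complex \<times> nat) set" where
  "equiv_isos X w X' w' = {g \<in> equiv_maps X w X' act w'. bij_betw g X X'}"

lemma equiv_isos_per_lab:
  assumes "aut X w" "aut X' w'" "g \<in> equiv_isos X w X' w'" "x \<in> X"
  shows "per w' (g x) = per w x" "lab w' (g x) = lab w x"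
proof -
  have g: "g \<in> equiv_maps X w X' act w'" "inj_on g X" using assms(3) by (auto simp: equiv_isos_def bij_betw_def)
  have "(w' ^^ t) (g x) = act \<zeta> (g x) \<longleftrightarrow> (w ^^ t) x = act \<zeta> x" if "\<zeta> \<in> mu" for t \<zeta>
  proof -
    have "(w' ^^ t) (g x) = g ((w ^^ t) x)" using equiv_maps_pow[OF assms(1) g(1) assms(4)] by simp
    moreover have "act \<zeta> (g x) = g (act \<zeta> x)" using g(1) assms(4) that by (simp add: equiv_maps_def)
    ultimately show ?thesis
      using inj_on_eq_iff[OF g(2) pow_in[OF assms(1,4)] aut_act_in[OF assms(1,4) that]] by simp
  qed
  then show "per w' (g x) = per w x" "lab w' (g x) = lab w x"
    using per_lab_cong[of w' "g x" w x] by blast+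
qed

lemma equiv_maps_image_worb:
  assumes "aut X w" "g \<in> equiv_maps X w X' act w'" "x \<in> X"
  shows "g ` worb w x = worb w' (g x)"
proof
  show "g ` worb w x \<subseteq> worb w' (g x)"
  proof
    fix y assume "y \<in> g ` worb w x"
    then obtain z t where y: "y = g (act z ((w ^^ t) x))" "z \<in> mu" by (auto simp: worb_def)
    then have "y = act z ((w' ^^ t) (g x))" using equiv_maps_worb[OF assms] by simp
    then show "y \<in> worb w' (g x)" using y(2) unfolding worb_def by blast
  qed
  show "worb w' (g x) \<subseteq> g ` worb w x"
  proof
    fix y assume "y \<in> worb w' (g x)"
    then obtain z t where y: "y = act z ((w' ^^ t) (g x))" "z \<in> mu" by (auto simp: worb_def)
    then have "y = g (act z ((w ^^ t) x))" using equiv_maps_worb[OF assms] by simp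
    moreover have "act z ((w ^^ t) x) \<in> worb w x" using y by (auto simp: worb_def)
    ultimately show "y \<in> g ` worb w x" by blast
  qed
qed

definition cent_order :: "(nat \<times> complex) multiset \<Rightarrow> nat" where
  "cent_order m = (\<Prod>v\<in>set_mset m. (r * fst v) ^ count m v * fact (count m v))"

lemma cent_order_empty [simp]: "cent_order {#} = 1"
  by (simp add: cent_order_def)

text \<open>The recursion through which the inductions meet \<open>cent_order\<close>. The factor of
  \<open>v\<close> is split off on both sides; it equals 1 when \<open>v\<close> does not
  occur.\<close>

lemma cent_order_add: "cent_order (add_mset v m) = r * fst v * (count m v + 1) * cent_order m"
proof -
  let ?h = "\<lambda>m v. (r * fst v) ^ count m v * fact (count m v)"
  have *: "cent_order m = ?h m v * (\<Prod>u\<in>set_mset m - {v}. ?h m u)" for m :: "(nat \<times> complex) multiset"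
  proof (cases "v \<in># m")
    case True
    then show ?thesis unfolding cent_order_def by (simp add: prod.remove)
  next
    case False
    then have "count m v = 0" by (simp add: count_eq_zero_iff)
    with False show ?thesis unfolding cent_order_def by simp
  qed
  have "(\<Prod>u\<in>set_mset (add_mset v m) - {v}. ?h (add_mset v m) u) = (\<Prod>u\<in>set_mset m - {v}. ?h m u)"
    by (intro prod.cong) auto
  then show ?thesis
    by (simp add: *[of m] *[of "add_mset v m"] algebra_simps)
qed

lemma cent_order_pos: "(\<And>v. v \<in># m \<Longrightarrow> 0 < fst v) \<Longrightarrow> 0 < cent_order m"
  using r_pos by (auto simp: cent_order_def intro!: prod_pos)

lemma cent_order_gtype_pos: "aut X w \<Longrightarrow> 0 < cent_order (gtype w X)"
  using cent_order_pos gtype_elem by blast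

lemma finite_equiv_isos: "aut X w \<Longrightarrow> aut X' w' \<Longrightarrow> finite (equiv_isos X w X' w')"
  by (rule finite_subset[of _ "X \<rightarrow>\<^sub>E X'"]) (auto simp: equiv_isos_def equiv_maps_def aut_finite intro: finite_PiE)

text \<open>An isomorphism maps the orbit of \<open>x\<close> onto the orbit of its image, so it
  amounts to the free choice of a \<open>y\<close> of the same length and type together with an
  isomorphism of the complements.\<close>

lemma equiv_isos_bij:
  assumes X: "aut X w" "x \<in> X" and X': "aut X' w'"
  shows "bij_betw (\<lambda>g. (g x, restrict g (X - worb w x))) (equiv_isos X w X' w')
    (SIGMA y:{y \<in> X'. (per w' y, lab w' y) = (per w x, lab w x)}. equiv_isos (X - worb w x) w (X' - worb w' y) w')"
    (is "bij_betw ?F ?A ?B")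
proof -
  let ?O = "worb w x" and ?R = "X - worb w x"
  have O: "aut ?O w" "?O \<subseteq> X" "x \<in> ?O" and R: "aut ?R w"
    using aut_worb[OF X] worb_subset[OF X] aut_Diff_worb[OF X] by auto
  have T: "acts_on X' act w'" using acts_on_aut[OF X'] .
  have "inj_on ?F ?A"
  proof (rule inj_onI)
    fix g h assume gh: "g \<in> ?A" "h \<in> ?A" "?F g = ?F h"
    then have e: "g \<in> equiv_maps X w X' act w'" "h \<in> equiv_maps X w X' act w'" by (auto simp: equiv_isos_def)
    have "restrict g ?O = restrict h ?O"
      using inj_onD[OF bij_betw_imp_inj_on[OF equiv_maps_bij[OF X T]], of "restrict g ?O" "restrict h ?O"]
        equiv_maps_restrict[OF e(1) O(2,1)] equiv_maps_restrict[OF e(2) O(2,1)] gh(3) O(3) by simp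
    moreover have "restrict g ?R = restrict h ?R" using gh(3) by simp
    ultimately have "g p = h p" if "p \<in> X" for p
      using that by (cases "p \<in> ?O") (metis restrict_apply' DiffI)+
    then show "g = h"
      using e by (intro PiE_ext[of g X "\<lambda>_. X'" h]) (auto simp: equiv_maps_def)
  qed
  moreover have "?F ` ?A \<subseteq> ?B"
  proof (rule image_subsetI)
    fix g assume g: "g \<in> ?A"
    then have e: "g \<in> equiv_maps X w X' act w'" and b: "bij_betw g X X'" by (auto simp: equiv_isos_def)
    have y: "g x \<in> X'" using b X(2) by (auto simp: bij_betw_def)
    have img: "g ` ?O = worb w' (g x)" using equiv_maps_image_worb[OF X(1) e X(2)] .
    have "bij_betw g ?R (X' - worb w' (g x))"
      using b O(2) img by (metis Diff_subset bij_betw_def inj_on_image_set_diff inj_on_subset)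
    then have b': "bij_betw (restrict g ?R) ?R (X' - worb w' (g x))"
      by (subst bij_betw_cong[of _ _ g]) auto
    then have "restrict g ?R \<in> equiv_isos ?R w (X' - worb w' (g x)) w'"
      using equiv_maps_restrict[OF e _ R] unfolding equiv_isos_def equiv_maps_def
      by (auto simp: bij_betw_def)
    then show "?F g \<in> ?B"
      using y equiv_isos_per_lab[OF X(1) X' g X(2)] by simp
  qed
  moreover have "?B \<subseteq> ?F ` ?A"
  proof clarify
    fix y h
    assume y: "y \<in> X'" "per w' y = per w x" "lab w' y = lab w x"
      and h: "h \<in> equiv_isos ?R w (X' - worb w' y) w'"
    have "y \<in> {y \<in> X'. (w' ^^ per w x) y = act (lab w x) y}"
      using y pow_per[OF X' y(1)] by simp
    then have "y \<in> (\<lambda>f. f x) ` equiv_maps ?O w X' act w'"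
      using bij_betw_imp_surj_on[OF equiv_maps_bij[OF X T]] by simp
    then obtain f where f: "f \<in> equiv_maps ?O w X' act w'" "f x = y"
      by blast
    have h': "h \<in> equiv_maps ?R w X' act w'" "bij_betw h ?R (X' - worb w' y)"
      using h by (auto simp: equiv_isos_def equiv_maps_def)
    let ?g = "\<lambda>p. if p \<in> ?O then f p else h p"
    have g: "?g \<in> equiv_maps X w X' act w'" by (rule equiv_maps_glue[OF X(1) O(2,1) f(1) h'(1)])
    have "f ` ?O = worb w' y" using equiv_maps_image_worb[OF O(1) f(1) O(3)] f(2) by simp
    \<comment> \<open>Equal lengths give orbits of equal size, which makes the surjection
      \<open>f\<close> between them bijective.\<close>
    moreover have "card ?O = card (worb w' y)"
      using card_worb[OF X] card_worb[OF X' y(1)] y(2) by simp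
    ultimately have "bij_betw f ?O (worb w' y)"
      using aut_finite[OF O(1)] by (simp add: bij_betw_def eq_card_imp_inj_on)
    then have "bij_betw ?g ?O (worb w' y)"
      by (simp cong: bij_betw_cong)
    moreover have "bij_betw ?g ?R (X' - worb w' y)"
      using h'(2) by (subst bij_betw_cong[of _ _ h]) auto
    ultimately have "bij_betw ?g (?O \<union> ?R) (worb w' y \<union> (X' - worb w' y))"
      by (rule bij_betw_combine) auto
    moreover have "?O \<union> ?R = X" "worb w' y \<union> (X' - worb w' y) = X'"
      using O(2) worb_subset[OF X' y(1)] by auto
    ultimately have "?g \<in> ?A" using g by (simp add: equiv_isos_def)
    moreover have "?g x = y" using f O(3) by simp
    moreover have "restrict ?g ?R = h"
      using h'(1) by (auto simp: equiv_maps_def PiE_iff extensional_def fun_eq_iff)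
    ultimately have "(y, h) = ?F ?g" by (simp only: prod.inject)
    then show "(y, h) \<in> ?F ` ?A" using \<open>?g \<in> ?A\<close> by (rule image_eqI)
  qed
  ultimately show ?thesis unfolding bij_betw_def by blast
qed

text \<open>A chosen point has \<open>r * per w x\<close> images for each orbit of its type in the
  target, which is the factor by which \<open>cent_order_add\<close> grows. The target is quantified
  inside the induction because its remaining part depends on the image.\<close>

lemma card_equiv_isos:
  assumes "aut X w" "aut X' w'" "gtype w X = gtype w' X'"
  shows "card (equiv_isos X w X' w') = cent_order (gtype w X)"
proof -
  have "\<forall>X'. aut X' w' \<longrightarrow> gtype w X = gtype w' X' \<longrightarrow> card (equiv_isos X w X' w') = cent_order (gtype w X)"
    using assms(1)
  proof (induction rule: aut_induct)
    case empty
    have "card (equiv_isos {} w {} w') = 1"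
      by (simp add: equiv_isos_def equiv_maps_def bij_betw_def)
    then show ?case
      using gtype_empty_iff by (auto simp: gtype_def worbs_def)
  next
    case (remove X x)
    show ?case
    proof (intro allI impI)
      fix X' assume X': "aut X' w'" and eq: "gtype w X = gtype w' X'"
      let ?v = "(per w x, lab w x)" and ?R = "X - worb w x"
      let ?Y = "{y \<in> X'. (per w' y, lab w' y) = ?v}"
      have g: "gtype w X = add_mset ?v (gtype w ?R)" using gtype_remove[OF remove(1,2)] .
      have "card (equiv_isos ?R w (X' - worb w' y) w') = cent_order (gtype w ?R)" if "y \<in> ?Y" for y
      proof -
        have y: "y \<in> X'" "per w' y = per w x" "lab w' y = lab w x" using that by auto
        have "gtype w ?R = gtype w' (X' - worb w' y)"
          using gtype_remove[OF X' y(1)] eq g y(2,3) by simp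
        then show ?thesis using remove(3) aut_Diff_worb[OF X' y(1)] by blast
      qed
      then have "card (SIGMA y:?Y. equiv_isos ?R w (X' - worb w' y) w') = card ?Y * cent_order (gtype w ?R)"
        using aut_finite[OF X'] finite_equiv_isos[OF aut_Diff_worb[OF remove(1,2)] aut_Diff_worb[OF X']]
        by (subst card_SigmaI) auto
      \<comment> \<open>Multiplicities refer to the complement of the orbit of \<open>x\<close>; the
        added 1 accounts for that orbit.\<close>
      also have "card ?Y = r * per w x * (count (gtype w ?R) ?v + 1)"
        using card_type[OF X', of ?v] eq g by (metis count_add_mset fst_conv Suc_eq_plus1)
      finally show "card (equiv_isos X w X' w') = cent_order (gtype w X)"
        using bij_betw_same_card[OF equiv_isos_bij[OF remove(1,2) X']] g cent_order_add[of ?v "gtype w ?R"] by simp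
    qed
  qed
  then show ?thesis using assms by blast
qed

text \<open>Existence is read off from the number of isomorphisms, which is positive.\<close>

lemma equiv_isos_nonempty:
  assumes "aut X w" "aut X' w'" "gtype w X = gtype w' X'"
  obtains g where "g \<in> equiv_isos X w X' w'"
  using card_equiv_isos[OF assms] cent_order_gtype_pos[OF assms(1)] by fastforce

lemma gtype_equiv_isos:
  assumes "aut X w" "aut X' w'" "g \<in> equiv_isos X w X' w'"
  shows "gtype w' X' = gtype w X"
proof -
  have g: "g \<in> equiv_maps X w X' act w'" "bij_betw g X X'" using assms(3) by (auto simp: equiv_isos_def)
  have "worbs w' X' = (\<lambda>S. g ` S) ` worbs w X"
  proof -
    have "worbs w' X' = worb w' ` g ` X" using g(2) by (simp add: worbs_def bij_betw_def)
    also have "\<dots> = (\<lambda>x. g ` worb w x) ` X"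
      unfolding image_image
      by (rule image_cong[OF refl]) (rule equiv_maps_image_worb[OF assms(1) g(1), symmetric])
    finally show ?thesis by (simp add: worbs_def image_image)
  qed
  moreover have "inj_on (\<lambda>S. g ` S) (worbs w X)"
    using g(2) worb_subset[OF assms(1)]
    by (intro inj_on_subset[OF inj_on_image_Pow]) (auto simp: bij_betw_def worbs_def)
  ultimately have "mset_set (worbs w' X') = image_mset (\<lambda>S. g ` S) (mset_set (worbs w X))"
    by (simp add: image_mset_mset_set)
  moreover have "otype w' (g ` S) = otype w S" if S: "S \<in> worbs w X" for S
  proof -
    obtain x where x: "x \<in> X" "S = worb w x" using S by (auto simp: worbs_def)
    then have "g x \<in> X'" using g(2) by (auto simp: bij_betw_def)
    then show ?thesis
      using x equiv_maps_image_worb[OF assms(1) g(1) x(1)] otype_worb[OF assms(1)] otype_worb[OF assms(2)]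
        equiv_isos_per_lab[OF assms x(1)] by simp
  qed
  ultimately show ?thesis
    using finite_worbs[OF assms(1)]
    by (auto simp: gtype_def image_mset.compositionality comp_def intro!: image_mset_cong)
qed

end

section \<open>Coefficients of the characteristic as normalised traces\<close>

lemma trace_cong:
  assumes "is_module obj hom M" "hom I w" "w ` I = I" "\<And>x. x \<in> I \<Longrightarrow> w x = w' x"
  shows "trace M w I = trace M w' I"
proof -
  have "\<forall>b\<in>basis M I. \<forall>b'\<in>basis M (w ` I). mat M w I b' b = mat M w' I b' b"
    using assms(1,2,4) unfolding is_module_def by blast
  then show ?thesis unfolding trace_def by (intro sum.cong) (auto simp: assms(3))
qed

text \<open>The identity tr(GF) = tr(FG) for maps between two different objects, a consequence of
  functoriality alone. Invariance of traces under isomorphism rests on it.\<close>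

lemma trace_comm:
  assumes M: "is_module obj hom M" and h: "hom I f" "hom (f ` I) g" "g ` f ` I = I"
  shows "trace M (g \<circ> f) I = trace M (f \<circ> g) (f ` I)"
proof -
  have comp: "mat M (g \<circ> f) I b'' b = (\<Sum>b'\<in>basis M (f ` I). mat M g (f ` I) b'' b' * mat M f I b' b)"
    if "hom I f" "hom (f ` I) g" "b \<in> basis M I" "b'' \<in> basis M (g ` f ` I)" for f g I b b''
    using M that unfolding is_module_def by blast
  have "trace M (g \<circ> f) I
      = (\<Sum>b\<in>basis M I. \<Sum>b'\<in>basis M (f ` I). mat M g (f ` I) b b' * mat M f I b' b)"
    unfolding trace_def using comp[OF h(1,2)] h(3) by (intro sum.cong) auto
  also have "\<dots> = (\<Sum>b'\<in>basis M (f ` I). \<Sum>b\<in>basis M I. mat M f I b' b * mat M g (f ` I) b b')"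
    by (subst sum.swap) (simp add: mult.commute)
  also have "\<dots> = trace M (f \<circ> g) (f ` I)"
    unfolding trace_def using comp[of "f ` I" g f] h by (intro sum.cong) auto
  finally show ?thesis .
qed

context root_sets
begin

text \<open>With \<open>?k\<close> inverse to \<open>g\<close> and \<open>?h\<close> =
  \<open>w\<close> after \<open>?k\<close>, the two products of \<open>g\<close> and
  \<open>?h\<close> are \<open>w\<close> on \<open>X\<close> and \<open>w'\<close> on
  \<open>X'\<close>; \<open>trace_comm\<close> exchanges them.\<close>

lemma trace_equiv_isos:
  assumes V: "is_module (objr r) (homr r) V" and X: "aut X w" and X': "aut X' w'"
    and g: "g \<in> equiv_isos X w X' w'"
  shows "trace V w X = trace V w' X'"
proof -
  have e: "g \<in> equiv_maps X w X' act w'" and b: "bij_betw g X X'" using g by (auto simp: equiv_isos_def)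
  have img: "g ` X = X'" and inj: "inj_on g X" using b by (auto simp: bij_betw_def)
  let ?k = "inv_into X g" let ?h = "w \<circ> ?k"
  have k: "?k (g x) = x" if "x \<in> X" for x using inj that by simp
  have k': "?k y \<in> X" "g (?k y) = y" if "y \<in> X'" for y
    using that img by (auto simp: inv_into_into f_inv_into_f)
  have hg: "homr r X g"
    using aut_objr[OF X] aut_objr[OF X'] img inj e by (auto simp: homr_def equiv_maps_def)
  have him: "?h ` X' = X"
  proof -
    have "?k ` X' = X" using bij_betw_inv_into[OF b] by (simp add: bij_betw_def)
    then have "?h ` X' = w ` X" by (metis image_comp)
    then show ?thesis using X by (simp add: aut_def bij_betw_def)
  qed
  have "inj_on ?h X'"
    by (rule eq_card_imp_inj_on) (use him b aut_finite[OF X'] bij_betw_same_card[OF b] in auto)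
  moreover have "?h (act z y) = act z (?h y)" if "y \<in> X'" "z \<in> mu" for y z
  proof -
    have "g (act z (?k y)) = act z (g (?k y))" using e k'(1)[OF that(1)] that(2) by (simp add: equiv_maps_def)
    then have "act z y = g (act z (?k y))" using k'(2)[OF that(1)] by simp
    then have "?k (act z y) = act z (?k y)"
      using k[OF aut_act_in[OF X k'(1)[OF that(1)] that(2)]] by simp
    then show ?thesis using aut_act[OF X k'(1)[OF that(1)] that(2)] by simp
  qed
  ultimately have hh: "homr r X' ?h"
    using aut_objr[OF X] aut_objr[OF X'] him by (auto simp: homr_def)
  have gh: "(g \<circ> ?h) y = w' y" if "y \<in> X'" for y
    using e k'[OF that] by (simp add: equiv_maps_def)
  have w': "homr r X' w'" "w' ` X' = X'" and w: "homr r X w" "w ` X = X"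
    using X X' by (auto simp: aut_homr)
  have "trace V w X = trace V (?h \<circ> g) X"
    by (rule trace_cong[OF V w]) (simp add: k)
  also have "\<dots> = trace V (g \<circ> ?h) X'"
    using trace_comm[OF V hg, of ?h] hh him unfolding img by blast
  also have "\<dots> = trace V w' X'"
    by (rule trace_cong[OF V w', symmetric]) (use gh in simp)
  finally show ?thesis .
qed

section \<open>The standard set, the wreath product and signed cycle types\<close>

lemma stdset_eq: "stdset r n = mu \<times> {1..n}"
  by (auto simp: stdset_def)

lemma objr_stdset: "objr r (stdset r n)"
  using nonzero_mu by (auto simp: objr_def stdset_eq act_def)

lemma card_stdset: "card (stdset r n) = r * n"
  by (simp add: stdset_eq card_mu)

lemma wreath_iff:
  "w \<in> wreath r n \<longleftrightarrow> aut (stdset r n) w \<and> (\<forall>x. x \<notin> stdset r n \<longrightarrow> w x = x)"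
  by (auto simp: wreath_def aut_homr)

lemma finite_wreath: "finite (wreath r n)"
proof (rule finite_subset)
  let ?X = "stdset r n"
  let ?e = "\<lambda>f y. if y \<in> ?X then f y else y"
  show "wreath r n \<subseteq> ?e ` (?X \<rightarrow>\<^sub>E ?X)"
  proof
    fix w assume w: "w \<in> wreath r n"
    then have "w = ?e (restrict w ?X)" by (auto simp: wreath_iff)
    moreover have "restrict w ?X \<in> ?X \<rightarrow>\<^sub>E ?X" using w aut_in by (auto simp: wreath_iff)
    ultimately show "w \<in> ?e ` (?X \<rightarrow>\<^sub>E ?X)" by (rule image_eqI)
  qed
  show "finite (?e ` (?X \<rightarrow>\<^sub>E ?X))"
    using objr_stdset by (intro finite_imageI finite_PiE) (auto simp: objr_def)
qed

text \<open>mu_r acts transitively on each column of the standard set, so an orbit consists of full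
  columns and is recovered from its projection to {1..n}.\<close>

lemma worb_times:
  assumes "aut (stdset r n) w" "x \<in> stdset r n"
  shows "worb w x = mu \<times> snd ` worb w x"
proof
  have sub: "worb w x \<subseteq> mu \<times> {1..n}" using worb_subset[OF assms] by (simp add: stdset_eq)
  then show "worb w x \<subseteq> mu \<times> snd ` worb w x" by force
  show "mu \<times> snd ` worb w x \<subseteq> worb w x"
  proof clarify
    fix z z' k assume z: "z \<in> mu" "(z', k) \<in> worb w x"
    then have "z' \<in> mu" using sub by auto
    then have "act (z * inverse z') (z', k) \<in> worb w x"
      using aut_act_in[OF aut_worb[OF assms] z(2)] z(1) by simp
    moreover have "act (z * inverse z') (z', k) = (z, k)"
      using nonzero_mu[OF \<open>z' \<in> mu\<close>] by (simp add: act_def mult.assoc)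
    ultimately show "(z, snd (z', k)) \<in> worb w x" by simp
  qed
qed

text \<open>Projection to the columns carries orbits bijectively to cycles of the induced
  permutation. The base point \<open>(1, Min C)\<close> lies in the orbit because orbits are unions
  of columns, and as its first coordinate is 1, the scalar acquired in one round is the
  type.\<close>

lemma wtype_gtype:
  assumes "w \<in> wreath r n"
  shows "wtype r n w = gtype w (stdset r n)"
proof -
  let ?X = "stdset r n" and ?\<sigma> = "\<lambda>k. snd (w (1, k))"
  have w: "aut ?X w" using assms by (simp add: wreath_iff)
  have e: "(1, k) \<in> ?X" if "k \<in> {1..n}" for k using that by (auto simp: stdset_eq)
  \<comment> \<open>By equivariance the column of \<open>w p\<close> depends only on the column of
    \<open>p\<close>; hence iterates of \<open>w\<close> project to iterates of the induced
    permutation.\<close>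
  have \<sigma>: "snd (w p) = ?\<sigma> (snd p)" if "p \<in> ?X" for p
  proof -
    have p: "fst p \<in> mu" "p = act (fst p) (1, snd p)" "(1, snd p) \<in> ?X"
      using that by (auto simp: stdset_eq act_def)
    then have "w p = act (fst p) (w (1, snd p))" using aut_act[OF w p(3,1)] by simp
    then show ?thesis by (simp add: act_def)
  qed
  have \<sigma>t: "snd ((w ^^ t) (1, k)) = (?\<sigma> ^^ t) k" if "k \<in> {1..n}" for t k
    by (induction t) (use \<sigma> pow_in[OF w e[OF that]] in auto)
  have orb: "orb ?\<sigma> k = snd ` worb w (1, k)" if "k \<in> {1..n}" for k
  proof -
    have "orb ?\<sigma> k = {snd (act z ((w ^^ t) (1, k))) | z t. z \<in> mu}"
      unfolding orb_def act_def snd_conv \<sigma>t[OF that] using one_mu by blast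
    also have "\<dots> = snd ` worb w (1, k)" unfolding worb_def by blast
    finally show ?thesis .
  qed
  have W: "worbs w ?X = (\<lambda>k. worb w (1, k)) ` {1..n}"
  proof -
    have "worb w p = worb w (1, snd p)" if "p \<in> ?X" for p
    proof (rule worb_eq[OF w])
      show "(1, snd p) \<in> ?X" using that by (auto simp: stdset_eq)
      have "p = act (fst p) ((w ^^ 0) (1, snd p))" "fst p \<in> mu"
        using that by (auto simp: stdset_eq act_def)
      then show "p \<in> worb w (1, snd p)" unfolding worb_def by blast
    qed
    then have "worbs w ?X = (\<lambda>p. worb w (1, snd p)) ` ?X" by (simp add: worbs_def)
    also have "\<dots> = (\<lambda>k. worb w (1, k)) ` snd ` ?X" by (simp add: image_image)
    also have "snd ` ?X = {1..n}" using one_mu unfolding stdset_eq by (metis empty_iff snd_image_times)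
    finally show ?thesis .
  qed
  have "inj_on (\<lambda>S. snd ` S) (worbs w ?X)"
  proof (rule inj_onI)
    fix S T assume ST: "S \<in> worbs w ?X" "T \<in> worbs w ?X" and eq: "snd ` S = snd ` T"
    have *: "S = mu \<times> snd ` S" if "S \<in> worbs w ?X" for S
      using worb_times[OF w] that unfolding worbs_def by blast
    show "S = T" using *[OF ST(1)] *[OF ST(2)] unfolding eq by (rule trans[OF _ sym])
  qed
  moreover have "orb ?\<sigma> ` {1..n} = (\<lambda>S. snd ` S) ` worbs w ?X"
    unfolding W image_image by (rule image_cong[OF refl]) (rule orb)
  ultimately have "mset_set (orb ?\<sigma> ` {1..n}) = image_mset (\<lambda>S. snd ` S) (mset_set (worbs w ?X))"
    by (simp add: image_mset_mset_set)
  moreover have "(card (snd ` S), fst ((w ^^ card (snd ` S)) (1, Min (snd ` S)))) = otype w S"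
    if S_worbs: "S \<in> worbs w ?X" for S
  proof -
    obtain x where x: "x \<in> ?X" "S = worb w x" using S_worbs by (auto simp: worbs_def)
    have S: "S = mu \<times> snd ` S" using worb_times[OF w x(1)] x(2) by simp
    have fin: "finite S" using aut_finite[OF w] worb_subset[OF w x(1)] x(2) finite_subset by blast
    have "card S = r * card (snd ` S)" by (subst S) (simp add: card_mu card_cartesian_product)
    then have c: "card (snd ` S) = per w x" using card_worb[OF w x(1)] x(2) r_pos by simp
    have "snd ` S \<noteq> {}" using x(2) worb_self by blast
    then have "Min (snd ` S) \<in> snd ` S" using fin by (intro Min_in) auto
    then have "(1, Min (snd ` S)) \<in> mu \<times> snd ` S" using one_mu by blast
    then have y: "(1, Min (snd ` S)) \<in> S" by (rule subsetD[OF equalityD2[OF S]])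
    then have y': "(1, Min (snd ` S)) \<in> worb w x" by (simp only: x(2)[symmetric])
    then have yX: "(1, Min (snd ` S)) \<in> ?X" by (rule subsetD[OF worb_subset[OF w x(1)]])
    have "(w ^^ per w x) (1, Min (snd ` S)) = act (lab w x) (1, Min (snd ` S))"
      using pow_per[OF w yX] unfolding per_lab_worb[OF w x(1) y'] .
    then have "fst ((w ^^ card (snd ` S)) (1, Min (snd ` S))) = lab w x"
      unfolding c by (simp add: act_def)
    then show ?thesis using c otype_worb[OF w x(1)] unfolding x(2)[symmetric] by simp
  qed
  ultimately show ?thesis
    using finite_worbs[OF w]
    by (auto simp: wtype_def Let_def gtype_def image_mset.compositionality comp_def
        intro!: image_mset_cong)
qed

text \<open>For the identity every orbit is a single mu_r-orbit, of length and type 1. The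
  centralizer of the identity is the full automorphism group, which is how
  \<open>r ^ n * fact n\<close> enters.\<close>

lemma gtype_id:
  assumes "objr r X" "card X = r * n"
  shows "gtype id X = replicate_mset n (1, 1)"
proof -
  have X: "aut X id" using aut_id assms by blast
  have "v = (1, 1)" if "v \<in># gtype id X" for v
  proof -
    have "v \<in> otype id ` worbs id X"
      using that finite_worbs[OF X] by (simp add: gtype_def)
    then obtain x where x: "x \<in> X" "v = (per id x, lab id x)"
      using otype_worb[OF X] unfolding worbs_def by blast
    have "per id x = 1" "lab id x = 1"
      by (rule per_lab_eqI[of 1 1 id x]; use aut_nonzero[OF X x(1)] in simp)+
    then show ?thesis using x by simp
  qed
  then have "set_mset (gtype id X) \<subseteq> {(1, 1)}" by blast
  then obtain k where k: "gtype id X = replicate_mset k (1, 1)"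
    using set_mset_subset_singletonD by metis
  then have "r * n = r * k" using card_weight[OF X] assms(2) by simp
  then show ?thesis using k r_pos by simp
qed

lemma cent_order_replicate: "cent_order (replicate_mset n (1, 1)) = r ^ n * fact n"
  by (simp add: cent_order_def)

text \<open>Transport of structure: an isomorphism of the bare free sets carries \<open>w\<close> to
  an automorphism of the standard set, which has the type of \<open>w\<close> because the same map
  is then an isomorphism of pairs.\<close>

lemma equiv_isos_partition:
  assumes X: "aut X w" and n: "card X = r * n"
  shows "equiv_isos X id (stdset r n) id =
    (\<Union>w'\<in>{w' \<in> wreath r n. gtype w' (stdset r n) = gtype w X}. equiv_isos X w (stdset r n) w')"
    (is "?A = (\<Union>w'\<in>?W. ?I w')")
proof
  let ?Y = "stdset r n"
  show "(\<Union>w'\<in>?W. ?I w') \<subseteq> ?A" by (auto simp: equiv_isos_def equiv_maps_def)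
  show "?A \<subseteq> (\<Union>w'\<in>?W. ?I w')"
  proof
    fix g assume "g \<in> ?A"
    then have e: "g \<in> equiv_maps X id ?Y act id" and b: "bij_betw g X ?Y" by (auto simp: equiv_isos_def)
    have img: "g ` X = ?Y" and inj: "inj_on g X" using b by (auto simp: bij_betw_def)
    define w' where "w' = (\<lambda>y. if y \<in> ?Y then g (w (inv_into X g y)) else y)"
    have w'g: "w' (g x) = g (w x)" if "x \<in> X" for x
      using that img inj by (auto simp: w'_def)
    have gact: "g (act z x) = act z (g x)" if "x \<in> X" "z \<in> mu" for x z
      using e that by (simp add: equiv_maps_def)
    have "w' ` ?Y = g ` w ` X"
      unfolding img[symmetric] image_image by (rule image_cong[OF refl]) (rule w'g)
    then have im: "w' ` ?Y = ?Y" using X img by (simp add: aut_def bij_betw_def)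
    moreover have "inj_on w' ?Y"
      using eq_card_imp_inj_on im objr_stdset by (metis objr_def)
    moreover have "w' (act z y) = act z (w' y)" if "y \<in> ?Y" "z \<in> mu" for y z
    proof -
      have "y \<in> g ` X" using that(1) by (simp add: img)
      then obtain x where x: "x \<in> X" "y = g x" by blast
      then show ?thesis
        using w'g[OF aut_act_in[OF X x(1) that(2)]] w'g[OF x(1)] gact[OF x(1) that(2)]
          gact[OF aut_in[OF X x(1)] that(2)] aut_act[OF X x(1) that(2)] by simp
    qed
    ultimately have Y: "aut ?Y w'" using objr_stdset by (simp add: aut_def bij_betw_def)
    have g: "g \<in> ?I w'" using e b w'g by (auto simp: equiv_isos_def equiv_maps_def)
    have "w' \<in> ?W" using Y gtype_equiv_isos[OF X Y g] by (auto simp: wreath_iff w'_def)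
    then show "g \<in> (\<Union>w'\<in>?W. ?I w')" using g by blast
  qed
qed

text \<open>Orbit-stabilizer as a double count of the isomorphisms from \<open>X\<close> to the
  standard set: there are \<open>r ^ n * fact n\<close> in all, and each \<open>w'\<close> of the
  right type receives \<open>cent_order\<close> many.\<close>

lemma card_wreath_type:
  assumes X: "aut X w" and n: "card X = r * n"
  shows "card {w' \<in> wreath r n. gtype w' (stdset r n) = gtype w X} * cent_order (gtype w X) = r ^ n * fact n"
    (is "card ?W * _ = _")
proof -
  let ?Y = "stdset r n"
  have a: "aut ?Y w'" "gtype w X = gtype w' ?Y" if "w' \<in> ?W" for w' using that by (auto simp: wreath_iff)
  have "r ^ n * fact n = card (equiv_isos X id ?Y id)"
    using card_equiv_isos[OF aut_id aut_id, of X ?Y] gtype_id[OF aut_objr[OF X] n]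
      gtype_id[OF objr_stdset card_stdset, of n] aut_objr[OF X] objr_stdset
    by (simp add: cent_order_replicate[simplified])
  also have "\<dots> = (\<Sum>w'\<in>?W. card (equiv_isos X w ?Y w'))"
    unfolding equiv_isos_partition[OF assms]
  proof (rule card_UN_disjoint)
    show "finite ?W" using finite_wreath by simp
    show "\<forall>w'\<in>?W. finite (equiv_isos X w ?Y w')" using finite_equiv_isos[OF X] a by blast
    \<comment> \<open>The isomorphism determines \<open>w'\<close>: conjugation fixes it on the
      standard set, and elements of \<open>wreath\<close> are the identity elsewhere.\<close>
    show "\<forall>i\<in>?W. \<forall>j\<in>?W. i \<noteq> j \<longrightarrow> equiv_isos X w ?Y i \<inter> equiv_isos X w ?Y j = {}"
    proof (intro ballI impI, rule ccontr)
      fix i j assume ij: "i \<in> ?W" "j \<in> ?W" "i \<noteq> j" "equiv_isos X w ?Y i \<inter> equiv_isos X w ?Y j \<noteq> {}"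
      then obtain g where g: "g \<in> equiv_isos X w ?Y i" "g \<in> equiv_isos X w ?Y j" by blast
      have "i y = j y" for y
      proof (cases "y \<in> ?Y")
        case True
        then have "y \<in> g ` X" using g by (simp add: equiv_isos_def bij_betw_def)
        then obtain x where "x \<in> X" "y = g x" by blast
        then show ?thesis using g by (simp add: equiv_isos_def equiv_maps_def)
      next
        case False
        moreover have "i y = y" "j y = y" using ij(1,2) False unfolding wreath_iff by blast+
        ultimately show ?thesis by simp
      qed
      then show False using ij(3) by blast
    qed
  qed
  also have "\<dots> = (\<Sum>w'\<in>?W. cent_order (gtype w X))"
    by (intro sum.cong refl card_equiv_isos[OF X] a)
  finally show ?thesis by simp
qed

text \<open>Constancy of the trace is taken as a hypothesis, so that the lemma serves modules,
  through invariance, and the composite, through its explicit trace.\<close>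

lemma chr_const:
  assumes X: "aut X w"
    and T: "\<And>n w'. aut (stdset r n) w' \<Longrightarrow> gtype w' (stdset r n) = gtype w X \<Longrightarrow> trace V w' (stdset r n) = T"
  shows "chr r V (gtype w X) = T / of_nat (cent_order (gtype w X))"
proof -
  let ?m = "gtype w X"
  define n where "n = sum_mset (image_mset fst ?m)"
  let ?Y = "stdset r n" and ?W = "{w' \<in> wreath r n. gtype w' (stdset r n) = ?m}"
  have n: "card X = r * n" using card_weight[OF X] by (simp add: n_def)
  have "{w \<in> wreath r n. wtype r n w = ?m} = ?W" using wtype_gtype by auto
  then have "chr r V ?m = 1 / (of_nat r ^ n * fact n) * (\<Sum>w'\<in>?W. trace V w' ?Y)"
    by (simp add: chr_def Let_def n_def)
  also have "(\<Sum>w'\<in>?W. trace V w' ?Y) = (\<Sum>w'\<in>?W. T)"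
    by (rule sum.cong[OF refl]) (use T in \<open>auto simp: wreath_iff\<close>)
  also have "\<dots> = of_nat (card ?W) * T" by simp
  also have "(of_nat r ^ n * fact n :: complex) = of_nat (card ?W) * of_nat (cent_order ?m)"
    using arg_cong[OF card_wreath_type[OF X n], of "of_nat :: nat \<Rightarrow> complex"] by simp
  finally have *: "chr r V ?m = 1 / (of_nat (card ?W) * of_nat (cent_order ?m)) * (of_nat (card ?W) * T)" .
  have "card ?W \<noteq> 0"
    using card_wreath_type[OF X n] r_pos by (intro notI) simp
  then show ?thesis using * by simp
qed

lemma chr_eq:
  assumes V: "is_module (objr r) (homr r) V" and X: "aut X w"
  shows "chr r V (gtype w X) = trace V w X / of_nat (cent_order (gtype w X))"
proof (rule chr_const[OF X])
  fix n w' assume Y: "aut (stdset r n) w'" "gtype w' (stdset r n) = gtype w X"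
  then obtain g where "g \<in> equiv_isos X w (stdset r n) w'" using equiv_isos_nonempty[OF X] by metis
  then show "trace V w' (stdset r n) = trace V w X" using trace_equiv_isos[OF V X Y(1)] by simp
qed

text \<open>A nonzero coefficient makes the index set of the sum nonempty, and any \<open>w\<close>
  in it realises \<open>m\<close> as the type of an object.\<close>

lemma chr_nonzero:
  assumes "chr r V m \<noteq> 0"
  shows "\<And>v. v \<in># m \<Longrightarrow> 0 < fst v \<and> snd v \<in> mu"
proof -
  let ?n = "sum_mset (image_mset fst m)"
  have "{w \<in> wreath r ?n. wtype r ?n w = m} \<noteq> {}"
    using assms unfolding chr_def Let_def by force
  then obtain w where "w \<in> wreath r ?n" "wtype r ?n w = m" by blast
  then have "aut (stdset r ?n) w" "gtype w (stdset r ?n) = m"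
    using wtype_gtype by (auto simp: wreath_iff)
  then show "0 < fst v \<and> snd v \<in> mu" if "v \<in># m" for v
    using gtype_elem[of "stdset r ?n" w v] that by auto
qed

section \<open>Realising a monomial by an object\<close>

lemma gtype_cong:
  assumes "aut X w" "\<And>x. x \<in> X \<Longrightarrow> w' x = w x"
  shows "aut X w'" "gtype w' X = gtype w X"
proof -
  show X: "aut X w'"
    using assms aut_act_in[OF assms(1)] by (auto simp: aut_def cong: bij_betw_cong)
  have "restrict id X \<in> equiv_isos X w X w'"
    using assms aut_act_in[OF assms(1)] aut_in[OF assms(1)] by (auto simp: equiv_isos_def equiv_maps_def bij_betw_def inj_on_def)
  then show "gtype w' X = gtype w X" using gtype_equiv_isos[OF assms(1) X] by blast
qed

lemma gtype_exists:
  assumes "\<And>v. v \<in># m \<Longrightarrow> 0 < fst v \<and> snd v \<in> mu"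
  obtains X w where "aut X w" "gtype w X = m"
proof -
  have "\<exists>X w. aut X w \<and> gtype w X = m"
    using assms
  proof (induction m)
    case empty
    have "aut {} id" by (simp add: aut_def objr_def)
    moreover have "gtype id {} = {#}" by (simp add: gtype_def worbs_def)
    ultimately show ?case by blast
  next
    case (add v m)
    then obtain X w where X: "aut X w" "gtype w X = m" by auto
    obtain L \<zeta> where v: "v = (L, \<zeta>)" "0 < L" "\<zeta> \<in> mu"
      using add.prems[of v] by (cases v) auto
    \<comment> \<open>\<open>a\<close> lies beyond all columns in use, so a block of new columns
      starting there is disjoint from \<open>X\<close>.\<close>
    obtain a where a: "\<And>x. x \<in> X \<Longrightarrow> snd x < a"
      using aut_finite[OF X(1)] finite_nat_set_iff_bounded[of "snd ` X"] by auto
    define C where "C = mu \<times> {a..<a + L}"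
    have disj: "X \<inter> C = {}" using a by (force simp: C_def)
    \<comment> \<open>On the new block \<open>u\<close> shifts to the next column and, on wrapping
      round from the last column to column \<open>a\<close>, multiplies by \<zeta>. One round thus
      takes \<open>L\<close> steps and acts as \<zeta>.\<close>
    define u where "u = (\<lambda>p. if p \<in> X then w p
        else if snd p + 1 < a + L then (fst p, snd p + 1) else (\<zeta> * fst p, a))"
    have uX: "u p = w p" if "p \<in> X" for p using that by (simp add: u_def)
    have uC: "u p = (if snd p + 1 < a + L then (fst p, snd p + 1) else (\<zeta> * fst p, a))"
      if "p \<in> C" for p using that disj by (auto simp: u_def)
    have Cact: "act z p \<in> C" if "p \<in> C" "z \<in> mu" for p z using that by (auto simp: C_def act_def)
    have Cin: "u p \<in> C" if "p \<in> C" for p using that v uC[OF that] by (auto simp: C_def)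
    have finC: "finite C" by (simp add: C_def)
    have "inj_on u C"
    proof (rule inj_onI)
      fix p q assume pq: "p \<in> C" "q \<in> C" "u p = u q"
      then show "p = q" using uC nonzero_mu[OF v(3)]
        by (auto simp: C_def prod_eq_iff split: if_splits)
    qed
    then have "bij_betw u C C"
      using Cin finC by (simp add: bij_betw_def endo_inj_surj image_subsetI)
    moreover have Xu: "aut X u" "gtype u X = m" using gtype_cong[OF X(1) uX] X(2) by auto
    ultimately have "bij_betw u (X \<union> C) (X \<union> C)"
      using disj by (intro bij_betw_combine) (auto simp: aut_def)
    moreover have "objr r (X \<union> C)"
      using aut_objr[OF X(1)] finC Cact nonzero_mu by (auto simp: objr_def C_def)
    moreover have "u (act z p) = act z (u p)" if "p \<in> C" "z \<in> mu" for p z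
      using uC[OF that(1)] uC[OF Cact[OF that]] by (simp add: act_def)
    ultimately have XC: "aut (X \<union> C) u" using Xu(1) by (auto simp: aut_def)
    have C: "aut C u" by (rule aut_subset[OF XC]) (use Cin Cact in auto)
    let ?x = "(1, a)"
    have x: "?x \<in> C" using v by (simp add: C_def)
    have pw: "(u ^^ t) ?x = (1, a + t)" if "t < L" for t
      using that
    proof (induction t)
      case (Suc t)
      then have "(1, a + t) \<in> C" by (auto simp: C_def)
      then show ?case using Suc uC by simp
    qed simp
    have "C \<subseteq> worb u ?x"
    proof
      fix p assume p: "p \<in> C"
      then have "fst p \<in> mu" "p = act (fst p) ((u ^^ (snd p - a)) ?x)"
        using pw[of "snd p - a"] by (auto simp: C_def act_def)
      then show "p \<in> worb u ?x" unfolding worb_def by blast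
    qed
    then have O: "worb u ?x = C" using worb_subset[OF C x] by blast
    \<comment> \<open>The length is obtained from the size of the orbit: \<open>C\<close> is a
      single orbit with \<open>r * L\<close> points.\<close>
    have "r * per u ?x = r * L"
      using card_worb[OF C x] unfolding O by (auto simp: C_def card_mu card_cartesian_product)
    then have per: "per u ?x = L" using r_pos by simp
    have "(u ^^ L) ?x = u ((u ^^ (L - 1)) ?x)" using v(2) by (cases L) auto
    also have "\<dots> = act \<zeta> ?x" using pw[of "L - 1"] v(2) uC[of "(1, a + (L - 1))"] by (simp add: C_def act_def)
    finally have lab: "lab u ?x = \<zeta>"
      using pow_per[OF C x] per act_eq_iff[of ?x] by simp
    have "gtype u (X \<union> C) = add_mset v (gtype u (X \<union> C - C))"
      using gtype_remove[OF XC, of ?x] x O per lab v(1) by simp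
    also have "X \<union> C - C = X" using disj by blast
    finally show ?case using XC Xu(2) by blast
  qed
  then show thesis using that by blast
qed

end

section \<open>Traces of permuted tensor products\<close>

lemma finite_sub_mset: "finite {A. A \<subseteq># (m :: 'v multiset)}"
proof (rule finite_subset)
  show "{A. A \<subseteq># m} \<subseteq> (\<Union>k\<in>{..size m}. multisets_of_size (set_mset m) k)"
    by (auto simp: multisets_of_size_def size_mset_mono dest: mset_subset_eqD)
  show "finite (\<Union>k\<in>{..size m}. multisets_of_size (set_mset m) k)" by auto
qed

section \<open>Sums over sections of a family of finite sets, and matrix products as sums over
  paths\<close>

lemma sum_PiE_insert:
  assumes "i \<notin> I"
  shows "(\<Sum>\<tau>\<in>PiE (insert i I) B. f \<tau>) = (\<Sum>x\<in>B i. \<Sum>\<tau>\<in>PiE I B. f (\<tau>(i := x)))"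
  unfolding PiE_insert_eq
  by (subst sum.reindex[OF inj_combinator[OF assms]]) (simp add: sum.cartesian_product case_prod_beta)

lemma sum_PiE_Un:
  fixes f g :: "_ \<Rightarrow> complex"
  assumes "P \<inter> Q = {}"
  shows "(\<Sum>\<sigma>\<in>PiE (P \<union> Q) B. f (restrict \<sigma> P) * g (restrict \<sigma> Q)) = (\<Sum>\<sigma>\<in>PiE P B. f \<sigma>) * (\<Sum>\<sigma>\<in>PiE Q B. g \<sigma>)"
proof -
  let ?i = "\<lambda>(\<sigma>, \<tau>). \<lambda>p. if p \<in> P then \<sigma> p else \<tau> p"
  let ?j = "\<lambda>\<sigma>. (restrict \<sigma> P, restrict \<sigma> Q)"
  have "(\<Sum>\<sigma>\<in>PiE (P \<union> Q) B. f (restrict \<sigma> P) * g (restrict \<sigma> Q))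
      = (\<Sum>p\<in>PiE P B \<times> PiE Q B. f (fst p) * g (snd p))"
  proof (rule sum.reindex_bij_witness[where j = ?j and i = ?i])
    fix \<sigma> assume \<sigma>: "\<sigma> \<in> PiE (P \<union> Q) B"
    then have "\<sigma> p = undefined" if "p \<notin> P" "p \<notin> Q" for p using that by (auto simp: PiE_def extensional_def)
    then show "?i (?j \<sigma>) = \<sigma>" by (auto simp: fun_eq_iff)
    show "?j \<sigma> \<in> PiE P B \<times> PiE Q B" using \<sigma> by auto
    show "f (fst (?j \<sigma>)) * g (snd (?j \<sigma>)) = f (restrict \<sigma> P) * g (restrict \<sigma> Q)" by simp
  next
    fix p assume "p \<in> PiE P B \<times> PiE Q B"
    then obtain \<sigma> \<tau> where p: "p = (\<sigma>, \<tau>)" "\<sigma> \<in> PiE P B" "\<tau> \<in> PiE Q B" by blast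
    have "restrict (?i p) P = \<sigma>"
      using p by (auto simp: fun_eq_iff PiE_def extensional_def)
    moreover have "restrict (?i p) Q = \<tau>"
      using p assms by (auto simp: fun_eq_iff PiE_def extensional_def)
    ultimately show "?j (?i p) = p" using p by simp
    show "?i p \<in> PiE (P \<union> Q) B" using p by (auto simp: PiE_iff extensional_def)
  qed
  then show ?thesis by (simp add: sum_product sum.cartesian_product case_prod_beta)
qed

lemma sum_PiE_reindex:
  assumes "bij_betw h I J"
  shows "(\<Sum>\<sigma>\<in>PiE J B. f (\<lambda>t\<in>I. \<sigma> (h t))) = (\<Sum>\<tau>\<in>PiE I (\<lambda>t. B (h t)). f \<tau>)"
proof (rule sum.reindex_bij_witness[where j = "\<lambda>\<sigma>. \<lambda>t\<in>I. \<sigma> (h t)" and i = "\<lambda>\<tau>. \<lambda>j\<in>J. \<tau> (inv_into I h j)"])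
  have h: "inv_into I h (h t) = t" "h t \<in> J" if "t \<in> I" for t
    using assms that by (auto simp: bij_betw_def)
  have k: "inv_into I h j \<in> I" "h (inv_into I h j) = j" if "j \<in> J" for j
    using assms that by (auto simp: bij_betw_def inv_into_into f_inv_into_f)
  fix \<sigma> assume \<sigma>: "\<sigma> \<in> PiE J B"
  show "(\<lambda>j\<in>J. (\<lambda>t\<in>I. \<sigma> (h t)) (inv_into I h j)) = \<sigma>"
    using \<sigma> k by (auto simp: fun_eq_iff PiE_def extensional_def)
  show "(\<lambda>t\<in>I. \<sigma> (h t)) \<in> PiE I (\<lambda>t. B (h t))" using \<sigma> h by auto
  show "f (\<lambda>t\<in>I. \<sigma> (h t)) = f (\<lambda>t\<in>I. \<sigma> (h t))" ..
next
  have h: "inv_into I h (h t) = t" "h t \<in> J" if "t \<in> I" for t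
    using assms that by (auto simp: bij_betw_def)
  have k: "inv_into I h j \<in> I" "h (inv_into I h j) = j" if "j \<in> J" for j
    using assms that by (auto simp: bij_betw_def inv_into_into f_inv_into_f)
  fix \<tau> assume \<tau>: "\<tau> \<in> PiE I (\<lambda>t. B (h t))"
  show "(\<lambda>t\<in>I. (\<lambda>j\<in>J. \<tau> (inv_into I h j)) (h t)) = \<tau>"
    using \<tau> h by (auto simp: fun_eq_iff PiE_def extensional_def)
  show "(\<lambda>j\<in>J. \<tau> (inv_into I h j)) \<in> PiE J B"
    using PiE_mem[OF \<tau> k(1)] k(2) by auto
qed

text \<open>A product of matrices expanded over all paths of basis indices, \<open>P\<close> being
  the accumulated product. The weight \<open>g\<close> of the two endpoints makes the induction
  work, since it can absorb the last matrix entry; it later closes the path into a trace.\<close>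

lemma path_sum:
  fixes M P :: "nat \<Rightarrow> 'b \<Rightarrow> 'b \<Rightarrow> complex"
  assumes fin: "\<And>t. finite (B t)"
    and P0: "\<And>b b'. b \<in> B 0 \<Longrightarrow> b' \<in> B 0 \<Longrightarrow> P 0 b' b = (if b' = b then 1 else 0)"
    and PS: "\<And>n b b''. b \<in> B 0 \<Longrightarrow> b'' \<in> B (Suc n) \<Longrightarrow>
      P (Suc n) b'' b = (\<Sum>b'\<in>B n. M n b'' b' * P n b' b)"
  shows "(\<Sum>\<tau>\<in>PiE {..n} B. (\<Prod>t<n. M t (\<tau> (Suc t)) (\<tau> t)) * g (\<tau> 0) (\<tau> n))
    = (\<Sum>b\<in>B 0. \<Sum>b'\<in>B n. P n b' b * g b b')"
proof (induction n arbitrary: g)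
  case 0
  have "(\<Sum>\<tau>\<in>PiE {..0} B. g (\<tau> 0) (\<tau> 0)) = (\<Sum>b\<in>B 0. g b b)"
    using sum_PiE_insert[of 0 "{}" "\<lambda>\<tau>. g (\<tau> 0) (\<tau> 0)" B] by simp
  also have "\<dots> = (\<Sum>b\<in>B 0. \<Sum>b'\<in>B 0. P 0 b' b * g b b')"
  proof (rule sum.cong[OF refl])
    fix b assume b: "b \<in> B 0"
    have "(\<Sum>b'\<in>B 0. P 0 b' b * g b b') = (\<Sum>b'\<in>B 0. if b' = b then g b b' else 0)"
      using P0[OF b] by (intro sum.cong) auto
    then show "g b b = (\<Sum>b'\<in>B 0. P 0 b' b * g b b')" using b fin by (simp add: sum.delta')
  qed
  finally show ?case by simp
next
  case (Suc n)
  have ins: "{..Suc n} = insert (Suc n) {..n}" by auto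
  let ?F = "\<lambda>n \<tau>. \<Prod>t<n. M t (\<tau> (Suc t)) (\<tau> t)"
  have "(\<Sum>\<tau>\<in>PiE {..Suc n} B. ?F (Suc n) \<tau> * g (\<tau> 0) (\<tau> (Suc n)))
      = (\<Sum>x\<in>B (Suc n). \<Sum>\<tau>\<in>PiE {..n} B. ?F (Suc n) (\<tau>(Suc n := x)) * g (\<tau> 0) x)"
    unfolding ins by (subst sum_PiE_insert) auto
  also have "\<dots> = (\<Sum>x\<in>B (Suc n). \<Sum>\<tau>\<in>PiE {..n} B. ?F n \<tau> * (M n x (\<tau> n) * g (\<tau> 0) x))"
  proof (intro sum.cong refl)
    fix x and \<tau> :: "nat \<Rightarrow> 'b"
    have "?F n (\<tau>(Suc n := x)) = ?F n \<tau>" by (rule prod.cong) auto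
    then show "?F (Suc n) (\<tau>(Suc n := x)) * g (\<tau> 0) x = ?F n \<tau> * (M n x (\<tau> n) * g (\<tau> 0) x)" by simp
  qed
  also have "\<dots> = (\<Sum>\<tau>\<in>PiE {..n} B. ?F n \<tau> * (\<Sum>x\<in>B (Suc n). M n x (\<tau> n) * g (\<tau> 0) x))"
    by (subst sum.swap) (simp add: sum_distrib_left)
  also have "\<dots> = (\<Sum>b\<in>B 0. \<Sum>b'\<in>B n. P n b' b * (\<Sum>x\<in>B (Suc n). M n x b' * g b x))"
    by (rule Suc.IH)
  also have "\<dots> = (\<Sum>b\<in>B 0. \<Sum>x\<in>B (Suc n). (\<Sum>b'\<in>B n. M n x b' * P n b' b) * g b x)"
  proof (rule sum.cong[OF refl])
    fix b
    show "(\<Sum>b'\<in>B n. P n b' b * (\<Sum>x\<in>B (Suc n). M n x b' * g b x))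
      = (\<Sum>x\<in>B (Suc n). (\<Sum>b'\<in>B n. M n x b' * P n b' b) * g b x)"
      unfolding sum_distrib_left sum_distrib_right by (subst sum.swap) (simp add: ac_simps)
  qed
  also have "\<dots> = (\<Sum>b\<in>B 0. \<Sum>x\<in>B (Suc n). P (Suc n) x b * g b x)"
    using PS by (intro sum.cong refl) simp
  finally show ?case .
qed

section \<open>Cycles with a marked starting point\<close>

definition is_cycle :: "('x \<Rightarrow> 'x) \<Rightarrow> 'x \<Rightarrow> 'x set \<Rightarrow> bool" where
  "is_cycle s p c \<longleftrightarrow> 0 < card c \<and> bij_betw (\<lambda>t. (s ^^ t) p) {..<card c} c \<and> (s ^^ card c) p = p"

lemma is_cycle_mod:
  assumes "is_cycle s p c"
  shows "(s ^^ t) p = (s ^^ (t mod card c)) p"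
proof -
  have "(s ^^ (card c * q)) p = p" for q
    using assms by (induction q) (simp_all add: is_cycle_def funpow_add)
  then have "(s ^^ (t mod card c + card c * (t div card c))) p = (s ^^ (t mod card c)) p"
    by (simp only: funpow_add_apply)
  then show ?thesis by simp
qed

lemma is_cycle_eq_iff:
  assumes "is_cycle s p c"
  shows "(s ^^ t) p = (s ^^ u) p \<longleftrightarrow> t mod card c = u mod card c"
proof
  assume "(s ^^ t) p = (s ^^ u) p"
  then have "(s ^^ (t mod card c)) p = (s ^^ (u mod card c)) p"
    using is_cycle_mod[OF assms] by metis
  moreover have "inj_on (\<lambda>t. (s ^^ t) p) {..<card c}" "0 < card c"
    using assms by (auto simp: is_cycle_def bij_betw_def)
  ultimately show "t mod card c = u mod card c"
    by (auto dest!: inj_onD)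
next
  assume "t mod card c = u mod card c"
  then show "(s ^^ t) p = (s ^^ u) p" using is_cycle_mod[OF assms] by metis
qed

lemma is_cycle_fix_iff: "is_cycle s p c \<Longrightarrow> (s ^^ t) p = p \<longleftrightarrow> card c dvd t"
  using is_cycle_eq_iff[of s p c t 0] by auto

lemma is_cycle_pow_in: "is_cycle s p c \<Longrightarrow> (s ^^ t) p \<in> c"
  using is_cycle_mod[of s p c t] by (auto simp: is_cycle_def bij_betw_def)

lemma is_cycle_elem:
  assumes "is_cycle s p c" "q \<in> c"
  obtains t where "t < card c" "q = (s ^^ t) p"
proof -
  have "c = (\<lambda>t. (s ^^ t) p) ` {..<card c}" using assms(1) by (simp add: is_cycle_def bij_betw_def)
  then have "q \<in> (\<lambda>t. (s ^^ t) p) ` {..<card c}" using assms(2) by simp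
  then show thesis using that by auto
qed

lemma is_cycle_closed: "is_cycle s p c \<Longrightarrow> q \<in> c \<Longrightarrow> s q \<in> c"
  using is_cycle_elem[of s p c q] is_cycle_pow_in[of s p c] by (metis funpow.simps(2) comp_apply)

lemma is_cycle_finite: "is_cycle s p c \<Longrightarrow> finite c"
  unfolding is_cycle_def using card_gt_0_iff by blast

text \<open>\<open>card c - u\<close> further steps turn iterates of \<open>q\<close> into iterates
  of \<open>p\<close> delayed by one full round, where coincidences are governed by residues modulo
  \<open>card c\<close>.\<close>

lemma is_cycle_base:
  assumes "is_cycle s p c" "q \<in> c"
  shows "is_cycle s q c"
proof -
  obtain u where u: "u < card c" "q = (s ^^ u) p" using is_cycle_elem[OF assms] .
  have pow: "(s ^^ t) q = (s ^^ (t + u)) p" for t using u(2) by (simp add: funpow_add)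
  have pos: "0 < card c" using assms(1) by (simp add: is_cycle_def)
  have "inj_on (\<lambda>t. (s ^^ t) q) {..<card c}"
  proof (rule inj_onI)
    fix t t' assume t: "t \<in> {..<card c}" "t' \<in> {..<card c}" "(s ^^ t) q = (s ^^ t') q"
    have shift: "(s ^^ (card c - u)) ((s ^^ v) q) = (s ^^ (v + card c)) p" for v
      unfolding pow funpow_add_apply[symmetric] using u(1) by (simp add: add.commute)
    have "(t + card c) mod card c = (t' + card c) mod card c"
      using shift[of t] shift[of t'] t(3) is_cycle_eq_iff[OF assms(1)] by metis
    then show "t = t'" using t(1,2) by simp
  qed
  moreover have "(\<lambda>t. (s ^^ t) q) ` {..<card c} \<subseteq> c" using pow is_cycle_pow_in[OF assms(1)] by auto
  ultimately have "bij_betw (\<lambda>t. (s ^^ t) q) {..<card c} c"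
    using is_cycle_finite[OF assms(1)] by (simp add: bij_betw_def card_image card_subset_eq)
  moreover have "(s ^^ card c) q = q" unfolding pow using u(2) is_cycle_eq_iff[OF assms(1)] by simp
  ultimately show ?thesis using pos by (simp add: is_cycle_def)
qed

lemma is_cycle_fix_iff': "is_cycle s p c \<Longrightarrow> q \<in> c \<Longrightarrow> (s ^^ t) q = q \<longleftrightarrow> card c dvd t"
  using is_cycle_fix_iff is_cycle_base by metis

text \<open>The trace of w on the tensor product of the V(F p), where w maps the factor at p to the factor
  at s p.\<close>
definition tensor_trace where
  "tensor_trace V w F Q s = (\<Sum>\<sigma>\<in>(\<Pi>\<^sub>E p\<in>Q. basis V (F p)). \<Prod>p\<in>Q. mat V w (F p) (\<sigma> (s p)) (\<sigma> p))"

lemma tensor_trace_cong: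
  assumes "\<And>p. p \<in> Q \<Longrightarrow> F p = F' p" "\<And>p. p \<in> Q \<Longrightarrow> s p = s' p"
  shows "tensor_trace V w F Q s = tensor_trace V w F' Q s'"
  unfolding tensor_trace_def
  by (intro sum.cong prod.cong PiE_cong) (use assms in auto)

text \<open>Both parts are stable under \<open>s\<close>, so each matrix entry involves indices from
  one part only, and a section over the union is a pair of sections.\<close>

lemma tensor_trace_Un:
  assumes "P \<inter> Q = {}" "finite P" "finite Q" "\<And>p. p \<in> P \<Longrightarrow> s p \<in> P" "\<And>p. p \<in> Q \<Longrightarrow> s p \<in> Q"
  shows "tensor_trace V w F (P \<union> Q) s = tensor_trace V w F P s * tensor_trace V w F Q s"
proof -
  let ?f = "\<lambda>Q \<sigma>. \<Prod>p\<in>Q. mat V w (F p) (\<sigma> (s p)) (\<sigma> p)"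
  have "tensor_trace V w F (P \<union> Q) s
      = (\<Sum>\<sigma>\<in>(\<Pi>\<^sub>E p\<in>P \<union> Q. basis V (F p)). ?f P (restrict \<sigma> P) * ?f Q (restrict \<sigma> Q))"
    unfolding tensor_trace_def using assms
    by (intro sum.cong refl) (simp add: prod.union_disjoint)
  also have "\<dots> = tensor_trace V w F P s * tensor_trace V w F Q s"
    unfolding tensor_trace_def by (rule sum_PiE_Un[OF assms(1)])
  finally show ?thesis .
qed

context root_sets
begin

section \<open>Invariant labellings and their fibres\<close>

abbreviation inv_maps where "inv_maps X w Q s \<equiv> equiv_maps X w Q (\<lambda>_ y. y) s"

definition fiber :: "(complex \<times> nat \<Rightarrow> 'x) \<Rightarrow> (complex \<times> nat) set \<Rightarrow> 'x \<Rightarrow> (complex \<times> nat) set" where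
  "fiber \<phi> X p = {x \<in> X. \<phi> x = p}"

definition labelled_trace where
  "labelled_trace V w X Q s = (\<Sum>\<phi>\<in>inv_maps X w Q s. tensor_trace V w (fiber \<phi> X) Q s)"

lemma homr_comp:
  assumes "homr r I f" "homr r (f ` I) g"
  shows "homr r I (g \<circ> f)"
  using assms unfolding homr_def image_comp by (auto intro: comp_inj_on)

text \<open>Summing over the indices at all factors but one multiplies the matrices met in going
  round the cycle. By functoriality their product is the matrix of \<open>w ^^ card c\<close> on the
  factor at \<open>p\<close>, and the last index takes its trace.\<close>

lemma tensor_trace_cycle:
  assumes V: "is_module (objr r) (homr r) V" and c: "is_cycle s p c"
    and F: "\<And>q. q \<in> c \<Longrightarrow> homr r (F q) w \<and> w ` F q = F (s q)"
  shows "tensor_trace V w F c s = trace V (w ^^ card c) (F p)"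
proof -
  \<comment> \<open>At time \<open>t\<close>: the basis of the factor reached, the matrix of the
    step leaving it, and the matrix of the first \<open>t\<close> steps starting from
    \<open>F p\<close>.\<close>
  define B where "B = (\<lambda>t. basis V (F ((s ^^ t) p)))"
  define M where "M = (\<lambda>t. mat V w (F ((s ^^ t) p)))"
  define P where "P = (\<lambda>t. mat V (w ^^ t) (F p))"
  \<comment> \<open>The first \<open>n\<close> steps form an open path; the remaining one, leaving
    time \<open>n\<close>, returns to \<open>p\<close>.\<close>
  obtain n where n: "card c = Suc n" using c by (cases "card c") (auto simp: is_cycle_def)
  have Ft: "homr r (F ((s ^^ t) p)) w \<and> w ` F ((s ^^ t) p) = F ((s ^^ Suc t) p)" for t
    using F[OF is_cycle_pow_in[OF c]] by simp
  have img: "(w ^^ t) ` F p = F ((s ^^ t) p)" for t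
  proof (induction t)
    case (Suc t)
    have "(w ^^ Suc t) ` F p = w ` (w ^^ t) ` F p" by (simp add: image_comp)
    then show ?case using Suc Ft[of t] by simp
  qed simp
  have obj: "objr r (F p)" using Ft[of 0] by (simp add: homr_def)
  have hom: "homr r (F p) (w ^^ t)" for t
  proof (induction t)
    case 0
    then show ?case using obj by (simp add: homr_def)
  next
    case (Suc t)
    then show ?case using homr_comp[of "F p" "w ^^ t" w] Ft[of t] img by (simp add: comp_def)
  qed
  have fin: "finite (B t)" for t
  proof -
    have "\<forall>I. objr r I \<longrightarrow> finite (basis V I)"
      using V unfolding is_module_def by (elim conjE) assumption
    then show ?thesis using Ft[of t] by (simp add: B_def homr_def)
  qed
  have P0: "P 0 b' b = (if b' = b then 1 else 0)" if "b \<in> B 0" "b' \<in> B 0" for b b'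
  proof -
    have "mat V id (F p) b' b = (if b' = b then 1 else 0)"
      using V obj that unfolding is_module_def B_def by simp
    then show ?thesis by (simp add: P_def id_def)
  qed
  have PS: "P (Suc t) b'' b = (\<Sum>b'\<in>B t. M t b'' b' * P t b' b)"
    if b: "b \<in> B 0" "b'' \<in> B (Suc t)" for t b b''
  proof -
    have "\<forall>I f g. homr r I f \<longrightarrow> homr r (f ` I) g \<longrightarrow> (\<forall>b\<in>basis V I. \<forall>b''\<in>basis V (g ` f ` I).
           mat V (g \<circ> f) I b'' b = (\<Sum>b'\<in>basis V (f ` I). mat V g (f ` I) b'' b' * mat V f I b' b))"
      using V unfolding is_module_def by (elim conjE) assumption
    from this[rule_format, of "F p" "w ^^ t" w b b'']
    show ?thesis using hom[of t] Ft[of t] img[of t] b by (simp add: B_def M_def P_def)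
  qed
  let ?h = "\<lambda>t. (s ^^ t) p"
  have h: "bij_betw ?h {..n} c" using c n by (simp add: is_cycle_def lessThan_Suc_atMost)
  let ?G = "\<lambda>\<tau>. (\<Prod>t<n. M t (\<tau> (Suc t)) (\<tau> t)) * M n (\<tau> 0) (\<tau> n)"
  have ret: "(s ^^ Suc n) p = p" using c n by (simp add: is_cycle_def)
  have "tensor_trace V w F c s = (\<Sum>\<sigma>\<in>(\<Pi>\<^sub>E q\<in>c. basis V (F q)). ?G (\<lambda>t\<in>{..n}. \<sigma> (?h t)))"
    unfolding tensor_trace_def
  proof (rule sum.cong[OF refl])
    fix \<sigma>
    have "(\<Prod>q\<in>c. mat V w (F q) (\<sigma> (s q)) (\<sigma> q))
        = (\<Prod>t\<in>{..n}. mat V w (F (?h t)) (\<sigma> (s (?h t))) (\<sigma> (?h t)))"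
      by (rule prod.reindex_bij_betw[OF h, symmetric])
    also have "\<dots> = (\<Prod>t<n. M t (\<sigma> (?h (Suc t))) (\<sigma> (?h t))) * M n (\<sigma> p) (\<sigma> (?h n))"
      using ret by (simp add: M_def flip: lessThan_Suc_atMost)
    finally show "(\<Prod>q\<in>c. mat V w (F q) (\<sigma> (s q)) (\<sigma> q)) = ?G (\<lambda>t\<in>{..n}. \<sigma> (?h t))"
      by simp
  qed
  also have "\<dots> = (\<Sum>\<tau>\<in>PiE {..n} B. ?G \<tau>)"
    unfolding B_def by (rule sum_PiE_reindex[OF h])
  \<comment> \<open>The matrix entry of the returning step plays the role of the endpoint weight
    \<open>g\<close> in \<open>path_sum\<close>.\<close>
  also have "\<dots> = (\<Sum>b\<in>B 0. \<Sum>b'\<in>B n. P n b' b * M n b b')"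
    using path_sum[of B P M n "M n", OF fin P0 PS] by simp
  also have "\<dots> = (\<Sum>b\<in>B 0. P (Suc n) b b)"
  proof (rule sum.cong[OF refl])
    fix b assume b: "b \<in> B 0"
    moreover have "b \<in> B (Suc n)" using b ret by (simp add: B_def)
    ultimately show "(\<Sum>b'\<in>B n. P n b' b * M n b b') = P (Suc n) b b"
      using PS by (simp add: mult.commute)
  qed
  finally show ?thesis by (simp add: trace_def B_def P_def n)
qed

text \<open>A point over \<open>s q\<close> has a preimage under \<open>w\<close>, whose label is
  \<open>q\<close> because \<open>s\<close> is injective; so the fibre is hit completely.\<close>

lemma fiber_hom:
  assumes X: "aut X w" and \<phi>: "\<phi> \<in> inv_maps X w Q s" and s: "inj_on s Q" and q: "q \<in> Q"
  shows "homr r (fiber \<phi> X q) w" "w ` fiber \<phi> X q = fiber \<phi> X (s q)"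
proof -
  have \<phi>': "\<phi> x \<in> Q" "\<phi> (w x) = s (\<phi> x)" "z \<in> mu \<Longrightarrow> \<phi> (act z x) = \<phi> x" if "x \<in> X" for x z
    using \<phi> that by (auto simp: equiv_maps_def)
  show img: "w ` fiber \<phi> X q = fiber \<phi> X (s q)"
  proof
    show "w ` fiber \<phi> X q \<subseteq> fiber \<phi> X (s q)" using \<phi>' aut_in[OF X] by (auto simp: fiber_def)
    show "fiber \<phi> X (s q) \<subseteq> w ` fiber \<phi> X q"
    proof
      fix y assume y: "y \<in> fiber \<phi> X (s q)"
      then have "y \<in> w ` X" using X by (simp add: fiber_def aut_def bij_betw_def)
      then obtain x where x: "x \<in> X" "y = w x" by blast
      then have "s (\<phi> x) = s q" using y \<phi>' by (simp add: fiber_def)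
      then have "\<phi> x = q" using s q \<phi>'(1)[OF x(1)] by (auto dest: inj_onD)
      then show "y \<in> w ` fiber \<phi> X q" using x by (auto simp: fiber_def)
    qed
  qed
  have ob: "objr r (fiber \<phi> X q)" for q
    using aut_objr[OF X] \<phi>'(3) by (auto simp: objr_def fiber_def)
  have "inj_on w (fiber \<phi> X q)"
    using X by (auto simp: aut_def bij_betw_def fiber_def intro: inj_on_subset)
  then show "homr r (fiber \<phi> X q) w"
    using ob img aut_act[OF X] by (auto simp: homr_def fiber_def)
qed

lemma is_cycle_inj: "is_cycle s p c \<Longrightarrow> inj_on s c"
proof -
  assume c: "is_cycle s p c"
  have "s ` c = c"
  proof
    show "s ` c \<subseteq> c" using is_cycle_closed[OF c] by auto
    show "c \<subseteq> s ` c"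
    proof
      fix q assume q: "q \<in> c"
      have "(s ^^ card c) q = q" using is_cycle_fix_iff'[OF c q] by simp
      moreover have "0 < card c" using c by (simp add: is_cycle_def)
      ultimately have "q = s ((s ^^ (card c - 1)) q)" by (cases "card c") auto
      moreover have "(s ^^ (card c - 1)) q \<in> c" using is_cycle_pow_in[OF is_cycle_base[OF c q]] .
      ultimately show "q \<in> s ` c" by blast
    qed
  qed
  then show ?thesis using is_cycle_finite[OF c] by (simp add: eq_card_imp_inj_on)
qed

text \<open>A point over \<open>p\<close> returns to the fibre exactly at multiples of
  \<open>card c\<close>. Hence every orbit of \<open>w\<close> meets the fibre in exactly one orbit
  of \<open>w ^^ card c\<close>, with the length divided by \<open>card c\<close> and the same
  type.\<close>

lemma fiber_type:
  assumes X: "aut X w" and c: "is_cycle s p c" and \<phi>: "\<phi> \<in> inv_maps X w c s"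
  shows "aut (fiber \<phi> X p) (w ^^ card c)"
    "gtype w X = image_mset (\<lambda>(j, z). (card c * j, z)) (gtype (w ^^ card c) (fiber \<phi> X p))"
proof -
  let ?i = "card c" let ?u = "w ^^ ?i" and ?Y = "fiber \<phi> X p"
  have i: "0 < ?i" using c by (simp add: is_cycle_def)
  have \<phi>w: "\<phi> ((w ^^ t) x) = (s ^^ t) (\<phi> x)" if "x \<in> X" for x t
    using equiv_maps_pow[OF X \<phi> that] .
  have \<phi>a: "\<phi> (act z x) = \<phi> x" if "x \<in> X" "z \<in> mu" for x z using \<phi> that by (simp add: equiv_maps_def)
  have YX: "?Y \<subseteq> X" by (auto simp: fiber_def)
  show Y: "aut ?Y ?u"
    by (rule aut_subset[OF aut_pow[OF X] YX])
      (use \<phi>w \<phi>a is_cycle_fix_iff[OF c] pow_in[OF X] aut_act_in[OF X] in \<open>auto simp: fiber_def\<close>)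
  have upow: "(?u ^^ t) x = (w ^^ (?i * t)) x" for t x by (simp add: funpow_mult)
  have pl: "?i * per ?u x = per w x" "lab ?u x = lab w x" if x: "x \<in> ?Y" for x
  proof -
    have xX: "x \<in> X" using x YX by blast
    have "(s ^^ per w x) p = p"
      using \<phi>w[OF xX, of "per w x"] pow_per[OF X xX] \<phi>a[OF xX lab_mu[OF X xX]] x by (simp add: fiber_def)
    then have d: "?i dvd per w x" using is_cycle_fix_iff[OF c] by simp
    then obtain L where L: "per w x = ?i * L" by blast
    then have L0: "0 < L" using per_pos[OF X xX] by (cases L) auto
    have min: "L \<le> t" if "0 < t" "\<zeta> \<in> mu" "(?u ^^ t) x = act \<zeta> x" for t \<zeta>
    proof -
      have "per w x \<le> ?i * t" using per_minimal[OF X xX _ that(2)] that i upow by simp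
      then show ?thesis using L i by simp
    qed
    have "(?u ^^ L) x = act (lab w x) x" using upow pow_per[OF X xX] L by simp
    from per_lab_eqI[OF L0 lab_mu[OF X xX] this aut_nonzero[OF X xX] min]
    show "?i * per ?u x = per w x" "lab ?u x = lab w x" using L by auto
  qed
  have inter: "worb ?u x = worb w x \<inter> ?Y" if x: "x \<in> ?Y" for x
  proof
    have xX: "x \<in> X" using x YX by blast
    show "worb ?u x \<subseteq> worb w x \<inter> ?Y"
      using worb_subset[OF Y x] upow by (auto simp: worb_def)
    show "worb w x \<inter> ?Y \<subseteq> worb ?u x"
    proof
      fix y assume y: "y \<in> worb w x \<inter> ?Y"
      then obtain z t where zt: "y = act z ((w ^^ t) x)" "z \<in> mu" by (auto simp: worb_def)
      then have "(s ^^ t) p = p"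
        using y x \<phi>a[OF pow_in[OF X xX] zt(2)] \<phi>w[OF xX] by (simp add: fiber_def)
      then obtain q where "t = ?i * q" using is_cycle_fix_iff[OF c] by blast
      then have "y = act z ((?u ^^ q) x)" using zt upow by simp
      then show "y \<in> worb ?u x" using zt(2) unfolding worb_def by blast
    qed
  qed
  \<comment> \<open>A point with label \<open>(s ^^ t) p\<close> reaches the fibre over
    \<open>p\<close> after the \<open>card c - t\<close> steps that complete the round.\<close>
  have meet: "\<exists>x\<in>?Y. S = worb w x" if S: "S \<in> worbs w X" for S
  proof -
    obtain a where a: "a \<in> X" "S = worb w a" using S by (auto simp: worbs_def)
    have "\<phi> a \<in> c" using \<phi> a(1) by (auto simp: equiv_maps_def)
    then obtain t where t: "t < ?i" "\<phi> a = (s ^^ t) p" using is_cycle_elem[OF c] by blast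
    have "\<phi> ((w ^^ (?i - t)) a) = (s ^^ (?i - t + t)) p"
      unfolding \<phi>w[OF a(1)] t(2) funpow_add_apply ..
    then have "\<phi> ((w ^^ (?i - t)) a) = p" using t is_cycle_fix_iff[OF c, of ?i] by simp
    then have x: "(w ^^ (?i - t)) a \<in> ?Y" using pow_in[OF X a(1)] by (simp add: fiber_def)
    have "(w ^^ (?i - t)) a = act 1 ((w ^^ (?i - t)) a)" by simp
    then have "(w ^^ (?i - t)) a \<in> worb w a" unfolding worb_def using one_mu by blast
    from worb_eq[OF X a(1) this] have "worb w ((w ^^ (?i - t)) a) = S" unfolding a(2) .
    then show ?thesis using x by blast
  qed
  have W: "worbs ?u ?Y = (\<lambda>S. S \<inter> ?Y) ` worbs w X"
  proof
    show "worbs ?u ?Y \<subseteq> (\<lambda>S. S \<inter> ?Y) ` worbs w X"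
    proof
      fix S assume "S \<in> worbs ?u ?Y"
      then obtain x where x: "x \<in> ?Y" "S = worb ?u x" by (auto simp: worbs_def)
      then have "S = worb w x \<inter> ?Y" "worb w x \<in> worbs w X"
        using inter[OF x(1)] YX by (auto simp: worbs_def)
      then show "S \<in> (\<lambda>S. S \<inter> ?Y) ` worbs w X" by blast
    qed
    show "(\<lambda>S. S \<inter> ?Y) ` worbs w X \<subseteq> worbs ?u ?Y"
    proof (rule image_subsetI)
      fix S assume "S \<in> worbs w X"
      then obtain x where "x \<in> ?Y" "S = worb w x" using meet by blast
      then show "S \<inter> ?Y \<in> worbs ?u ?Y" using inter unfolding worbs_def by (metis imageI)
    qed
  qed
  have inj: "inj_on (\<lambda>S. S \<inter> ?Y) (worbs w X)"
  proof (rule inj_onI)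
    fix S T assume ST: "S \<in> worbs w X" "T \<in> worbs w X" "S \<inter> ?Y = T \<inter> ?Y"
    obtain x where "x \<in> ?Y" "S = worb w x" using meet[OF ST(1)] by blast
    then have "x \<in> S \<inter> T" using ST(3) worb_self by blast
    then show "S = T" using worbs_disjoint[OF X ST(1,2)] by blast
  qed
  have "mset_set (worbs ?u ?Y) = image_mset (\<lambda>S. S \<inter> ?Y) (mset_set (worbs w X))"
    unfolding W by (rule image_mset_mset_set[OF inj, symmetric])
  moreover have "otype w S = (\<lambda>(j, z). (?i * j, z)) (otype ?u (S \<inter> ?Y))" if S: "S \<in> worbs w X" for S
  proof -
    obtain x where x: "x \<in> ?Y" "S = worb w x" using meet[OF S] by blast
    have xX: "x \<in> X" using x(1) YX by blast
    show ?thesis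
      using otype_worb[OF X xX] otype_worb[OF Y x(1)] pl[OF x(1)] inter[OF x(1)]
      unfolding x(2) by simp
  qed
  ultimately show "gtype w X = image_mset (\<lambda>(j, z). (?i * j, z)) (gtype ?u ?Y)"
    using finite_worbs[OF X]
    by (auto simp: gtype_def image_mset.compositionality comp_def intro!: image_mset_cong)
qed

end

section \<open>Sums over invariant maps to a union of cycles\<close>

lemma sum_mset_subset_type:
  fixes f :: "'v multiset \<Rightarrow> complex"
  assumes "finite F"
  shows "(\<Sum>S\<in>Pow F. f (image_mset t (mset_set S)))
    = (\<Sum>A\<in>{A. A \<subseteq># image_mset t (mset_set F)}.
        of_nat (card {S. S \<subseteq> F \<and> image_mset t (mset_set S) = A}) * f A)"
proof -
  let ?g = "\<lambda>S. image_mset t (mset_set S)"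
  have "?g ` Pow F \<subseteq> {A. A \<subseteq># ?g F}"
    using assms by (auto intro!: image_mset_subseteq_mono simp: subset_imp_msubset_mset_set)
  from sum.group[OF _ finite_sub_mset this, of "\<lambda>S. f (?g S)"] assms
  have "(\<Sum>S\<in>Pow F. f (?g S)) = (\<Sum>A\<in>{A. A \<subseteq># ?g F}. \<Sum>S\<in>{S \<in> Pow F. ?g S = A}. f (?g S))"
    by simp
  also have "\<dots> = (\<Sum>A\<in>{A. A \<subseteq># ?g F}. of_nat (card {S. S \<subseteq> F \<and> ?g S = A}) * f A)"
  proof (rule sum.cong[OF refl])
    fix A
    have "(\<Sum>S\<in>{S \<in> Pow F. ?g S = A}. f (?g S)) = (\<Sum>S\<in>{S \<in> Pow F. ?g S = A}. f A)"
      by (rule sum.cong) auto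
    then show "(\<Sum>S\<in>{S \<in> Pow F. ?g S = A}. f (?g S)) = of_nat (card {S. S \<subseteq> F \<and> ?g S = A}) * f A"
      by simp
  qed
  finally show ?thesis .
qed

context root_sets
begin

text \<open>The number of subsets is a product of binomial coefficients, one for each variable, the
  powers of \<open>r * fst v\<close> cancelling in the quotient. The induction is Pascal's rule, in
  a form without division: subsets that avoid the new element \<open>x\<close> and subsets that
  contain it.\<close>

lemma card_subsets_type:
  assumes "finite F" "A \<subseteq># image_mset t (mset_set F)"
  shows "card {S. S \<subseteq> F \<and> image_mset t (mset_set S) = A} * (cent_order A * cent_order (image_mset t (mset_set F) - A))
    = cent_order (image_mset t (mset_set F))"
  using assms
proof (induction F arbitrary: A rule: finite_induct)
  case empty
  have "{S. S = {} \<and> image_mset t (mset_set S) = {#}} = {{}}" by auto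
  then show ?case using empty by simp
next
  case (insert x F)
  let ?g = "\<lambda>S. image_mset t (mset_set S)" and ?v = "t x"
  let ?N = "\<lambda>F A. {S. S \<subseteq> F \<and> ?g S = A}"
  let ?M = "?g F"
  let ?a = "r * fst ?v"
  have gi: "?g (insert x S) = add_mset ?v (?g S)" if "S \<subseteq> F" for S
    using that insert finite_subset by (subst mset_set.insert) auto
  have M: "?g (insert x F) = add_mset ?v ?M" using gi by simp
  have split: "?N (insert x F) A = ?N F A \<union> insert x ` {S. S \<subseteq> F \<and> add_mset ?v (?g S) = A}"
  proof -
    have "S \<in> ?N F A \<or> S \<in> insert x ` {S. S \<subseteq> F \<and> add_mset ?v (?g S) = A}"
      if S: "S \<in> ?N (insert x F) A" for S
    proof (cases "x \<in> S")
      case True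
      define S' where "S' = S - {x}"
      have S': "S = insert x S'" "S' \<subseteq> F" using S True by (auto simp: S'_def)
      then have "add_mset ?v (?g S') = A" using S gi[OF S'(2)] by simp
      then show ?thesis using S' by blast
    qed (use S in auto)
    moreover have "insert x S \<in> ?N (insert x F) A" if "S \<subseteq> F" "add_mset ?v (?g S) = A" for S
      using that gi[OF that(1)] by auto
    ultimately show ?thesis by blast
  qed
  have inj: "inj_on (insert x) {S. S \<subseteq> F \<and> add_mset ?v (?g S) = A}"
  proof (rule inj_onI)
    fix S T assume "S \<in> {S. S \<subseteq> F \<and> add_mset ?v (?g S) = A}" "T \<in> {S. S \<subseteq> F \<and> add_mset ?v (?g S) = A}"
      and eq: "insert x S = insert x T"
    then have "x \<notin> S" "x \<notin> T" using insert(2) by auto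
    then show "S = T" using eq by (simp add: insert_ident)
  qed
  have fin: "finite (?N F A)" "finite {S. S \<subseteq> F \<and> add_mset ?v (?g S) = A}"
    using insert(1) by auto
  have "card (?N (insert x F) A) = card (?N F A) + card (insert x ` {S. S \<subseteq> F \<and> add_mset ?v (?g S) = A})"
    unfolding split using insert(2) fin by (intro card_Un_disjoint) auto
  then have card: "card (?N (insert x F) A) = card (?N F A) + card {S. S \<subseteq> F \<and> add_mset ?v (?g S) = A}"
    by (simp add: card_image[OF inj])
  have sub: "A \<subseteq># add_mset ?v ?M" using insert.prems M by simp
  \<comment> \<open>If \<open>A\<close> is not below \<open>?M\<close>, it contains
    \<open>?v\<close> once more than \<open>?M\<close> does; the truncated difference is then 0, in
    agreement with the empty set of subsets.\<close>
  have 1: "card (?N F A) * (cent_order A * cent_order (add_mset ?v ?M - A)) = ?a * (count ?M ?v + 1 - count A ?v) * cent_order ?M"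
  proof (cases "A \<subseteq># ?M")
    case True
    let ?k = "count ?M ?v + 1 - count A ?v" and ?n = "card (?N F A)"
    have "add_mset ?v ?M - A = add_mset ?v (?M - A)"
      using multiset_diff_union_assoc[OF True, of "{#?v#}"] by simp
    moreover have "count A ?v \<le> count ?M ?v" using True by (rule mset_subset_eq_count)
    ultimately have "cent_order (add_mset ?v ?M - A) = ?a * ?k * cent_order (?M - A)"
      using cent_order_add[of ?v "?M - A"] by (simp add: Suc_diff_le)
    then have "?n * (cent_order A * cent_order (add_mset ?v ?M - A)) = ?a * ?k * (?n * (cent_order A * cent_order (?M - A)))"
      by (simp only: ac_simps)
    then show ?thesis unfolding insert.IH[OF True] .
  next
    case False
    have empty: "?N F A = {}"
      using False insert(1)
      by (auto intro!: image_mset_subseteq_mono simp: subset_imp_msubset_mset_set)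
    moreover have "count A ?v \<ge> count ?M ?v + 1"
    proof (rule ccontr)
      assume "\<not> count A ?v \<ge> count ?M ?v + 1"
      then have "count A u \<le> count ?M u" for u
        using mset_subset_eq_count[OF sub, of u] by (cases "u = ?v") auto
      then show False using False by (simp add: mset_subset_eqI)
    qed
    ultimately show ?thesis unfolding empty by simp
  qed
  have 2: "card {S. S \<subseteq> F \<and> add_mset ?v (?g S) = A} * (cent_order A * cent_order (add_mset ?v ?M - A))
      = ?a * count A ?v * cent_order ?M"
  proof (cases "?v \<in># A")
    case True
    then obtain A' where A': "A = add_mset ?v A'" by (metis multi_member_split)
    then have "A' \<subseteq># ?M" using sub by simp
    let ?n = "card (?N F A')"
    have "?n * (cent_order A * cent_order (add_mset ?v ?M - A)) = ?a * count A ?v * (?n * (cent_order A' * cent_order (?M - A')))"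
      using cent_order_add[of ?v A'] A' by (simp add: ac_simps)
    then show ?thesis
      unfolding insert.IH[OF \<open>A' \<subseteq># ?M\<close>] using A' by simp
  next
    case False
    then have empty: "{S. S \<subseteq> F \<and> add_mset ?v (?g S) = A} = {}" by auto
    have "count A ?v = 0" using False by (simp add: count_eq_zero_iff)
    then show ?thesis unfolding empty by simp
  qed
  \<comment> \<open>This bound makes the natural subtraction exact, so that the factors of the two
    cases add up to \<open>count ?M ?v + 1\<close>.\<close>
  have "count A ?v \<le> count ?M ?v + 1" using mset_subset_eq_count[OF sub, of ?v] by simp
  then have "?a * (count ?M ?v + 1 - count A ?v) * cent_order ?M + ?a * count A ?v * cent_order ?M
      = ?a * (count ?M ?v + 1) * cent_order ?M"
    by (metis add_mult_distrib add_mult_distrib2 le_add_diff_inverse2)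
  then show ?case
    unfolding M card add_mult_distrib 1 2 cent_order_add by simp
qed

section \<open>Scaling of cycle lengths and labellings by a single cycle\<close>

lemma inj_scale: "0 < i \<Longrightarrow> inj (\<lambda>(j, z). (i * j :: nat, z))"
  by (auto simp: inj_on_def)

lemma scale_mset_cancel:
  assumes "0 < i" "image_mset (\<lambda>(j, z). (i * j :: nat, z)) m = image_mset (\<lambda>(j, z). (i * j, z)) m'"
  shows "m = m'"
proof -
  let ?f = "\<lambda>(j, z). (i * j :: nat, z)"
  have "image_mset (inv ?f) (image_mset ?f m) = image_mset (inv ?f) (image_mset ?f m')"
    using assms(2) by simp
  then show ?thesis
    by (simp only: image_mset.compositionality inv_o_cancel[OF inj_scale[OF assms(1)]] image_mset.id id_apply)
qed

text \<open>Each of the \<open>size m\<close> variables gains a factor \<open>i\<close> in its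
  length, and multiplicities persist because scaling is injective. The resulting power of
  \<open>i\<close> is the number of labellings by a cycle of length \<open>i\<close>.\<close>

lemma cent_order_scale:
  assumes "0 < i"
  shows "cent_order (image_mset (\<lambda>(j, z). (i * j, z)) m) = i ^ size m * cent_order m"
proof (induction m)
  case (add v m)
  obtain j z where v: "v = (j, z)" by (cases v)
  have "count (image_mset (\<lambda>(j, z). (i * j, z)) m) (i * j, z) = count m (j, z)" for m
    using assms by (induction m) auto
  then show ?case using add cent_order_add[of v m] cent_order_add[of "(i * j, z)"] v by (simp add: algebra_simps)
qed simp

lemma adams_scale:
  assumes "0 < i"
  shows "adams i g (image_mset (\<lambda>(j, z). (i * j, z)) m) = g m"
proof -
  have "(THE m'. image_mset (\<lambda>(j, z). (i * j, z)) m' = image_mset (\<lambda>(j, z). (i * j, z)) m) = m"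
    using scale_mset_cancel[OF assms] by (intro the_equality) auto
  then show ?thesis unfolding adams_def by auto
qed

lemma equiv_maps_split:
  assumes "aut X w" "Y \<subseteq> X" "aut Y w"
  shows "bij_betw (\<lambda>f. (restrict f Y, restrict f (X - Y))) (equiv_maps X w T \<alpha> s) (equiv_maps Y w T \<alpha> s \<times> equiv_maps (X - Y) w T \<alpha> s)"
proof (rule bij_betw_byWitness[where f' = "\<lambda>(f, g). \<lambda>x. if x \<in> Y then f x else g x"])
  show "\<forall>f\<in>equiv_maps X w T \<alpha> s.
      (\<lambda>(f, g). \<lambda>x. if x \<in> Y then f x else g x) (restrict f Y, restrict f (X - Y)) = f"
    using assms(2) by (auto simp: fun_eq_iff equiv_maps_def PiE_def extensional_def)
  show "\<forall>p\<in>equiv_maps Y w T \<alpha> s \<times> equiv_maps (X - Y) w T \<alpha> s.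
      (restrict ((\<lambda>(f, g). \<lambda>x. if x \<in> Y then f x else g x) p) Y,
       restrict ((\<lambda>(f, g). \<lambda>x. if x \<in> Y then f x else g x) p) (X - Y)) = p"
    by (auto simp: fun_eq_iff equiv_maps_def PiE_def extensional_def)
  show "(\<lambda>f. (restrict f Y, restrict f (X - Y))) ` equiv_maps X w T \<alpha> s
      \<subseteq> equiv_maps Y w T \<alpha> s \<times> equiv_maps (X - Y) w T \<alpha> s"
    using equiv_maps_restrict[of _ X w T \<alpha> s] assms(2,3) aut_Diff[OF assms] by blast
  show "(\<lambda>(f, g). \<lambda>x. if x \<in> Y then f x else g x) ` (equiv_maps Y w T \<alpha> s \<times> equiv_maps (X - Y) w T \<alpha> s)
      \<subseteq> equiv_maps X w T \<alpha> s"
    using equiv_maps_glue[OF assms] by auto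
qed

text \<open>Orbits are labelled independently. On one orbit the label of a generator must be fixed
  by \<open>s ^^ per w x\<close>; either all points of the cycle are, or none.\<close>

lemma card_inv_maps:
  assumes "aut X w" and c: "is_cycle s p c"
  shows "card (inv_maps X w c s) =
    (if \<forall>v\<in>#gtype w X. card c dvd fst v then card c ^ size (gtype w X) else 0)"
  using assms(1)
proof (induction rule: aut_induct)
  case empty
  then show ?case by (simp add: equiv_maps_def gtype_def worbs_def)
next
  case (remove X x)
  have T: "acts_on c (\<lambda>_ y. y) s" using is_cycle_closed[OF c] by (simp add: acts_on_def)
  have "card (inv_maps (worb w x) w c s) = card {y \<in> c. (s ^^ per w x) y = y}"
    using bij_betw_same_card[OF equiv_maps_bij[OF remove(1,2) T]] .
  also have "{y \<in> c. (s ^^ per w x) y = y} = (if card c dvd per w x then c else {})"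
    using is_cycle_fix_iff'[OF c] by auto
  finally have "card (inv_maps (worb w x) w c s) = (if card c dvd per w x then card c else 0)" by simp
  moreover have "card (inv_maps X w c s) = card (inv_maps (worb w x) w c s) * card (inv_maps (X - worb w x) w c s)"
    using bij_betw_same_card[OF equiv_maps_split[OF remove(1) worb_subset[OF remove(1,2)] aut_worb[OF remove(1,2)]]]
    by (simp add: card_cartesian_product)
  ultimately show ?case
    unfolding remove(3) gtype_remove[OF remove(1,2)] by auto
qed

text \<open>Cancelling the scaling in \<open>fiber_type\<close> shows that the type
  \<open>m'\<close> of the fibre is the same for all labellings. They contribute equally, and their
  number times \<open>cent_order m'\<close> is the centralizer order of the scaled type.\<close>

lemma labelled_trace_cycle:
  assumes V: "is_module (objr r) (homr r) V" and X: "aut X w" and c: "is_cycle s p c"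
  shows "labelled_trace V w X c s = of_nat (cent_order (gtype w X)) * adams (card c) (chr r V) (gtype w X)"
proof (cases "inv_maps X w c s = {}")
  case True
  have i: "0 < card c" using c by (simp add: is_cycle_def)
  \<comment> \<open>A scaled type has all lengths divisible by \<open>card c\<close> and so would
    admit labellings. Without any, \<open>adams\<close> takes its default value 0.\<close>
  have "\<not> (\<exists>m'. image_mset (\<lambda>(j, z). (card c * j, z)) m' = gtype w X)"
  proof
    assume "\<exists>m'. image_mset (\<lambda>(j, z). (card c * j, z)) m' = gtype w X"
    then obtain m' where m': "gtype w X = image_mset (\<lambda>(j, z). (card c * j, z)) m'" by metis
    have "\<forall>v\<in>#gtype w X. card c dvd fst v" unfolding m' by auto
    then show False using card_inv_maps[OF X c] True i by simp
  qed
  then show ?thesis using True by (simp add: labelled_trace_def adams_def)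
next
  case False
  let ?i = "card c" and ?m = "gtype w X"
  have i: "0 < card c" using c by (simp add: is_cycle_def)
  obtain \<phi> where \<phi>: "\<phi> \<in> inv_maps X w c s" using False by blast
  define m' where "m' = gtype (w ^^ ?i) (fiber \<phi> X p)"
  have m: "?m = image_mset (\<lambda>(j, z). (?i * j, z)) m'" using fiber_type[OF X c \<phi>] by (simp add: m'_def)
  have m'_eq: "gtype (w ^^ ?i) (fiber \<psi> X p) = m'" if \<psi>: "\<psi> \<in> inv_maps X w c s" for \<psi>
  proof -
    have "image_mset (\<lambda>(j, z). (?i * j, z)) (gtype (w ^^ ?i) (fiber \<psi> X p)) = image_mset (\<lambda>(j, z). (?i * j, z)) m'"
      using fiber_type[OF X c \<psi>] m by simp
    then show ?thesis by (rule scale_mset_cancel[OF i])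
  qed
  have zpos: "cent_order m' > 0" unfolding m'_def by (rule cent_order_gtype_pos[OF fiber_type(1)[OF X c \<phi>]])
  have "tensor_trace V w (fiber \<psi> X) c s = of_nat (cent_order m') * chr r V m'" if \<psi>: "\<psi> \<in> inv_maps X w c s" for \<psi>
  proof -
    have "tensor_trace V w (fiber \<psi> X) c s = trace V (w ^^ ?i) (fiber \<psi> X p)"
      by (rule tensor_trace_cycle[OF V c]) (use fiber_hom[OF X \<psi> is_cycle_inj[OF c]] in blast)
    also have "\<dots> = of_nat (cent_order m') * chr r V m'"
      using chr_eq[OF V fiber_type(1)[OF X c \<psi>]] m'_eq[OF \<psi>] zpos by simp
    finally show ?thesis .
  qed
  then have "labelled_trace V w X c s = of_nat (card (inv_maps X w c s)) * (of_nat (cent_order m') * chr r V m')"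
    by (simp add: labelled_trace_def)
  also have "card (inv_maps X w c s) = ?i ^ size m'"
    unfolding card_inv_maps[OF X c] m by auto
  finally show ?thesis
    unfolding m cent_order_scale[OF i] adams_scale[OF i] by simp
qed

section \<open>Decomposition over unions of cycles\<close>

lemma finite_equiv_maps: "aut X w \<Longrightarrow> finite T \<Longrightarrow> finite (equiv_maps X w T \<alpha> s)"
  by (rule finite_subset[of _ "X \<rightarrow>\<^sub>E T"]) (auto simp: equiv_maps_def aut_finite intro: finite_PiE)

text \<open>The points with labels in \<open>P\<close> form a stable subset \<open>Y\<close>, since
  \<open>P\<close> is closed under \<open>s\<close>; the labelling is then a pair of independent
  labellings of \<open>Y\<close> and of its complement.\<close>

lemma labelled_trace_Un:
  assumes X: "aut X w" and P: "finite P" "\<And>p. p \<in> P \<Longrightarrow> s p \<in> P"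
    and Q: "finite Q" "\<And>p. p \<in> Q \<Longrightarrow> s p \<in> Q" and disj: "P \<inter> Q = {}"
  shows "labelled_trace V w X (P \<union> Q) s = (\<Sum>Y\<in>{Y. Y \<subseteq> X \<and> aut Y w}. labelled_trace V w Y P s * labelled_trace V w (X - Y) Q s)"
proof -
  let ?St = "{Y. Y \<subseteq> X \<and> aut Y w}"
  let ?B = "SIGMA Y:?St. inv_maps Y w P s \<times> inv_maps (X - Y) w Q s"
  let ?E = "\<lambda>(Y, \<phi>, \<psi>). tensor_trace V w (fiber \<phi> Y) P s * tensor_trace V w (fiber \<psi> (X - Y)) Q s"
  let ?i = "\<lambda>(Y, \<phi>, \<psi>). \<lambda>x. if x \<in> Y then \<phi> x else \<psi> x"
  let ?pre = "\<lambda>\<phi>. {x \<in> X. \<phi> x \<in> P}"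
  let ?j = "\<lambda>\<phi>. (?pre \<phi>, restrict \<phi> (?pre \<phi>), restrict \<phi> (X - ?pre \<phi>))"
  have finSt: "finite ?St" using aut_finite[OF X] by simp
  have "labelled_trace V w X (P \<union> Q) s = (\<Sum>b\<in>?B. ?E b)"
    unfolding labelled_trace_def
  proof (rule sum.reindex_bij_witness[where i = ?i and j = ?j])
    fix \<phi> assume \<phi>: "\<phi> \<in> inv_maps X w (P \<union> Q) s"
    have in_: "\<phi> x \<in> P \<or> \<phi> x \<in> Q" "\<phi> (w x) = s (\<phi> x)" "z \<in> mu \<Longrightarrow> \<phi> (act z x) = \<phi> x" if "x \<in> X" for x z
      using \<phi> that by (auto simp: equiv_maps_def)
    have Y: "aut (?pre \<phi>) w"
      by (rule aut_subset[OF X]) (use in_ P aut_in[OF X] aut_act_in[OF X] in auto)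
    have XY: "aut (X - ?pre \<phi>) w" using aut_Diff[OF X _ Y] by auto
    show "?i (?j \<phi>) = \<phi>" using \<phi> by (auto simp: fun_eq_iff equiv_maps_def PiE_def extensional_def)
    have "restrict \<phi> (?pre \<phi>) \<in> inv_maps (?pre \<phi>) w P s"
      using in_ aut_in[OF Y] aut_act_in[OF Y] by (auto simp: equiv_maps_def)
    moreover have "restrict \<phi> (X - ?pre \<phi>) \<in> inv_maps (X - ?pre \<phi>) w Q s"
      using in_ aut_in[OF XY] aut_act_in[OF XY] by (auto simp: equiv_maps_def)
    ultimately show "?j \<phi> \<in> ?B" using Y by auto
    have "tensor_trace V w (fiber \<phi> X) (P \<union> Q) s = tensor_trace V w (fiber \<phi> X) P s * tensor_trace V w (fiber \<phi> X) Q s"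
      by (rule tensor_trace_Un[OF disj P(1) Q(1) P(2) Q(2)])
    moreover have "tensor_trace V w (fiber \<phi> X) P s = tensor_trace V w (fiber (restrict \<phi> (?pre \<phi>)) (?pre \<phi>)) P s"
      by (rule tensor_trace_cong) (auto simp: fiber_def)
    moreover have "tensor_trace V w (fiber \<phi> X) Q s = tensor_trace V w (fiber (restrict \<phi> (X - ?pre \<phi>)) (X - ?pre \<phi>)) Q s"
      by (rule tensor_trace_cong) (use disj in \<open>auto simp: fiber_def\<close>)
    ultimately show "?E (?j \<phi>) = tensor_trace V w (fiber \<phi> X) (P \<union> Q) s" by simp
  next
    fix b assume "b \<in> ?B"
    then obtain Y \<phi> \<psi> where b: "b = (Y, \<phi>, \<psi>)" "Y \<subseteq> X" "aut Y w" "\<phi> \<in> inv_maps Y w P s" "\<psi> \<in> inv_maps (X - Y) w Q s"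
      by blast
    have pre: "?pre (?i b) = Y"
      using b disj by (auto simp: equiv_maps_def)
    have "restrict (?i b) Y = \<phi>" "restrict (?i b) (X - Y) = \<psi>"
      using b by (auto simp: fun_eq_iff equiv_maps_def PiE_def extensional_def)
    then show "?j (?i b) = b" unfolding pre using b(1) by simp
    have "\<phi> \<in> inv_maps Y w (P \<union> Q) s" "\<psi> \<in> inv_maps (X - Y) w (P \<union> Q) s"
      using b(4,5) by (auto simp: equiv_maps_def)
    from equiv_maps_glue[OF X b(2,3) this] show "?i b \<in> inv_maps X w (P \<union> Q) s" using b(1) by simp
  qed
  also have "\<dots> = (\<Sum>Y\<in>?St. \<Sum>q\<in>inv_maps Y w P s \<times> inv_maps (X - Y) w Q s. ?E (Y, q))"
  proof (rule sum.Sigma[symmetric, THEN trans])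
    show "finite ?St" by (rule finSt)
    show "\<forall>Y\<in>?St. finite (inv_maps Y w P s \<times> inv_maps (X - Y) w Q s)"
      by (intro ballI finite_cartesian_product finite_equiv_maps) (use P(1) Q(1) aut_Diff[OF X] in auto)
  qed (simp add: case_prod_beta)
  also have "\<dots> = (\<Sum>Y\<in>?St. labelled_trace V w Y P s * labelled_trace V w (X - Y) Q s)"
    unfolding labelled_trace_def sum_product sum.cartesian_product by (simp add: case_prod_beta)
  finally show ?thesis .
qed

text \<open>The cycles come as a list because \<open>foldr\<close> multiplies the series in a
  definite order; each step of the induction strips one cycle and one factor.\<close>

lemma labelled_trace_list:
  assumes V: "is_module (objr r) (homr r) V"
    and "\<And>c. c \<in> set cs \<Longrightarrow> \<exists>p. is_cycle s p c" "disjoint (set cs)" "distinct cs" "aut X w"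
  shows "labelled_trace V w X (\<Union>(set cs)) s = of_nat (cent_order (gtype w X)) *
    foldr ps_mult (map (\<lambda>i. adams i (chr r V)) (map card cs)) ps_one (gtype w X)"
  using assms(2-)
proof (induction cs arbitrary: X)
  case Nil
  then show ?case
  proof (cases "X = {}")
    case True
    then show ?thesis by (simp add: labelled_trace_def equiv_maps_def tensor_trace_def gtype_def worbs_def ps_one_def)
  next
    case False
    \<comment> \<open>Without labels only the empty object has a labelling, which is the constant
      term of \<open>ps_one\<close>.\<close>
    then have "inv_maps X w {} s = {}" by (auto simp: equiv_maps_def PiE_def)
    then show ?thesis using False gtype_empty_iff[OF Nil(4)] by (simp add: labelled_trace_def ps_one_def)
  qed
next
  case (Cons c cs)
  let ?Q = "\<Union>(set cs)" and ?m = "gtype w X"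
  let ?G = "foldr ps_mult (map (\<lambda>i. adams i (chr r V)) (map card cs)) ps_one"
  let ?A = "adams (card c) (chr r V)"
  let ?F = "worbs w X"
  note X = Cons.prems(4)
  obtain p where c: "is_cycle s p c" using Cons.prems(1) by auto
  have cs: "\<exists>p. is_cycle s p d" if "d \<in> set cs" for d using Cons.prems(1) that by auto
  have dj: "disjoint (set cs)" "distinct cs" "c \<notin> set cs"
    using Cons.prems(2,3) by (auto simp: disjoint_def)
  have disj: "c \<inter> ?Q = {}"
    using Cons.prems(2) dj(3) by (auto simp: disjoint_def)
  have "finite d" if "d \<in> set cs" for d using cs[OF that] is_cycle_finite by metis
  then have finQ: "finite ?Q" by auto
  have clQ: "s q \<in> ?Q" if q: "q \<in> ?Q" for q
  proof -
    obtain d where d: "d \<in> set cs" "q \<in> d" using q by blast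
    then obtain p' where "is_cycle s p' d" using cs by blast
    then show ?thesis using is_cycle_closed d by (metis UnionI)
  qed
  have IH: "labelled_trace V w Y ?Q s = of_nat (cent_order (gtype w Y)) * ?G (gtype w Y)" if "aut Y w" for Y
    using Cons.IH[OF cs dj(1,2) that] .
  let ?h = "\<lambda>A. of_nat (cent_order A) * ?A A * (of_nat (cent_order (?m - A)) * ?G (?m - A))"
  have "labelled_trace V w X (\<Union>(set (c # cs))) s = (\<Sum>Y\<in>{Y. Y \<subseteq> X \<and> aut Y w}. labelled_trace V w Y c s * labelled_trace V w (X - Y) ?Q s)"
    using labelled_trace_Un[OF X is_cycle_finite[OF c] is_cycle_closed[OF c] finQ clQ disj] by simp
  also have "\<dots> = (\<Sum>Y\<in>{Y. Y \<subseteq> X \<and> aut Y w}. ?h (gtype w Y))"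
  proof (rule sum.cong[OF refl])
    fix Y assume "Y \<in> {Y. Y \<subseteq> X \<and> aut Y w}"
    then have Y: "Y \<subseteq> X" "aut Y w" by auto
    have "gtype w (X - Y) = ?m - gtype w Y" using gtype_split[OF X Y] by simp
    then show "labelled_trace V w Y c s * labelled_trace V w (X - Y) ?Q s = ?h (gtype w Y)"
      using labelled_trace_cycle[OF V Y(2) c] IH[OF aut_Diff[OF X Y]] by simp
  qed
  also have "\<dots> = (\<Sum>S\<in>Pow ?F. ?h (gtype w (\<Union>S)))"
    by (rule sum.reindex_bij_betw[OF bij_betw_Union_worbs[OF X], symmetric])
  also have "\<dots> = (\<Sum>S\<in>Pow ?F. ?h (image_mset (otype w) (mset_set S)))"
    using worbs_Union_worbs[OF X] by (intro sum.cong) (auto simp: gtype_def)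
  also have "\<dots> = (\<Sum>A\<in>{A. A \<subseteq># ?m}. of_nat (card {S. S \<subseteq> ?F \<and> image_mset (otype w) (mset_set S) = A}) * ?h A)"
    using sum_mset_subset_type[OF finite_worbs[OF X], of ?h "otype w"] by (simp only: gtype_def)
  \<comment> \<open>The number of sets of orbits of type \<open>A\<close> absorbs both smaller
    centralizer orders into that of \<open>?m\<close>; what remains is the convolution
    \<open>ps_mult\<close>.\<close>
  also have "\<dots> = (\<Sum>A\<in>{A. A \<subseteq># ?m}. of_nat (cent_order ?m) * (?A A * ?G (?m - A)))"
  proof (rule sum.cong[OF refl])
    fix A assume "A \<in> {A. A \<subseteq># ?m}"
    then have "card {S. S \<subseteq> ?F \<and> image_mset (otype w) (mset_set S) = A} * (cent_order A * cent_order (?m - A)) = cent_order ?m"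
      using card_subsets_type[OF finite_worbs[OF X]] by (simp add: gtype_def)
    from arg_cong[OF this, of "of_nat :: nat \<Rightarrow> complex"]
    show "of_nat (card {S. S \<subseteq> ?F \<and> image_mset (otype w) (mset_set S) = A}) * ?h A
      = of_nat (cent_order ?m) * (?A A * ?G (?m - A))" by (simp add: algebra_simps)
  qed
  also have "\<dots> = of_nat (cent_order ?m) * ps_mult ?A ?G ?m"
    by (simp add: ps_mult_def sum_distrib_left)
  finally show ?case by simp
qed

end

section \<open>Cycles of permutations of finite sets\<close>

text \<open>The length of the cycle is the least return time \<open>i\<close>; all iterates reduce
  modulo \<open>i\<close>.\<close>

lemma is_cycle_orb:
  assumes "finite P" "bij_betw s P P" "p \<in> P"
  shows "is_cycle s p (orb s p)"
proof -
  have s: "inj_on s P" "s ` P \<subseteq> P" using assms(2) by (auto simp: bij_betw_def)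
  have inP: "(s ^^ t) p \<in> P" for t using s(2) assms(3) by (induction t) auto
  define i where "i = (LEAST t. 0 < t \<and> (s ^^ t) p = p)"
  have "0 < i \<and> (s ^^ i) p = p"
    unfolding i_def using inj_return[OF assms(1) s assms(3)] by (rule LeastI_ex)
  then have i: "0 < i" "(s ^^ i) p = p" by auto
  have min: "i \<le> t" if "0 < t" "(s ^^ t) p = p" for t
    unfolding i_def using that by (intro Least_le) auto
  have "(s ^^ (i * q)) p = p" for q using i(2) by (induction q) (simp_all add: funpow_add)
  then have md: "(s ^^ t) p = (s ^^ (t mod i)) p" for t
    using funpow_add_apply[of "t mod i" "i * (t div i)" s p] by simp
  have "orb s p = (\<lambda>t. (s ^^ t) p) ` {..<i}"
  proof
    show "orb s p \<subseteq> (\<lambda>t. (s ^^ t) p) ` {..<i}"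
    proof
      fix q assume "q \<in> orb s p"
      then obtain t where "q = (s ^^ t) p" by (auto simp: orb_def)
      then have "q = (s ^^ (t mod i)) p" using md by simp
      then show "q \<in> (\<lambda>t. (s ^^ t) p) ` {..<i}" using i(1) by auto
    qed
  qed (auto simp: orb_def)
  moreover have "inj_on (\<lambda>t. (s ^^ t) p) {..<i}"
  proof (rule inj_onI, rule ccontr)
    \<comment> \<open>If times \<open>a < b < i\<close> agree, going on for \<open>i - b\<close>
      steps gives a return at time \<open>i - b + a\<close>, which is positive and below
      \<open>i\<close>.\<close>
    have cancel: "False" if "a < b" "b < i" "(s ^^ a) p = (s ^^ b) p" for a b
    proof -
      have "(s ^^ (i - b)) ((s ^^ a) p) = (s ^^ (i - b)) ((s ^^ b) p)" using that(3) by simp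
      then have "(s ^^ (i - b + a)) p = p"
        unfolding funpow_add_apply[symmetric] using that(2) i(2) by simp
      then show False using min[of "i - b + a"] that by simp
    qed
    fix a b assume "a \<in> {..<i}" "b \<in> {..<i}" "(s ^^ a) p = (s ^^ b) p" "a \<noteq> b"
    then show False using cancel[of a b] cancel[of b a] by (cases a b rule: linorder_cases) auto
  qed
  ultimately have b: "bij_betw (\<lambda>t. (s ^^ t) p) {..<i} (orb s p)" by (simp add: bij_betw_def)
  then have "card (orb s p) = i" using bij_betw_same_card by fastforce
  then show ?thesis using b i by (simp add: is_cycle_def)
qed

lemma orb_self: "p \<in> orb s p"
proof -
  have "p = (s ^^ 0) p" by simp
  then show ?thesis unfolding orb_def by blast
qed

lemma orb_eq:
  assumes "finite P" "bij_betw s P P" "p \<in> P" "q \<in> orb s p"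
  shows "orb s q = orb s p"
proof -
  have c: "is_cycle s q (orb s p)" by (rule is_cycle_base[OF is_cycle_orb[OF assms(1-3)] assms(4)])
  show ?thesis
  proof
    show "orb s q \<subseteq> orb s p" using is_cycle_pow_in[OF c] by (auto simp: orb_def)
    show "orb s p \<subseteq> orb s q"
    proof
      fix x assume "x \<in> orb s p"
      then obtain t where "x = (s ^^ t) q" using is_cycle_elem[OF c] by metis
      then show "x \<in> orb s q" unfolding orb_def by blast
    qed
  qed
qed

lemma orb_subset:
  assumes "bij_betw s P P" "p \<in> P"
  shows "orb s p \<subseteq> P"
proof -
  have "(s ^^ t) p \<in> P" for t
    using assms by (induction t) (auto simp: bij_betw_def)
  then show ?thesis by (auto simp: orb_def)
qed

lemma orbs_partition:
  assumes "finite P" "bij_betw s P P"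
  shows "disjoint (orb s ` P)" "\<Union>(orb s ` P) = P"
proof -
  show "disjoint (orb s ` P)"
  proof (rule disjointI)
    fix C D assume "C \<in> orb s ` P" "D \<in> orb s ` P" "C \<noteq> D"
    then obtain p q where pq: "p \<in> P" "q \<in> P" "C = orb s p" "D = orb s q" "orb s p \<noteq> orb s q" by blast
    show "C \<inter> D = {}"
    proof (rule ccontr)
      assume "C \<inter> D \<noteq> {}"
      then obtain x where "x \<in> orb s p" "x \<in> orb s q" using pq by blast
      then have "orb s x = orb s p" "orb s x = orb s q"
        using orb_eq[OF assms pq(1), of x] orb_eq[OF assms pq(2), of x] by blast+
      then show False using pq(5) by metis
    qed
  qed
  show "\<Union>(orb s ` P) = P"
    using orb_subset[OF assms(2)] orb_self[of _ s] by blast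
qed

lemma cyc_type_props:
  assumes "finite P" "bij_betw s P P"
  shows "sum_mset (cyc_type s P) = card P" "0 \<notin># cyc_type s P"
proof -
  have fin: "finite (orb s p)" if "p \<in> P" for p using orb_subset[OF assms(2) that] assms(1) finite_subset by blast
  have "sum_mset (cyc_type s P) = (\<Sum>C\<in>orb s ` P. card C)"
    by (simp add: cyc_type_def sum_unfold_sum_mset)
  also have "\<dots> = card (\<Union>(orb s ` P))"
    by (rule card_Union_disjoint[symmetric]) (use orbs_partition[OF assms] fin in auto)
  finally show "sum_mset (cyc_type s P) = card P" using orbs_partition(2)[OF assms] by simp
  have "card C \<noteq> 0" if "C \<in> orb s ` P" for C
  proof -
    obtain p where p: "p \<in> P" "C = orb s p" using \<open>C \<in> orb s ` P\<close> by blast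
    then show ?thesis using fin[OF p(1)] orb_self[of p s] by (auto simp: card_eq_0_iff)
  qed
  then show "0 \<notin># cyc_type s P" using assms(1) unfolding cyc_type_def by fastforce
qed

text \<open>Sorting the cycles by size makes their list of lengths literally the list used in
  \<open>pleth\<close>.\<close>

lemma cycles_list:
  assumes "finite P" "bij_betw s P P"
  obtains cs where "distinct cs" "set cs = orb s ` P" "map card cs = sorted_list_of_multiset (cyc_type s P)"
proof -
  obtain L where L: "set L = orb s ` P" "distinct L" using finite_distinct_list assms(1) by (metis finite_imageI)
  let ?cs = "sort_key card L"
  have "mset (map card ?cs) = cyc_type s P"
    using mset_set_set[OF L(2)] L(1) by (simp add: cyc_type_def)
  then have "sorted_list_of_multiset (cyc_type s P) = sort (map card ?cs)"
    by (metis sorted_list_of_multiset_mset)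
  also have "\<dots> = map card ?cs" by (simp add: sorted_sort_id)
  finally show thesis using that[of ?cs] L by simp
qed

text \<open>The same choice as inside \<open>ch1\<close>, named so that label sets and the
  evaluation of U agree.\<close>

definition model_set :: "nat \<Rightarrow> 'x set" where
  "model_set k = (SOME I. finite I \<and> card I = k)"

text \<open>An infinite type has a subset of every finite size, so the choice is meaningful for all
  \<open>k\<close>.\<close>

lemma model_set:
  assumes "infinite (UNIV :: 'x set)"
  shows "finite (model_set k :: 'x set)" "card (model_set k :: 'x set) = k"
proof -
  have "\<exists>I :: 'x set. finite I \<and> card I = k"
    using infinite_arbitrarily_large[OF assms] by blast
  then have "finite (model_set k :: 'x set) \<and> card (model_set k :: 'x set) = k"
    unfolding model_set_def by (rule someI_ex)
  then show "finite (model_set k :: 'x set)" "card (model_set k :: 'x set) = k" by auto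
qed

section \<open>Permutations, bijections and the plethysm as a sum over permutations\<close>

lemma finite_perms_on: "finite P \<Longrightarrow> finite (perms_on P)"
proof (rule finite_subset)
  let ?e = "\<lambda>f y. if y \<in> P then f y else y"
  show "perms_on P \<subseteq> ?e ` (P \<rightarrow>\<^sub>E P)"
  proof
    fix s assume s: "s \<in> perms_on P"
    then have "s = ?e (restrict s P)" by (auto simp: perms_on_def)
    moreover have "restrict s P \<in> P \<rightarrow>\<^sub>E P" using s by (auto simp: perms_on_def bij_betw_def)
    ultimately show "s \<in> ?e ` (P \<rightarrow>\<^sub>E P)" by (rule image_eqI)
  qed
  show "finite P \<Longrightarrow> finite (?e ` (P \<rightarrow>\<^sub>E P))" by (intro finite_imageI finite_PiE) auto
qed

lemma card_self_bijections:
  assumes "finite P"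
  shows "card {f \<in> P \<rightarrow>\<^sub>E P. bij_betw f P P} = fact (card P)"
proof -
  have "{f \<in> P \<rightarrow>\<^sub>E P. bij_betw f P P} = {f \<in> P \<rightarrow>\<^sub>E P. inj_on f P}"
  proof (intro Collect_cong conj_cong refl)
    fix f assume "f \<in> P \<rightarrow>\<^sub>E P"
    then have "f ` P \<subseteq> P" by auto
    then show "bij_betw f P P \<longleftrightarrow> inj_on f P"
      using endo_inj_surj[OF assms, of f] by (auto simp: bij_betw_def)
  qed
  moreover have "(\<Prod>i = 0..<n. n - i) = fact n" for n :: nat
    using fact_prod_rev[of n, where ?'a = nat] by simp
  ultimately show ?thesis
    using card_inj_on_subset_funcset[OF assms assms, of P] by simp
qed

lemma card_bijections:
  assumes "finite P" "finite T" "card T = card P"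
  shows "card {f \<in> P \<rightarrow>\<^sub>E T. bij_betw f P T} = fact (card P)"
proof -
  obtain g where g: "bij_betw g T P" using assms finite_same_card_bij by metis
  let ?k = "inv_into T g"
  have k: "bij_betw ?k P T" using bij_betw_inv_into[OF g] .
  have gk: "g (?k p) = p" if "p \<in> P" for p using bij_betw_inv_into_right[OF g that] .
  have kg: "?k (g x) = x" if "x \<in> T" for x using bij_betw_inv_into_left[OF g that] .
  have comp: "compose P h f \<in> P \<rightarrow>\<^sub>E C \<and> bij_betw (compose P h f) P C"
    if "bij_betw h B C" "bij_betw f P B" for h f B C
  proof -
    have "bij_betw (compose P h f) P C"
      using bij_betw_trans[OF that(2,1)] by (subst bij_betw_cong[of _ _ "h \<circ> f"]) (auto simp: compose_def)
    then show ?thesis by (auto simp: bij_betw_def compose_def)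
  qed
  have "bij_betw (compose P g) {f \<in> P \<rightarrow>\<^sub>E T. bij_betw f P T} {f \<in> P \<rightarrow>\<^sub>E P. bij_betw f P P}"
  proof (rule bij_betw_byWitness[where f' = "compose P ?k"])
    show "\<forall>f\<in>{f \<in> P \<rightarrow>\<^sub>E T. bij_betw f P T}. compose P ?k (compose P g f) = f"
      using kg by (auto simp: compose_def fun_eq_iff PiE_def extensional_def)
    show "\<forall>f\<in>{f \<in> P \<rightarrow>\<^sub>E P. bij_betw f P P}. compose P g (compose P ?k f) = f"
      using gk by (auto simp: compose_def fun_eq_iff PiE_def extensional_def)
    show "compose P g ` {f \<in> P \<rightarrow>\<^sub>E T. bij_betw f P T} \<subseteq> {f \<in> P \<rightarrow>\<^sub>E P. bij_betw f P P}"
      using comp[OF g] by blast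
    show "compose P ?k ` {f \<in> P \<rightarrow>\<^sub>E P. bij_betw f P P} \<subseteq> {f \<in> P \<rightarrow>\<^sub>E T. bij_betw f P T}"
      using comp[OF k] by blast
  qed
  then show ?thesis using bij_betw_same_card card_self_bijections[OF assms(1)] by fastforce
qed

text \<open>A coefficient of \<open>ch1\<close> is itself an average over the permutations of one
  cycle type, so the sum over monomials becomes a sum over all permutations, and the bound on the
  weight of \<mu> becomes a bound on the number of labels.\<close>

lemma pleth_eq:
  fixes U :: "('x, 'u) bmod"
  assumes inf: "infinite (UNIV :: 'x set)"
  defines "N \<equiv> \<lambda>m. sum_mset (image_mset fst m)"
  shows "pleth (ch1 U) g m = (\<Sum>k\<le>N m. \<Sum>s\<in>perms_on (model_set k). trace U s (model_set k) / fact k *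
    foldr ps_mult (map (\<lambda>i. adams i g) (sorted_list_of_multiset (cyc_type s (model_set k)))) ps_one m)"
proof -
  let ?T = "{\<mu>. 0 \<notin># \<mu> \<and> sum_mset \<mu> \<le> N m}"
  let ?S = "SIGMA k:{..N m}. perms_on (model_set k :: 'x set)"
  let ?G = "\<lambda>\<mu>. foldr ps_mult (map (\<lambda>i. adams i g) (sorted_list_of_multiset \<mu>)) ps_one m"
  let ?h = "\<lambda>(k, s). trace U s (model_set k) / fact k * ?G (cyc_type s (model_set k))"
  let ?c = "\<lambda>(k, s). cyc_type s (model_set k :: 'x set)"
  have fp: "finite (perms_on (model_set k :: 'x set))" for k using finite_perms_on model_set[OF inf] by blast
  have sb: "bij_betw s (model_set k) (model_set k)" if "s \<in> perms_on (model_set k :: 'x set)" for s k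
    using that by (simp add: perms_on_def)
  note props = cyc_type_props[OF model_set(1)[OF inf] sb]
  have "finite ?T"
  proof (rule finite_subset)
    show "?T \<subseteq> (\<Union>k\<in>{..N m}. multisets_of_size {..N m} k)"
    proof
      fix \<mu> assume \<mu>: "\<mu> \<in> ?T"
      have "size \<mu> \<le> sum_mset \<mu>" if "0 \<notin># \<mu>" for \<mu> :: "nat multiset"
        using that by (induction \<mu>) auto
      moreover have "x \<le> sum_mset \<mu>" if "x \<in># \<mu>" for x
        using that by (metis le_add1 sum_mset.remove)
      ultimately show "\<mu> \<in> (\<Union>k\<in>{..N m}. multisets_of_size {..N m} k)"
        using \<mu> by (force simp: multisets_of_size_def intro: order_trans)
    qed
    show "finite (\<Union>k\<in>{..N m}. multisets_of_size {..N m} k)" by auto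
  qed
  moreover have "finite ?S" using fp by simp
  moreover have "?c ` ?S \<subseteq> ?T" using props model_set(2)[OF inf] by force
  ultimately have "(\<Sum>x\<in>?S. ?h x) = (\<Sum>\<mu>\<in>?T. \<Sum>x\<in>{x \<in> ?S. ?c x = \<mu>}. ?h x)"
    by (intro sum.group[symmetric])
  also have "\<dots> = (\<Sum>\<mu>\<in>?T. ch1 U \<mu> * ?G \<mu>)"
  proof (rule sum.cong[OF refl])
    fix \<mu> assume \<mu>: "\<mu> \<in> ?T"
    let ?k = "sum_mset \<mu>"
    \<comment> \<open>The cycle type determines the number of labels as its weight, so a monomial
      meets only one value of \<open>k\<close>.\<close>
    have "{x \<in> ?S. ?c x = \<mu>} = Pair ?k ` {s \<in> perms_on (model_set ?k). cyc_type s (model_set ?k :: 'x set) = \<mu>}"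
      using \<mu> props(1) model_set(2)[OF inf] by force
    then have "(\<Sum>x\<in>{x \<in> ?S. ?c x = \<mu>}. ?h x)
        = (\<Sum>s\<in>{s \<in> perms_on (model_set ?k). cyc_type s (model_set ?k :: 'x set) = \<mu>}. ?h (?k, s))"
      by (simp add: sum.reindex inj_on_def)
    also have "\<dots> = (\<Sum>s\<in>{s \<in> perms_on (model_set ?k). cyc_type s (model_set ?k :: 'x set) = \<mu>}.
        trace U s (model_set ?k) / fact ?k * ?G \<mu>)"
      by (rule sum.cong) auto
    also have "\<dots> = ch1 U \<mu> * ?G \<mu>"
      by (simp add: ch1_def Let_def model_set_def[symmetric] sum_distrib_right sum_divide_distrib)
    finally show "(\<Sum>x\<in>{x \<in> ?S. ?c x = \<mu>}. ?h x) = ch1 U \<mu> * ?G \<mu>" .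
  qed
  also have "\<dots> = pleth (ch1 U) g m" by (simp add: pleth_def N_def)
  finally show ?thesis using fp by (simp add: sum.Sigma)
qed

section \<open>Labelled partitions\<close>

context root_sets
begin

definition stable_parts :: "(complex \<times> nat) set \<Rightarrow> (complex \<times> nat \<Rightarrow> complex \<times> nat) \<Rightarrow> (complex \<times> nat) set set set" where
  "stable_parts X w = {\<pi>. partition_on X \<pi> \<and> (\<forall>K\<in>\<pi>. objr r K) \<and> (\<lambda>K. w ` K) ` \<pi> = \<pi>}"

lemma finite_stable_parts: "finite X \<Longrightarrow> finite (stable_parts X w)"
  by (rule finite_subset[of _ "Pow (Pow X)"]) (auto simp: stable_parts_def partition_on_def)

text \<open>A diagonal entry vanishes unless \<open>w\<close> fixes the partition. For a fixed
  partition the basis is a product, and the sum factors into the trace on U and the trace on the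
  tensor product.\<close>

lemma trace_comp_mod:
  assumes U: "is_module obj1 hom1 U" and V: "is_module (objr r) (homr r) V" and X: "aut X w"
  shows "trace (comp_mod r U V) w X =
    (\<Sum>\<pi>\<in>stable_parts X w. trace U (\<lambda>K. w ` K) \<pi> * tensor_trace V w (\<lambda>K. K) \<pi> (\<lambda>K. w ` K))"
proof -
  let ?P = "{\<pi>. partition_on X \<pi> \<and> (\<forall>K\<in>\<pi>. objr r K)}"
  let ?w = "\<lambda>K. w ` K"
  have finX: "finite X" using aut_finite[OF X] .
  have finP: "finite ?P"
    by (rule finite_subset[of _ "Pow (Pow X)"]) (auto simp: finX partition_on_def)
  have fin\<pi>: "finite \<pi>" if "\<pi> \<in> ?P" for \<pi>
    by (rule finite_subset[of _ "Pow X"]) (use that finX in \<open>auto simp: partition_on_def\<close>)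
  have finU: "finite (basis U \<pi>)" if "\<pi> \<in> ?P" for \<pi>
  proof -
    have "\<forall>I. obj1 I \<longrightarrow> finite (basis U I)" using U unfolding is_module_def by (elim conjE) assumption
    then show ?thesis using fin\<pi>[OF that] by (simp add: obj1_def)
  qed
  have finV: "finite (\<Pi>\<^sub>E K\<in>\<pi>. basis V K)" if "\<pi> \<in> ?P" for \<pi>
  proof -
    have "\<forall>I. objr r I \<longrightarrow> finite (basis V I)" using V unfolding is_module_def by (elim conjE) assumption
    then show ?thesis using fin\<pi>[OF that] that by (intro finite_PiE) auto
  qed
  let ?t = "\<lambda>\<pi> u \<sigma>. if \<pi> = ?w ` \<pi> then mat U ?w \<pi> u u * (\<Prod>K\<in>\<pi>. mat V w K (\<sigma> (w ` K)) (\<sigma> K)) else 0"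
  have "basis (comp_mod r U V) X = (SIGMA \<pi>:?P. basis U \<pi> \<times> (\<Pi>\<^sub>E K\<in>\<pi>. basis V K))"
    by (auto simp: comp_mod_def)
  then have "trace (comp_mod r U V) w X
      = (\<Sum>(\<pi>, u, \<sigma>)\<in>(SIGMA \<pi>:?P. basis U \<pi> \<times> (\<Pi>\<^sub>E K\<in>\<pi>. basis V K)). ?t \<pi> u \<sigma>)"
    unfolding trace_def by (intro sum.cong) (auto simp: comp_mod_def)
  also have "\<dots> = (\<Sum>\<pi>\<in>?P. \<Sum>(u, \<sigma>)\<in>basis U \<pi> \<times> (\<Pi>\<^sub>E K\<in>\<pi>. basis V K). ?t \<pi> u \<sigma>)"
    using finP finU finV by (subst sum.Sigma) (auto simp: case_prod_beta)
  also have "\<dots> = (\<Sum>\<pi>\<in>?P. if \<pi> = ?w ` \<pi> then trace U ?w \<pi> * tensor_trace V w (\<lambda>K. K) \<pi> ?w else 0)"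
    by (rule sum.cong[OF refl])
      (auto simp: trace_def tensor_trace_def sum_product sum.cartesian_product case_prod_beta)
  also have "\<dots> = (\<Sum>\<pi>\<in>{\<pi> \<in> ?P. \<pi> = ?w ` \<pi>}. trace U ?w \<pi> * tensor_trace V w (\<lambda>K. K) \<pi> ?w)"
    by (rule sum.inter_filter[OF finP, symmetric])
  also have "{\<pi> \<in> ?P. \<pi> = ?w ` \<pi>} = stable_parts X w"
    by (auto simp: stable_parts_def)
  finally show ?thesis .
qed

text \<open>Every block is nonempty and stable, so it contains a free orbit of \<open>r\<close>
  points. The bound obtained is the one that limits \<open>k\<close> in
  \<open>pleth_eq\<close>.\<close>

lemma card_stable_parts:
  assumes X: "aut X w" and \<pi>: "\<pi> \<in> stable_parts X w"
  shows "finite \<pi>" "card \<pi> \<le> sum_mset (image_mset fst (gtype w X))"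
proof -
  have ob: "objr r K" if "K \<in> \<pi>" for K
    using \<pi> that by (auto simp: stable_parts_def)
  show fin: "finite \<pi>"
    by (rule finite_subset[of _ "Pow X"])
      (use \<pi> aut_finite[OF X] in \<open>auto simp: stable_parts_def partition_on_def\<close>)
  have "r \<le> card K" if K: "K \<in> \<pi>" for K
  proof -
    have "K \<noteq> {}" using \<pi> K by (auto simp: stable_parts_def partition_on_def)
    then obtain x where x: "x \<in> K" by blast
    have "inj_on (\<lambda>z. act z x) mu"
      using act_eq_iff[of x] ob[OF K] x by (auto simp: objr_def inj_on_def)
    then have "card ((\<lambda>z. act z x) ` mu) = r" by (simp add: card_image card_mu)
    moreover have "(\<lambda>z. act z x) ` mu \<subseteq> K" using ob[OF K] x by (auto simp: objr_def)
    ultimately show ?thesis using ob[OF K] card_mono by (metis objr_def)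
  qed
  then have "(\<Sum>K\<in>\<pi>. r) \<le> (\<Sum>K\<in>\<pi>. card K)" by (rule sum_mono)
  also have "\<dots> = card X"
    using \<pi> by (intro product_partition[symmetric]) (auto simp: stable_parts_def objr_def)
  finally show "card \<pi> \<le> sum_mset (image_mset fst (gtype w X))"
    using card_weight[OF X] r_pos by simp
qed

section \<open>Labelling the blocks of a stable partition\<close>

lemma tensor_trace_reindex:
  assumes f: "bij_betw f P \<pi>" and s: "\<And>p. p \<in> P \<Longrightarrow> s p \<in> P \<and> t (f p) = f (s p)"
  shows "tensor_trace V w (\<lambda>K. K) \<pi> t = tensor_trace V w f P s"
proof -
  have fp: "f p \<in> \<pi>" if "p \<in> P" for p using f that by (auto simp: bij_betw_def)
  let ?h = "\<lambda>\<tau>. \<Prod>p\<in>P. mat V w (f p) (\<tau> (s p)) (\<tau> p)"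
  have "tensor_trace V w (\<lambda>K. K) \<pi> t = (\<Sum>\<sigma>\<in>(\<Pi>\<^sub>E K\<in>\<pi>. basis V K). ?h (\<lambda>p\<in>P. \<sigma> (f p)))"
    unfolding tensor_trace_def
  proof (rule sum.cong[OF refl])
    fix \<sigma>
    have "(\<Prod>K\<in>\<pi>. mat V w K (\<sigma> (t K)) (\<sigma> K)) = (\<Prod>p\<in>P. mat V w (f p) (\<sigma> (t (f p))) (\<sigma> (f p)))"
      by (rule prod.reindex_bij_betw[OF f, symmetric])
    also have "\<dots> = ?h (\<lambda>p\<in>P. \<sigma> (f p))" using s by (intro prod.cong) auto
    finally show "(\<Prod>K\<in>\<pi>. mat V w K (\<sigma> (t K)) (\<sigma> K)) = ?h (\<lambda>p\<in>P. \<sigma> (f p))" .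
  qed
  also have "\<dots> = tensor_trace V w f P s"
    unfolding tensor_trace_def by (rule sum_PiE_reindex[OF f])
  finally show ?thesis .
qed

text \<open>With \<open>?g\<close> = \<open>s\<close> after the inverse of \<open>f\<close>, the
  permutation \<open>t\<close> of the blocks is \<open>f\<close> after \<open>?g\<close> and
  \<open>s\<close> is \<open>?g\<close> after \<open>f\<close>, so \<open>trace_comm\<close>
  applies.\<close>

lemma trace_reindex:
  assumes U: "is_module obj1 hom1 U" and fin: "finite P" and f: "bij_betw f P \<pi>"
    and s: "bij_betw s P P" and t: "\<And>p. p \<in> P \<Longrightarrow> t (f p) = f (s p)"
  shows "trace U t \<pi> = trace U s P"
proof -
  have f': "f ` P = \<pi>" "inj_on f P" using f by (auto simp: bij_betw_def)
  have s': "s ` P = P" "inj_on s P" using s by (auto simp: bij_betw_def)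
  let ?g = "s \<circ> inv_into P f"
  have gf: "(?g \<circ> f) p = s p" if "p \<in> P" for p using f' that by simp
  have fg: "(f \<circ> ?g) K = t K" if "K \<in> \<pi>" for K
  proof -
    obtain p where p: "p \<in> P" "K = f p" using f'(1) \<open>K \<in> \<pi>\<close> by blast
    then show ?thesis using f'(2) t by simp
  qed
  have g: "bij_betw ?g \<pi> P" using bij_betw_trans[OF bij_betw_inv_into[OF f] s] .
  have t\<pi>: "bij_betw t \<pi> \<pi>"
    using bij_betw_trans[OF g f] fg by (simp cong: bij_betw_cong)
  have fin\<pi>: "finite \<pi>" using fin f'(1) by blast
  have "trace U t \<pi> = trace U (f \<circ> ?g) \<pi>"
    by (rule trace_cong[OF U]) (use t\<pi> fin\<pi> fg in \<open>auto simp: hom1_def bij_betw_def\<close>)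
  also have "\<dots> = trace U (?g \<circ> f) P"
    using trace_comm[OF U, of P f ?g] fin fin\<pi> f' g by (simp add: hom1_def bij_betw_def)
  also have "\<dots> = trace U s P"
    by (rule trace_cong[OF U, symmetric]) (use fin s' gf in \<open>auto simp: hom1_def\<close>)
  finally show ?thesis .
qed

lemma fiber_bij:
  assumes "\<phi> ` X = P"
  shows "bij_betw (fiber \<phi> X) P (fiber \<phi> X ` P)"
proof -
  have "inj_on (fiber \<phi> X) P"
  proof (rule inj_onI)
    fix p q assume "p \<in> P" "q \<in> P" and eq: "fiber \<phi> X p = fiber \<phi> X q"
    then obtain x where "x \<in> X" "\<phi> x = p" using assms by blast
    then have "x \<in> fiber \<phi> X q" using eq by (auto simp: fiber_def)
    then show "p = q" using \<open>\<phi> x = p\<close> by (simp add: fiber_def)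
  qed
  then show ?thesis by (simp add: bij_betw_def)
qed

lemma fiber_parts:
  assumes X: "aut X w" and s: "s \<in> perms_on P" and \<phi>: "\<phi> \<in> inv_maps X w P s" "\<phi> ` X = P"
  shows "fiber \<phi> X ` P \<in> stable_parts X w"
proof -
  have s': "inj_on s P" "s ` P = P" using s by (auto simp: perms_on_def bij_betw_def)
  have "partition_on X (fiber \<phi> X ` P)"
  proof (rule partition_onI)
    show "\<Union>(fiber \<phi> X ` P) = X" using \<phi>(2) by (auto simp: fiber_def)
    show "{} \<notin> fiber \<phi> X ` P" using \<phi>(2) by (fastforce simp: fiber_def)
    show "disjnt K L" if "K \<in> fiber \<phi> X ` P" "L \<in> fiber \<phi> X ` P" "K \<noteq> L" for K L
      using that by (auto simp: fiber_def disjnt_def)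
  qed
  moreover have "(\<lambda>K. w ` K) ` fiber \<phi> X ` P = fiber \<phi> X ` P"
  proof -
    have "(\<lambda>K. w ` K) ` fiber \<phi> X ` P = fiber \<phi> X ` s ` P"
      unfolding image_image by (rule image_cong[OF refl]) (rule fiber_hom(2)[OF X \<phi>(1) s'(1)])
    then show ?thesis using s'(2) by simp
  qed
  moreover have "objr r K" if "K \<in> fiber \<phi> X ` P" for K
    using that fiber_hom(1)[OF X \<phi>(1) s'(1)] by (auto simp: homr_def)
  ultimately show ?thesis by (simp add: stable_parts_def)
qed

text \<open>A bijection from labels to blocks determines the map sending a point to the label of its
  block, and then the permutation of labels induced by \<open>w\<close> on the blocks.\<close>

lemma labelling_bij:
  assumes X: "aut X w" and fin: "finite P" and \<pi>: "\<pi> \<in> stable_parts X w"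
  shows "bij_betw (\<lambda>(s, \<phi>). restrict (fiber \<phi> X) P)
    {(s, \<phi>). s \<in> perms_on P \<and> \<phi> \<in> inv_maps X w P s \<and> \<phi> ` X = P \<and> fiber \<phi> X ` P = \<pi>}
    {f \<in> P \<rightarrow>\<^sub>E \<pi>. bij_betw f P \<pi>}"
    (is "bij_betw ?F ?A ?B")
proof -
  have part: "partition_on X \<pi>" and ob: "\<And>K. K \<in> \<pi> \<Longrightarrow> objr r K" and w\<pi>: "(\<lambda>K. w ` K) ` \<pi> = \<pi>"
    using \<pi> by (auto simp: stable_parts_def)
  have uniq: "K = L" if "K \<in> \<pi>" "L \<in> \<pi>" "x \<in> K" "x \<in> L" for K L x
    using disjointD[OF partition_onD2[OF part] that(1,2)] that(3,4) by blast
  have "inj_on ?F ?A"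
  proof (rule inj_onI)
    fix a b assume ab: "a \<in> ?A" "b \<in> ?A" and eq: "?F a = ?F b"
    from ab(1) obtain s \<phi> where a: "a = (s, \<phi>)" "s \<in> perms_on P" "\<phi> \<in> inv_maps X w P s" "\<phi> ` X = P"
      by (cases a) auto
    from ab(2) obtain t \<psi> where b: "b = (t, \<psi>)" "t \<in> perms_on P" "\<psi> \<in> inv_maps X w P t" "\<psi> ` X = P"
      by (cases b) auto
    have fiber_eq: "fiber \<phi> X p = fiber \<psi> X p" if "p \<in> P" for p
      using fun_cong[OF eq, of p] a(1) b(1) that by simp
    have \<phi>\<psi>: "\<phi> x = \<psi> x" if "x \<in> X" for x
    proof -
      have "\<phi> x \<in> P" "x \<in> fiber \<phi> X (\<phi> x)" using a(4) that by (auto simp: fiber_def)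
      then have "x \<in> fiber \<psi> X (\<phi> x)" using fiber_eq by blast
      then show ?thesis by (simp add: fiber_def)
    qed
    have "\<phi> = \<psi>"
      using a(3) b(3) \<phi>\<psi> by (intro PiE_ext[of \<phi> X "\<lambda>_. P" \<psi>]) (auto simp: equiv_maps_def)
    moreover have "s p = t p" for p
    proof (cases "p \<in> P")
      case True
      then obtain x where x: "x \<in> X" "p = \<phi> x" using a(4) by blast
      have "s (\<phi> x) = \<phi> (w x)" "t (\<psi> x) = \<psi> (w x)" using a(3) b(3) x by (auto simp: equiv_maps_def)
      then show ?thesis using x(2) \<open>\<phi> = \<psi>\<close> by simp
    next
      case False
      then show ?thesis using a(2) b(2) by (auto simp: perms_on_def)
    qed
    ultimately show "a = b" using a(1) b(1) by auto
  qed
  moreover have "?F ` ?A \<subseteq> ?B"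
  proof (rule image_subsetI)
    fix a assume "a \<in> ?A"
    then obtain s \<phi> where a: "a = (s, \<phi>)" "\<phi> ` X = P" "fiber \<phi> X ` P = \<pi>" by blast
    have "bij_betw (fiber \<phi> X) P \<pi>" using fiber_bij[OF a(2)] a(3) by simp
    then have "bij_betw (restrict (fiber \<phi> X) P) P \<pi>" by (subst bij_betw_cong[of _ _ "fiber \<phi> X"]) auto
    then show "?F a \<in> ?B" using a by (auto simp: bij_betw_def)
  qed
  moreover have "?B \<subseteq> ?F ` ?A"
  proof
    fix f assume "f \<in> ?B"
    then have f: "f \<in> P \<rightarrow>\<^sub>E \<pi>" "inj_on f P" "f ` P = \<pi>" by (auto simp: bij_betw_def)
    have f\<pi>: "f p \<in> \<pi>" if "p \<in> P" for p using f(3) that by blast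
    have ex: "\<exists>p\<in>P. x \<in> f p" if "x \<in> X" for x
    proof -
      have "x \<in> \<Union>(f ` P)" using part f(3) that by (simp add: partition_on_def)
      then show ?thesis by blast
    qed
    define \<phi> where "\<phi> = (\<lambda>x\<in>X. SOME p. p \<in> P \<and> x \<in> f p)"
    have \<phi>x: "\<phi> x \<in> P \<and> x \<in> f (\<phi> x)" if "x \<in> X" for x
    proof -
      have "\<exists>p. p \<in> P \<and> x \<in> f p" using ex[OF that] by blast
      from someI_ex[OF this] show ?thesis using that by (simp add: \<phi>_def)
    qed
    have \<phi>_eq: "\<phi> x = p" if "x \<in> X" "p \<in> P" "x \<in> f p" for x p
    proof -
      have "f (\<phi> x) = f p" using uniq[OF f\<pi> f\<pi>] \<phi>x[OF that(1)] that(2,3) by blast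
      then show ?thesis using f(2) \<phi>x[OF that(1)] that(2) by (auto dest: inj_onD)
    qed
    have fX: "f p \<subseteq> X" if "p \<in> P" for p
      using f\<pi>[OF that] part by (auto simp: partition_on_def)
    have fne: "f p \<noteq> {}" if "p \<in> P" for p
      using f\<pi>[OF that] part by (auto simp: partition_on_def)
    have fiber: "fiber \<phi> X p = f p" if "p \<in> P" for p
      using \<phi>x \<phi>_eq[OF _ that] fX[OF that] by (auto simp: fiber_def)
    \<comment> \<open>The action of \<open>w\<close> on blocks, read in the labels; it is the
      identity outside \<open>P\<close>, as \<open>perms_on\<close> demands.\<close>
    define s where "s = (\<lambda>p. if p \<in> P then inv_into P f (w ` f p) else p)"
    have wf: "w ` f p \<in> f ` P" if "p \<in> P" for p
      using w\<pi> f\<pi>[OF that] f(3) by blast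
    have sP: "s p \<in> P" "f (s p) = w ` f p" if "p \<in> P" for p
      using inv_into_into[OF wf[OF that]] f_inv_into_f[OF wf[OF that]] that by (auto simp: s_def)
    have "inj_on s P"
    proof (rule inj_onI)
      fix p q assume pq: "p \<in> P" "q \<in> P" "s p = s q"
      then have "w ` f p = w ` f q" using sP by metis
      moreover have "inj_on w X" using X by (simp add: aut_def bij_betw_def)
      ultimately have "f p = f q" using fX pq by (metis inj_on_image_eq_iff)
      then show "p = q" using f(2) pq by (auto dest: inj_onD)
    qed
    then have "bij_betw s P P" using sP(1) fin by (simp add: bij_betw_def endo_inj_surj image_subsetI)
    then have s: "s \<in> perms_on P" by (auto simp: perms_on_def s_def)
    have \<phi>w: "\<phi> (w x) = s (\<phi> x)" if "x \<in> X" for x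
      by (rule \<phi>_eq) (use \<phi>x[OF that] sP aut_in[OF X that] in auto)
    have \<phi>a: "\<phi> (act z x) = \<phi> x" if "x \<in> X" "z \<in> mu" for x z
      by (rule \<phi>_eq) (use \<phi>x[OF that(1)] ob[OF f\<pi>] aut_act_in[OF X that] that(2) in \<open>auto simp: objr_def\<close>)
    have "\<phi> \<in> X \<rightarrow>\<^sub>E P" using \<phi>x by (auto simp: \<phi>_def)
    then have e: "\<phi> \<in> inv_maps X w P s" using \<phi>w \<phi>a by (simp add: equiv_maps_def)
    have surj: "\<phi> ` X = P"
    proof
      show "\<phi> ` X \<subseteq> P" using \<phi>x by blast
      show "P \<subseteq> \<phi> ` X"
      proof
        fix p assume p: "p \<in> P"
        then obtain x where x: "x \<in> f p" using fne by blast
        then have "x \<in> X" using fX[OF p] by blast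
        then show "p \<in> \<phi> ` X" using \<phi>_eq[OF _ p x] by blast
      qed
    qed
    have "fiber \<phi> X ` P = \<pi>" using fiber f(3) by (metis image_cong)
    then have "(s, \<phi>) \<in> ?A" using s e surj by blast
    moreover have "f = ?F (s, \<phi>)"
      using fiber f(1) by (auto simp: fun_eq_iff PiE_def extensional_def)
    ultimately show "f \<in> ?F ` ?A" by blast
  qed
  ultimately show ?thesis unfolding bij_betw_def by blast
qed

text \<open>Surjective labellings are grouped by their partition into fibres. Relabelling changes
  neither of the two traces, so the \<open>fact (card P)\<close> labellings of one partition
  contribute equally.\<close>

lemma sum_labellings:
  assumes U: "is_module obj1 hom1 U" and V: "basis V {} = {}" and X: "aut X w" and fin: "finite P"
  shows "(\<Sum>s\<in>perms_on P. trace U s P * labelled_trace V w X P s) = fact (card P) *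
    (\<Sum>\<pi>\<in>{\<pi> \<in> stable_parts X w. card \<pi> = card P}. trace U (\<lambda>K. w ` K) \<pi> * tensor_trace V w (\<lambda>K. K) \<pi> (\<lambda>K. w ` K))"
    (is "_ = _ * (\<Sum>\<pi>\<in>?T. ?\<Psi> \<pi>)")
proof -
  let ?S = "SIGMA s:perms_on P. {\<phi> \<in> inv_maps X w P s. \<phi> ` X = P}"
  let ?f = "\<lambda>(s, \<phi>). trace U s P * tensor_trace V w (fiber \<phi> X) P s"
  let ?G = "\<lambda>(s, \<phi>). fiber \<phi> X ` P"
  have fine: "finite (inv_maps X w P s)" for s using finite_equiv_maps[OF X fin] .
  have finS: "finite ?S" using finite_perms_on[OF fin] fine by simp
  have finT: "finite ?T" using finite_stable_parts[OF aut_finite[OF X]] by simp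
  have "labelled_trace V w X P s = (\<Sum>\<phi>\<in>{\<phi> \<in> inv_maps X w P s. \<phi> ` X = P}. tensor_trace V w (fiber \<phi> X) P s)" for s
    unfolding labelled_trace_def
  proof (rule sum.mono_neutral_right[OF fine])
    \<comment> \<open>A missed label has empty fibre and hence an empty basis, which leaves no
      section to sum over.\<close>
    show "\<forall>\<phi>\<in>inv_maps X w P s - {\<phi> \<in> inv_maps X w P s. \<phi> ` X = P}. tensor_trace V w (fiber \<phi> X) P s = 0"
    proof
      fix \<phi> assume "\<phi> \<in> inv_maps X w P s - {\<phi> \<in> inv_maps X w P s. \<phi> ` X = P}"
      then have "\<phi> ` X \<subseteq> P" "\<phi> ` X \<noteq> P" by (auto simp: equiv_maps_def)
      then obtain q where q: "q \<in> P" "q \<notin> \<phi> ` X" by blast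
      then have "fiber \<phi> X q = {}" by (auto simp: fiber_def)
      then have "(\<Pi>\<^sub>E p\<in>P. basis V (fiber \<phi> X p)) = {}"
        using q(1) V by (auto simp: PiE_eq_empty_iff)
      then show "tensor_trace V w (fiber \<phi> X) P s = 0" by (simp add: tensor_trace_def)
    qed
  qed auto
  then have "(\<Sum>s\<in>perms_on P. trace U s P * labelled_trace V w X P s) = (\<Sum>a\<in>?S. ?f a)"
    using finite_perms_on[OF fin] fine by (simp add: sum_distrib_left sum.Sigma)
  also have "\<dots> = (\<Sum>\<pi>\<in>?T. \<Sum>a\<in>{a \<in> ?S. ?G a = \<pi>}. ?f a)"
  proof (rule sum.group[OF finS finT, symmetric])
    show "?G ` ?S \<subseteq> ?T"
    proof (rule image_subsetI)
      fix a assume "a \<in> ?S"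
      then obtain s \<phi> where a: "a = (s, \<phi>)" "s \<in> perms_on P" "\<phi> \<in> inv_maps X w P s" "\<phi> ` X = P" by blast
      show "?G a \<in> ?T"
        using fiber_parts[OF X a(2-4)] bij_betw_same_card[OF fiber_bij[OF a(4)]] a(1) by simp
    qed
  qed
  also have "\<dots> = (\<Sum>\<pi>\<in>?T. fact (card P) * ?\<Psi> \<pi>)"
  proof (rule sum.cong[OF refl])
    fix \<pi> assume "\<pi> \<in> ?T"
    then have \<pi>: "\<pi> \<in> stable_parts X w" "card \<pi> = card P" by auto
    have A: "{a \<in> ?S. ?G a = \<pi>} =
        {(s, \<phi>). s \<in> perms_on P \<and> \<phi> \<in> inv_maps X w P s \<and> \<phi> ` X = P \<and> fiber \<phi> X ` P = \<pi>}"
      by auto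
    have "?f a = ?\<Psi> \<pi>" if "a \<in> {a \<in> ?S. ?G a = \<pi>}" for a
    proof -
      obtain s \<phi> where a: "a = (s, \<phi>)" "s \<in> perms_on P" "\<phi> \<in> inv_maps X w P s" "\<phi> ` X = P" "fiber \<phi> X ` P = \<pi>"
        using \<open>a \<in> {a \<in> ?S. ?G a = \<pi>}\<close> by blast
      have s: "bij_betw s P P" "inj_on s P" using a(2) by (auto simp: perms_on_def bij_betw_def)
      have sP: "s p \<in> P" if "p \<in> P" for p using s(1) that by (auto simp: bij_betw_def)
      have b: "bij_betw (fiber \<phi> X) P \<pi>" using fiber_bij[OF a(4)] a(5) by simp
      have t: "w ` fiber \<phi> X p = fiber \<phi> X (s p)" if "p \<in> P" for p
        using fiber_hom(2)[OF X a(3) s(2) that] .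
      have "trace U (\<lambda>K. w ` K) \<pi> = trace U s P"
        by (rule trace_reindex[OF U fin b s(1) t])
      moreover have "tensor_trace V w (\<lambda>K. K) \<pi> (\<lambda>K. w ` K) = tensor_trace V w (fiber \<phi> X) P s"
        by (rule tensor_trace_reindex[OF b]) (use sP t in blast)
      ultimately show ?thesis using a(1) by simp
    qed
    then have "(\<Sum>a\<in>{a \<in> ?S. ?G a = \<pi>}. ?f a) = of_nat (card {a \<in> ?S. ?G a = \<pi>}) * ?\<Psi> \<pi>"
      by simp
    also have "card {a \<in> ?S. ?G a = \<pi>} = fact (card P)"
      unfolding A using bij_betw_same_card[OF labelling_bij[OF X fin \<pi>(1)]]
        card_bijections[OF fin card_stable_parts(1)[OF X \<pi>(1)] \<pi>(2)] by simp
    finally show "(\<Sum>a\<in>{a \<in> ?S. ?G a = \<pi>}. ?f a) = fact (card P) * ?\<Psi> \<pi>" by simp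
  qed
  finally show ?thesis by (simp add: sum_distrib_left)
qed

lemma labelled_trace_perm:
  assumes V: "is_module (objr r) (homr r) V" and X: "aut X w" and P: "finite P" "s \<in> perms_on P"
  shows "labelled_trace V w X P s = of_nat (cent_order (gtype w X)) *
    foldr ps_mult (map (\<lambda>i. adams i (chr r V)) (sorted_list_of_multiset (cyc_type s P))) ps_one (gtype w X)"
proof -
  have s: "bij_betw s P P" using P(2) by (simp add: perms_on_def)
  obtain cs where cs: "distinct cs" "set cs = orb s ` P" "map card cs = sorted_list_of_multiset (cyc_type s P)"
    using cycles_list[OF P(1) s] .
  have "\<exists>p. is_cycle s p c" if "c \<in> set cs" for c using that is_cycle_orb[OF P(1) s] cs(2) by auto
  then show ?thesis
    using labelled_trace_list[OF V _ _ cs(1) X, of s] cs(2,3) orbs_partition[OF P(1) s] by simp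
qed

text \<open>Each factor scales lengths by a positive \<open>i\<close> and keeps types, so the
  products involve only variables allowed by \<open>chr_nonzero\<close>. This settles the monomials
  that no object realises.\<close>

lemma foldr_nonzero:
  assumes "foldr ps_mult (map (\<lambda>i. adams i (chr r V)) is) ps_one m \<noteq> 0" "0 \<notin> set is" "v \<in># m"
  shows "0 < fst v \<and> snd v \<in> mu"
  using assms
proof (induction "is" arbitrary: m)
  case Nil
  then show ?case by (auto simp: ps_one_def split: if_splits)
next
  case (Cons i "is")
  let ?G = "foldr ps_mult (map (\<lambda>i. adams i (chr r V)) is) ps_one"
  have "(\<Sum>A\<in>{A. A \<subseteq># m}. adams i (chr r V) A * ?G (m - A)) \<noteq> 0"
    using Cons.prems(1) by (simp add: ps_mult_def[of _ ?G])
  then obtain A where A: "A \<subseteq># m" "adams i (chr r V) A * ?G (m - A) \<noteq> 0"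
    by (metis (mono_tags, lifting) mem_Collect_eq sum.neutral)
  have i: "0 < i" using Cons.prems(2) by auto
  have "v \<in># A \<or> v \<in># m - A"
    using Cons.prems(3) A(1) by (metis subset_mset.add_diff_inverse union_iff)
  then show ?case
  proof
    assume v: "v \<in># A"
    obtain m' where m': "image_mset (\<lambda>(j, z). (i * j, z)) m' = A"
      using A(2) by (auto simp: adams_def split: if_splits)
    then have "chr r V m' \<noteq> 0" using A(2) adams_scale[OF i, of "chr r V" m'] by auto
    from chr_nonzero[OF this] show ?thesis using v i m' by force
  next
    assume "v \<in># m - A"
    then show ?thesis using Cons.IH[of "m - A"] A(2) Cons.prems(2) by auto
  qed
qed

lemma chr_comp_mod:
  fixes U :: "((complex \<times> nat) set, 'u) bmod"
  assumes U: "is_module obj1 hom1 U" and V: "is_module (objr r) (homr r) V" and V0: "basis V {} = {}"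
  shows "chr r (comp_mod r U V) = pleth (ch1 U) (chr r V)"
proof
  fix m :: "(nat \<times> complex) multiset"
  \<comment> \<open>Ensures label sets of every size among the sets of blocks.\<close>
  have inf: "infinite (UNIV :: (complex \<times> nat) set set)"
    by (simp add: finite_prod infinite_UNIV_char_0 Finite_Set.finite_set)
  let ?N = "sum_mset (image_mset fst m)"
  let ?P = "\<lambda>k. model_set k :: (complex \<times> nat) set set"
  let ?G = "\<lambda>\<mu>. foldr ps_mult (map (\<lambda>i. adams i (chr r V)) (sorted_list_of_multiset \<mu>)) ps_one m"
  have P: "finite (?P k)" "card (?P k) = k" for k using model_set[OF inf] by auto
  note pl = pleth_eq[OF inf, of U "chr r V" m]
  show "chr r (comp_mod r U V) m = pleth (ch1 U) (chr r V) m"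
  proof (cases "\<forall>v\<in>#m. 0 < fst v \<and> snd v \<in> mu")
    case True
    then obtain X w where X: "aut X w" "gtype w X = m" using gtype_exists by metis
    \<comment> \<open>Computed for every object of type \<open>m\<close>, and not only for the one
      just obtained, because \<open>chr_const\<close> needs the value on all of them.\<close>
    have "trace (comp_mod r U V) w X = of_nat (cent_order m) * pleth (ch1 U) (chr r V) m"
      if X: "aut X w" "gtype w X = m" for X w
    proof -
      let ?\<Psi> = "\<lambda>\<pi>. trace U (\<lambda>K. w ` K) \<pi> * tensor_trace V w (\<lambda>K. K) \<pi> (\<lambda>K. w ` K)"
      have "trace (comp_mod r U V) w X = (\<Sum>\<pi>\<in>stable_parts X w. ?\<Psi> \<pi>)"
        by (rule trace_comp_mod[OF U V X(1)])
      also have "\<dots> = (\<Sum>k\<le>?N. \<Sum>\<pi>\<in>{\<pi> \<in> stable_parts X w. card \<pi> = k}. ?\<Psi> \<pi>)"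
        using finite_stable_parts[OF aut_finite[OF X(1)]] card_stable_parts(2)[OF X(1)] X(2)
        by (intro sum.group[symmetric]) auto
      also have "\<dots> = (\<Sum>k\<le>?N. \<Sum>s\<in>perms_on (?P k). trace U s (?P k) / fact k * labelled_trace V w X (?P k) s)"
      proof (rule sum.cong[OF refl])
        fix k
        show "(\<Sum>\<pi>\<in>{\<pi> \<in> stable_parts X w. card \<pi> = k}. ?\<Psi> \<pi>)
            = (\<Sum>s\<in>perms_on (?P k). trace U s (?P k) / fact k * labelled_trace V w X (?P k) s)"
          using sum_labellings[OF U V0 X(1) P(1), of k] P(2)[of k]
          by (simp add: sum_divide_distrib[symmetric])
      qed
      also have "\<dots> = (\<Sum>k\<le>?N. \<Sum>s\<in>perms_on (?P k). trace U s (?P k) / fact k *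
          (of_nat (cent_order m) * ?G (cyc_type s (?P k))))"
        using labelled_trace_perm[OF V X(1) P(1)] X(2) by (intro sum.cong refl) simp
      also have "\<dots> = of_nat (cent_order m) * pleth (ch1 U) (chr r V) m"
        unfolding pl sum_distrib_left by (simp add: mult.left_commute)
      finally show ?thesis .
    qed
    then show ?thesis
      using chr_const[OF X(1), of "comp_mod r U V" "of_nat (cent_order m) * pleth (ch1 U) (chr r V) m"]
        X cent_order_gtype_pos[OF X(1)] by simp
  next
    case False
    have "?G (cyc_type s (?P k)) = 0" if "s \<in> perms_on (?P k)" for s k
    proof -
      have "0 \<notin> set (sorted_list_of_multiset (cyc_type s (?P k)))"
        using cyc_type_props(2)[OF P(1)] that by (simp add: perms_on_def)
      then show ?thesis using foldr_nonzero False by blast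
    qed
    then have "pleth (ch1 U) (chr r V) m = 0" unfolding pl by simp
    moreover have "chr r (comp_mod r U V) m = 0" using chr_nonzero False by blast
    ultimately show ?thesis by simp
  qed
qed

end

section \<open>From species to modules\<close>

lemma is_module_lin:
  assumes "is_species obj hom A" and obj: "\<And>I f. hom I f \<Longrightarrow> obj (f ` I)"
  shows "is_module obj hom (lin A)"
proof -
  have fin: "\<forall>I. obj I \<longrightarrow> finite (sset A I)"
    and bij: "\<forall>I f. hom I f \<longrightarrow> bij_betw (smap A f I) (sset A I) (sset A (f ` I))"
    and cong: "\<forall>I f g. hom I f \<longrightarrow> (\<forall>x\<in>I. f x = g x) \<longrightarrow> (\<forall>a\<in>sset A I. smap A f I a = smap A g I a)"
    and id: "\<forall>I. obj I \<longrightarrow> (\<forall>a\<in>sset A I. smap A id I a = a)"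
    and comp: "\<forall>I f g. hom I f \<longrightarrow> hom (f ` I) g \<longrightarrow>
      (\<forall>a\<in>sset A I. smap A (g \<circ> f) I a = smap A g (f ` I) (smap A f I a))"
    using assms(1) unfolding is_species_def by blast+
  show ?thesis
    unfolding is_module_def
  proof (intro conjI allI impI ballI)
    fix I assume "obj I"
    then show "finite (basis (lin A) I)" using fin by (simp add: lin_def)
  next
    fix I f g b b'
    assume h: "hom I f" "\<forall>x\<in>I. f x = g x" "b \<in> basis (lin A) I"
    have "smap A f I b = smap A g I b"
      using cong[rule_format, OF h(1) _, of g b] h(2,3) by (simp add: lin_def)
    then show "mat (lin A) f I b' b = mat (lin A) g I b' b" by (simp add: lin_def)
  next
    fix I b b'
    assume h: "obj I" "b \<in> basis (lin A) I"
    then have "smap A id I b = b" using id by (simp add: lin_def)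
    then show "mat (lin A) id I b' b = (if b' = b then 1 else 0)" by (auto simp: lin_def)
  next
    fix I f g b b''
    assume h: "hom I f" "hom (f ` I) g" "b \<in> basis (lin A) I" "b'' \<in> basis (lin A) (g ` f ` I)"
    have b: "b \<in> sset A I" using h(3) by (simp add: lin_def)
    let ?c = "smap A f I b"
    have bf: "bij_betw (smap A f I) (sset A I) (sset A (f ` I))"
      using bij h(1) by blast
    have c: "?c \<in> sset A (f ` I)" using bf b by (auto simp: bij_betw_def)
    have "(\<Sum>b'\<in>basis (lin A) (f ` I). mat (lin A) g (f ` I) b'' b' * mat (lin A) f I b' b)
        = (\<Sum>b'\<in>sset A (f ` I). if b' = ?c then mat (lin A) g (f ` I) b'' b' else 0)"
      by (rule sum.cong) (auto simp: lin_def)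
    also have "\<dots> = mat (lin A) g (f ` I) b'' ?c"
      using c fin obj[OF h(1)] by simp
    also have "\<dots> = mat (lin A) (g \<circ> f) I b'' b"
      using comp[rule_format, OF h(1,2) b] by (simp add: lin_def)
    finally show "mat (lin A) (g \<circ> f) I b'' b
        = (\<Sum>b'\<in>basis (lin A) (f ` I). mat (lin A) g (f ` I) b'' b' * mat (lin A) f I b' b)" by simp
  qed
qed

context root_sets
begin

text \<open>Both modules have the same basis, and only diagonal entries matter: a triple is fixed by
  \<open>w\<close> exactly when its partition, its structure on the partition and its structures on
  the blocks are fixed, which a product of indicators records.\<close>

lemma trace_comp_sp:
  assumes X: "aut X w"
  shows "trace (lin (comp_sp r A B)) w X = trace (comp_mod r (lin A) (lin B)) w X"
  unfolding trace_def
proof (rule sum.cong)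
  show "basis (lin (comp_sp r A B)) X = basis (comp_mod r (lin A) (lin B)) X"
    by (simp add: lin_def comp_sp_def comp_mod_def)
  fix b assume "b \<in> basis (comp_mod r (lin A) (lin B)) X"
  then obtain \<pi> a \<sigma> where b: "b = (\<pi>, a, \<sigma>)" "partition_on X \<pi>" "\<sigma> \<in> (\<Pi>\<^sub>E K\<in>\<pi>. sset B K)"
    by (auto simp: comp_mod_def lin_def)
  let ?w = "\<lambda>K. w ` K" and ?inv = "the_inv_into \<pi> (\<lambda>K. w ` K)"
  let ?\<sigma> = "\<lambda>K'. if K' \<in> ?w ` \<pi> then smap B w (?inv K') (\<sigma> (?inv K')) else undefined"
  have sub: "K \<subseteq> X" if "K \<in> \<pi>" for K using b(2) that by (auto simp: partition_on_def)
  have fin: "finite \<pi>"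
    by (rule finite_subset[of _ "Pow X"]) (use sub aut_finite[OF X] in auto)
  have "inj_on w X" using X by (simp add: aut_def bij_betw_def)
  then have inj: "inj_on ?w \<pi>"
    by (intro inj_on_subset[OF inj_on_image_Pow]) (use sub in auto)
  have inv: "?inv (w ` K) = K" if "K \<in> \<pi>" for K using the_inv_into_f_f[OF inj that] .
  \<comment> \<open>For a fixed partition, equality of the transported section with \<sigma> is a
    condition block by block: at the image of \<open>K\<close> it compares the transport of the
    structure on \<open>K\<close> with the structure already there. Off the partition both are
    \<open>undefined\<close>.\<close>
  have \<sigma>: "?\<sigma> = \<sigma> \<longleftrightarrow> (\<forall>K\<in>\<pi>. smap B w K (\<sigma> K) = \<sigma> (w ` K))" if \<pi>: "?w ` \<pi> = \<pi>"
  proof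
    assume eq: "?\<sigma> = \<sigma>"
    show "\<forall>K\<in>\<pi>. smap B w K (\<sigma> K) = \<sigma> (w ` K)"
    proof
      fix K assume "K \<in> \<pi>"
      then show "smap B w K (\<sigma> K) = \<sigma> (w ` K)" using fun_cong[OF eq, of "w ` K"] inv by simp
    qed
  next
    assume *: "\<forall>K\<in>\<pi>. smap B w K (\<sigma> K) = \<sigma> (w ` K)"
    show "?\<sigma> = \<sigma>"
    proof
      fix K'
      show "?\<sigma> K' = \<sigma> K'"
      proof (cases "K' \<in> ?w ` \<pi>")
        case True
        then obtain K where "K \<in> \<pi>" "K' = w ` K" by blast
        then show ?thesis using * inv by simp
      next
        case False
        then show ?thesis using b(3) \<pi> by (simp add: PiE_def extensional_def)
      qed
    qed
  qed
  have ind: "(\<Prod>K\<in>\<pi>. if Q K then 1 else 0) = (if \<forall>K\<in>\<pi>. Q K then 1 else (0 :: complex))" for Q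
    using fin by (induction rule: finite_induct) auto
  have "mat (lin (comp_sp r A B)) w X b b =
      (if ?w ` \<pi> = \<pi> \<and> smap A ?w \<pi> a = a \<and> ?\<sigma> = \<sigma> then 1 else 0)"
    by (simp add: b(1) lin_def comp_sp_def)
  also have "\<dots> = mat (comp_mod r (lin A) (lin B)) w X b b"
    using \<sigma> by (auto simp: b(1) lin_def comp_mod_def ind)
  finally show "mat (lin (comp_sp r A B)) w X b b = mat (comp_mod r (lin A) (lin B)) w X b b" .
qed

lemma chr_comp_sp: "chr r (lin (comp_sp r A B)) = chr r (comp_mod r (lin A) (lin B))"
proof
  fix m
  show "chr r (lin (comp_sp r A B)) m = chr r (comp_mod r (lin A) (lin B)) m"
    unfolding chr_def Let_def
    by (intro arg_cong2[where f = "(*)"] sum.cong refl trace_comp_sp) (auto simp: wreath_iff)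
qed

end

theorem theorem4p6:
  fixes r :: nat
    and U :: "((complex \<times> nat) set, 'u) bmod" and V :: "(complex \<times> nat, 'v) bmod"
    and A :: "((complex \<times> nat) set, 'c) spec" and B :: "(complex \<times> nat, 'd) spec"
  assumes "r \<ge> 1"
  shows "(is_module obj1 hom1 U \<and> is_module (objr r) (homr r) V \<and> basis V {} = {} \<longrightarrow>
            chr r (comp_mod r U V) = pleth (ch1 U) (chr r V)) \<and>
         (is_species obj1 hom1 A \<and> is_species (objr r) (homr r) B \<and> sset B {} = {} \<longrightarrow>
            chr r (lin (comp_sp r A B)) = pleth (ch1 (lin A)) (chr r (lin B)))"
proof -
  interpret root_sets r using assms by unfold_locales
  show ?thesis
  proof (intro conjI impI)
    assume "is_module obj1 hom1 U \<and> is_module (objr r) (homr r) V \<and> basis V {} = {}"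
    then show "chr r (comp_mod r U V) = pleth (ch1 U) (chr r V)"
      using chr_comp_mod by blast
  next
    assume *: "is_species obj1 hom1 A \<and> is_species (objr r) (homr r) B \<and> sset B {} = {}"
    then have "is_module obj1 hom1 (lin A)" "is_module (objr r) (homr r) (lin B)"
      by (auto intro!: is_module_lin simp: hom1_def obj1_def homr_def)
    moreover have "basis (lin B) {} = {}" using * by (simp add: lin_def)
    ultimately show "chr r (lin (comp_sp r A B)) = pleth (ch1 (lin A)) (chr r (lin B))"
      unfolding chr_comp_sp by (rule chr_comp_mod)
  qed
qed

end
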